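(* Let $(\mathbb X,T_\bullet)$ and $(\mathbb X',T'_\bullet)$ be tangent actegories, where $\mathbb X$ has a terminal object $*$, and let $(F,\hat\alpha):(\mathbb X,T_\bullet)\to(\mathbb X',T'_\bullet)$ be an oplax $\mathrm{Weil}$-linear functor. Let $(X,\sigma,\zeta,\lambda)$ be a differential object in $\mathbb X$ (with addition $\sigma:X^2\to X$, zero $\zeta:*\to X$, lift $\lambda:X\to T_WX$ and projection $!:X\to *$). (a) If $(F,\hat\alpha)$ is a lax differential functor, then $F(X)$ over $F( * )$ with projection $F(!)$, addition $F(\sigma)$, zero section $F(\zeta)$ and lift $\hat\alpha_{W,X}\circ F(\lambda)$ is a differential bundle in $\mathbb X'$. (b) If $(F,\hat\alpha)$ is a strong differential functor, then the same data form a differential object in $\mathbb X'$.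
   Context: **Weil algebras and tangent actegories.** $\mathrm{Weil}$ is the category whose objects are the commutative $\mathbb N$-algebras (semirings) $\mathbb N[x_1,\dots,x_n]/\langle x_ix_j\mid i\sim j\rangle$ for an equivalence relation $\sim$ on $\{1,\dots,n\}$, with unital $\mathbb N$-linear semiring homomorphisms as morphisms. It is monoidal under the coproduct $\otimes$ with unit $\mathbb N$ (also terminal). $W=\mathbb N[x]/\langle x^2\rangle$; $W^n=\mathbb N[x_1,\dots,x_n]/\langle x_ix_j \mid \text{all } i,j\rangle$ is the $n$-fold product in $\mathrm{Weil}$; every object has the form $W^{n_1}\otimes\cdots\otimes W^{n_k}$. Distinguished morphisms: $p:W\to\mathbb N$, $ax+b\mapsto b$; $0:\mathbb N\to W$ the inclusion; $+:W\times W\to W$, $ax_1+bx_2+c\mapsto (a+b)x+c$; $\ell:W\to W\otimes W$, $ax+b\mapsto ax_1x_2+b$; $c:W\otimes W\to W\otimes W$ swapping $x_1,x_2$. A $\mathrm{Weil}$-actegory $(\mathbb X,T_\bullet)$ is a category with a functor $T_\bullet:\mathrm{Weil}\times\mathbb X\to\mathbb X$ and natural isomorphisms $X\cong T_\bullet(\mathbb N,X)$, $T_\bullet(A,T_\bullet(B,X))\cong T_\bullet(A\otimes B,X)$ satisfying the usual associativity and unit coherences. Write $T_A=T_\bullet(A,-)$ and $T_\theta$ for the natural transformation given by a morphism $\theta$ of $\mathrm{Weil}$. It is a tangent actegory if for each object $X$ the functor $T_{(-)}(X)$ sends to pullbacks: (i) the squares exhibiting $A\otimes(B\times C)$ as the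 pullback of $A\otimes B\to A\leftarrow A\otimes C$, whenever $B\times C$ exists in $\mathrm{Weil}$; (ii) the squares obtained by applying $W^{\otimes n}\otimes-$, $n\ge0$, to the pullback square with top $\nu:W\times W\to W\otimes W$, $\nu(ax_1+bx_2+c)=ax_1x_2+bx_2+c$, right side $1_W\otimes p:W\otimes W\to W$, left side the unique map $W\times W\to\mathbb N$ and bottom $0:\mathbb N\to W$. Tangent categories are identified with tangent actegories, with tangent functor $T:=T_W$ and structure maps $p:=T_p,\ 0:=T_0,\ +:=T_+,\ \ell:=T_\ell,\ c:=T_c$, under the identifications $T_{W\otimes W}=T\circ T$, $T_n:=T_{W^n}$. **Differential bundles.** An additive bundle $(X,A,p,+,0)$: a morphism $p:X\to A$ with pullback powers $X_n$ of $p$ over $A$, and $+:X_2\to X$, $0:A\to X$ with $p\circ +=p\circ\pi_0=p\circ\pi_1$, $p\circ0=1_A$, and $+$ associative, commutative and with unit $0$. An additive bundle morphism $(f,g)$ is a pair $f:X\to Y$, $g:A\to B$ with $p'f=gp$, $f\circ+=+'\circ f_2$, $f\circ0=0'\circ g$. A differential bundle $(E,M,q,\zeta,\sigma,\lambda)$ in $(\mathbb X,T)$ consists of $q:E\to M$ whose finite pullback powers $E_n$ exist and are preserved by all $T^k$; $\zeta:M\to E$, $\sigma:E_2\to E$ making $(E,M,q,\sigma,\zeta)$ an additive bundle; and $\lambda:E\to TE$ such that $(\lambda,0_M)$ is an additive bundle morphism to $(TE,TM,Tq,T\sigma,T\zeta)$, $(\lambda,\zeta)$ is an additive bundle morphism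 to $(TE,E,p_E,+_E,0_E)$, $\ell_E\circ\lambda=T(\lambda)\circ\lambda$, and the square with top $T(\sigma)\circ\langle\lambda\pi_0,0\pi_1\rangle:E_2\to TE$, left $q\pi_0:E_2\to M$, bottom $0_M:M\to TM$, right $T(q)$ is a pullback. A differential object is a differential bundle over a terminal object. **Differential functors.** An oplax $\mathrm{Weil}$-linear functor $(F,\hat\alpha):(\mathbb X,T_\bullet)\to(\mathbb X',T'_\bullet)$ is a functor $F$ with a natural transformation $\hat\alpha:F\circ T_\bullet\Rightarrow T'_\bullet\circ(1\times F)$, components $\hat\alpha_{A,X}:F(T_AX)\to T'_A(FX)$, satisfying (modulo the structure isomorphisms) $\hat\alpha_{A\otimes B,X}=T'_A(\hat\alpha_{B,X})\circ\hat\alpha_{A,T_BX}$ and $\hat\alpha_{\mathbb N,X}=1_{FX}$. Suppose $\mathbb X$ has a terminal object $*$. $(F,\hat\alpha)$ is a lax differential functor if for all $A\in\mathrm{Weil}$: (a) $T'_A\circ F$ preserves pullbacks over $*$, and (b) all naturality squares of $\hat\alpha_{A,-}:F\circ T_A\Rightarrow T'_A\circ F$ are pullbacks. It is a strong differential functor if moreover $F( * )$ is terminal in $\mathbb X'$.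
   Formalization: The formal theorem additionally assumes that T_W( * ) is again terminal in the source category; without this the stated claim fails, since the universality square of X lies over 0: * → T( * ), which F need not preserve as a pullback. *)

theory Defs
  imports "HOL-Algebra.Ring" "HOL-Library.Poly_Mapping"
begin

section \<open>Categories\<close>

record ('o, 'm) cat =
  Obj :: "'o set"
  Arr :: "'m set"
  Dom :: "'m \<Rightarrow> 'o"
  Cod :: "'m \<Rightarrow> 'o"
  Id :: "'o \<Rightarrow> 'm"
  Comp :: "'m \<Rightarrow> 'm \<Rightarrow> 'm"  (infixr "\<odot>\<index>" 70)

definition Hom :: "('o, 'm, 'z) cat_scheme \<Rightarrow> 'o \<Rightarrow> 'o \<Rightarrow> 'm set"
  where "Hom C X Y = {f \<in> Arr C. Dom C f = X \<and> Cod C f = Y}"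

locale category =
  fixes C (structure)
  assumes dom_obj: "f \<in> Arr C \<Longrightarrow> Dom C f \<in> Obj C"
    and cod_obj: "f \<in> Arr C \<Longrightarrow> Cod C f \<in> Obj C"
    and id_hom: "X \<in> Obj C \<Longrightarrow> Id C X \<in> Hom C X X"
    and comp_hom: "\<lbrakk>f \<in> Hom C X Y; g \<in> Hom C Y Z\<rbrakk> \<Longrightarrow> g \<odot> f \<in> Hom C X Z"
    and comp_assoc: "\<lbrakk>f \<in> Hom C X Y; g \<in> Hom C Y Z; h \<in> Hom C Z V\<rbrakk>
      \<Longrightarrow> (h \<odot> g) \<odot> f = h \<odot> (g \<odot> f)"
    and comp_id_left: "f \<in> Hom C X Y \<Longrightarrow> Id C Y \<odot> f = f"
    and comp_id_right: "f \<in> Hom C X Y \<Longrightarrow> f \<odot> Id C X = f"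

definition prod_cat :: "('o, 'm, 'y) cat_scheme \<Rightarrow> ('p, 'n, 'z) cat_scheme \<Rightarrow> ('o \<times> 'p, 'm \<times> 'n) cat"
  where "prod_cat C D =
    \<lparr> Obj = Obj C \<times> Obj D, Arr = Arr C \<times> Arr D,
      Dom = map_prod (Dom C) (Dom D), Cod = map_prod (Cod C) (Cod D),
      Id = map_prod (Id C) (Id D),
      Comp = (\<lambda>(g, g') (f, f'). (g \<odot>\<^bsub>C\<^esub> f, g' \<odot>\<^bsub>D\<^esub> f')) \<rparr>"

subsection \<open>Functors and natural transformations\<close>

record ('o, 'm, 'p, 'n) ftor =
  FO :: "'o \<Rightarrow> 'p"
  FA :: "'m \<Rightarrow> 'n"

definition is_functor ::
    "('o, 'm, 'y) cat_scheme \<Rightarrow> ('p, 'n, 'z) cat_scheme \<Rightarrow> ('o, 'm, 'p, 'n) ftor \<Rightarrow> bool"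
  where "is_functor C D F \<longleftrightarrow>
    (\<forall>X\<in>Obj C. FO F X \<in> Obj D) \<and>
    (\<forall>f\<in>Arr C. FA F f \<in> Hom D (FO F (Dom C f)) (FO F (Cod C f))) \<and>
    (\<forall>X\<in>Obj C. FA F (Id C X) = Id D (FO F X)) \<and>
    (\<forall>f\<in>Arr C. \<forall>g\<in>Arr C. Dom C g = Cod C f \<longrightarrow> FA F (g \<odot>\<^bsub>C\<^esub> f) = FA F g \<odot>\<^bsub>D\<^esub> FA F f)"

definition id_ftor :: "('o, 'm, 'o, 'm) ftor"
  where "id_ftor = \<lparr> FO = id, FA = id \<rparr>"

definition comp_ftor :: "('p, 'n, 'q, 'l) ftor \<Rightarrow> ('o, 'm, 'p, 'n) ftor \<Rightarrow> ('o, 'm, 'q, 'l) ftor"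
    (infixr "\<circ>\<^sub>F" 75)
  where "G \<circ>\<^sub>F F = \<lparr> FO = FO G \<circ> FO F, FA = FA G \<circ> FA F \<rparr>"

definition prod_ftor ::
    "('o, 'm, 'p, 'n) ftor \<Rightarrow> ('o', 'm', 'p', 'n') ftor \<Rightarrow> ('o \<times> 'o', 'm \<times> 'm', 'p \<times> 'p', 'n \<times> 'n') ftor"
    (infixr "\<times>\<^sub>F" 76)
  where "F \<times>\<^sub>F G = \<lparr> FO = map_prod (FO F) (FO G), FA = map_prod (FA F) (FA G) \<rparr>"

definition ftor_power :: "nat \<Rightarrow> ('o, 'm, 'o, 'm) ftor \<Rightarrow> ('o, 'm, 'o, 'm) ftor"
  where "ftor_power k F = \<lparr> FO = FO F ^^ k, FA = FA F ^^ k \<rparr>"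

definition natural_transformation ::
    "('o, 'm, 'y) cat_scheme \<Rightarrow> ('p, 'n, 'z) cat_scheme \<Rightarrow>
     ('o, 'm, 'p, 'n) ftor \<Rightarrow> ('o, 'm, 'p, 'n) ftor \<Rightarrow> ('o \<Rightarrow> 'n) \<Rightarrow> bool"
  where "natural_transformation C D F G \<tau> \<longleftrightarrow>
    is_functor C D F \<and> is_functor C D G \<and>
    (\<forall>X\<in>Obj C. \<tau> X \<in> Hom D (FO F X) (FO G X)) \<and>
    (\<forall>f\<in>Arr C. \<tau> (Cod C f) \<odot>\<^bsub>D\<^esub> FA F f = FA G f \<odot>\<^bsub>D\<^esub> \<tau> (Dom C f))"

definition inverse_arrows :: "('o, 'm, 'z) cat_scheme \<Rightarrow> 'm \<Rightarrow> 'm \<Rightarrow> bool"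
  where "inverse_arrows C f g \<longleftrightarrow>
    f \<in> Arr C \<and> g \<in> Hom C (Cod C f) (Dom C f) \<and>
    g \<odot>\<^bsub>C\<^esub> f = Id C (Dom C f) \<and> f \<odot>\<^bsub>C\<^esub> g = Id C (Cod C f)"

definition inv_arr :: "('o, 'm, 'z) cat_scheme \<Rightarrow> 'm \<Rightarrow> 'm"
  where "inv_arr C f = (THE g. inverse_arrows C f g)"

definition natural_isomorphism ::
    "('o, 'm, 'y) cat_scheme \<Rightarrow> ('p, 'n, 'z) cat_scheme \<Rightarrow>
     ('o, 'm, 'p, 'n) ftor \<Rightarrow> ('o, 'm, 'p, 'n) ftor \<Rightarrow> ('o \<Rightarrow> 'n) \<Rightarrow> bool"
  where "natural_isomorphism C D F G \<tau> \<longleftrightarrow>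
    natural_transformation C D F G \<tau> \<and> (\<forall>X\<in>Obj C. \<exists>g. inverse_arrows D (\<tau> X) g)"

subsection \<open>Limits\<close>

definition terminal :: "('o, 'm, 'z) cat_scheme \<Rightarrow> 'o \<Rightarrow> bool"
  where "terminal C X \<longleftrightarrow> X \<in> Obj C \<and> (\<forall>Y\<in>Obj C. \<exists>!f. f \<in> Hom C Y X)"

definition is_product :: "('o, 'm, 'z) cat_scheme \<Rightarrow> 'o \<Rightarrow> 'o \<Rightarrow> 'o \<Rightarrow> 'm \<Rightarrow> 'm \<Rightarrow> bool"
  where "is_product C X Y P p q \<longleftrightarrow>
    X \<in> Obj C \<and> Y \<in> Obj C \<and> P \<in> Obj C \<and> p \<in> Hom C P X \<and> q \<in> Hom C P Y \<and>
    (\<forall>Z\<in>Obj C. \<forall>a\<in>Hom C Z X. \<forall>b\<in>Hom C Z Y.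
      \<exists>!h. h \<in> Hom C Z P \<and> p \<odot>\<^bsub>C\<^esub> h = a \<and> q \<odot>\<^bsub>C\<^esub> h = b)"

text \<open>\<open>is_pullback C p q f g\<close>: the square \<open>f p = g q\<close> is a pullback, i.e. \<open>p\<close> and \<open>q\<close> are the
  projections of a pullback of the cospan \<open>f\<close>, \<open>g\<close>.\<close>

definition is_pullback :: "('o, 'm, 'z) cat_scheme \<Rightarrow> 'm \<Rightarrow> 'm \<Rightarrow> 'm \<Rightarrow> 'm \<Rightarrow> bool"
  where "is_pullback C p q f g \<longleftrightarrow>
    p \<in> Arr C \<and> q \<in> Arr C \<and> f \<in> Arr C \<and> g \<in> Arr C \<and>
    Dom C p = Dom C q \<and> Cod C p = Dom C f \<and> Cod C q = Dom C g \<and> Cod C f = Cod C g \<and>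
    f \<odot>\<^bsub>C\<^esub> p = g \<odot>\<^bsub>C\<^esub> q \<and>
    (\<forall>Z\<in>Obj C. \<forall>a\<in>Hom C Z (Dom C f). \<forall>b\<in>Hom C Z (Dom C g). f \<odot>\<^bsub>C\<^esub> a = g \<odot>\<^bsub>C\<^esub> b \<longrightarrow>
      (\<exists>!h. h \<in> Hom C Z (Dom C p) \<and> p \<odot>\<^bsub>C\<^esub> h = a \<and> q \<odot>\<^bsub>C\<^esub> h = b))"

text \<open>The arrow \<open>\<langle>a, b\<rangle>\<close> into a pullback with projections \<open>p\<close> and \<open>q\<close>.\<close>

definition pairing :: "('o, 'm, 'z) cat_scheme \<Rightarrow> 'm \<Rightarrow> 'm \<Rightarrow> 'm \<Rightarrow> 'm \<Rightarrow> 'm"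
  where "pairing C p q a b =
    (THE h. h \<in> Hom C (Dom C a) (Dom C p) \<and> p \<odot>\<^bsub>C\<^esub> h = a \<and> q \<odot>\<^bsub>C\<^esub> h = b)"

text \<open>\<open>P\<close>, with projections \<open>\<pi> i\<close> for \<open>i < n\<close> and structure map \<open>b\<close> to the base, is the \<open>n\<close>-fold
  pullback power of \<open>q\<close>.  The structure map makes the case \<open>n = 0\<close> (the base itself) uniform.\<close>

definition is_pullback_power ::
    "('o, 'm, 'z) cat_scheme \<Rightarrow> 'm \<Rightarrow> nat \<Rightarrow> 'o \<Rightarrow> 'm \<Rightarrow> (nat \<Rightarrow> 'm) \<Rightarrow> bool"
  where "is_pullback_power C q n P b \<pi> \<longleftrightarrow>
    q \<in> Arr C \<and> P \<in> Obj C \<and> b \<in> Hom C P (Cod C q) \<and>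
    (\<forall>i<n. \<pi> i \<in> Hom C P (Dom C q) \<and> q \<odot>\<^bsub>C\<^esub> \<pi> i = b) \<and>
    (\<forall>Z\<in>Obj C. \<forall>z\<in>Hom C Z (Cod C q). \<forall>a.
      (\<forall>i<n. a i \<in> Hom C Z (Dom C q) \<and> q \<odot>\<^bsub>C\<^esub> a i = z) \<longrightarrow>
      (\<exists>!h. h \<in> Hom C Z P \<and> b \<odot>\<^bsub>C\<^esub> h = z \<and> (\<forall>i<n. \<pi> i \<odot>\<^bsub>C\<^esub> h = a i)))"

section \<open>Weil algebras\<close>

text \<open>An object of \<open>Weil\<close> is a pair \<open>(n, R)\<close> with \<open>R\<close> an equivalence relation on \<open>{1..n}\<close>.
  It stands for the semiring of polynomials in \<open>x\<^sub>1, \<dots>, x\<^sub>n\<close> over the naturals, modulo the ideal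
  generated by the products \<open>x\<^sub>i x\<^sub>j\<close> with \<open>(i, j) \<in> R\<close>.  As usual for semirings, the quotient by
  an ideal \<open>I\<close> is the quotient by the least congruence making \<open>I\<close> zero: \<open>P \<sim> Q\<close> iff
  \<open>P + S = Q + S'\<close> for some \<open>S, S' \<in> I\<close>.\<close>

type_synonym npoly = "(nat \<Rightarrow>\<^sub>0 nat) \<Rightarrow>\<^sub>0 nat"
type_synonym weil_obj = "nat \<times> (nat \<times> nat) set"
type_synonym weil_elt = "npoly set"
type_synonym weil_arr = "weil_obj \<times> (weil_elt \<Rightarrow> weil_elt) \<times> weil_obj"

definition var :: "nat \<Rightarrow> npoly"
  where "var i = Poly_Mapping.single (Poly_Mapping.single i 1) 1"

definition npolys :: "nat \<Rightarrow> npoly set"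
  where "npolys n = {P. \<forall>m\<in>Poly_Mapping.keys P. Poly_Mapping.keys m \<subseteq> {1..n}}"

inductive_set weil_ideal :: "weil_obj \<Rightarrow> npoly set" for A :: weil_obj
  where
    zero: "0 \<in> weil_ideal A"
  | gen: "\<lbrakk>(i, j) \<in> snd A; P \<in> npolys (fst A)\<rbrakk> \<Longrightarrow> P * (var i * var j) \<in> weil_ideal A"
  | add: "\<lbrakk>P \<in> weil_ideal A; Q \<in> weil_ideal A\<rbrakk> \<Longrightarrow> P + Q \<in> weil_ideal A"

definition weil_rel :: "weil_obj \<Rightarrow> (npoly \<times> npoly) set"
  where "weil_rel A = {(P, Q). P \<in> npolys (fst A) \<and> Q \<in> npolys (fst A) \<and>
    (\<exists>S\<in>weil_ideal A. \<exists>S'\<in>weil_ideal A. P + S = Q + S')}"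

definition weil_class :: "weil_obj \<Rightarrow> npoly \<Rightarrow> weil_elt"
  where "weil_class A P = weil_rel A `` {P}"

definition weil_alg :: "weil_obj \<Rightarrow> weil_elt ring"
  where "weil_alg A =
    \<lparr> carrier = npolys (fst A) // weil_rel A,
      monoid.mult = (\<lambda>a b. \<Union>P\<in>a. \<Union>Q\<in>b. weil_class A (P * Q)),
      one = weil_class A 1,
      ring.zero = weil_class A 0,
      ring.add = (\<lambda>a b. \<Union>P\<in>a. \<Union>Q\<in>b. weil_class A (P + Q)) \<rparr>"

text \<open>\<^const>\<open>ring_hom\<close> does not ask for preservation of zero, which is not automatic for semirings.\<close>

definition weil_homs :: "weil_obj \<Rightarrow> weil_obj \<Rightarrow> (weil_elt \<Rightarrow> weil_elt) set"
  where "weil_homs A B =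
    {\<theta> \<in> ring_hom (weil_alg A) (weil_alg B) \<inter> extensional (carrier (weil_alg A)).
      \<theta> \<zero>\<^bsub>weil_alg A\<^esub> = \<zero>\<^bsub>weil_alg B\<^esub>}"

definition Weil :: "(weil_obj, weil_arr) cat"
  where "Weil =
    \<lparr> Obj = {(n, R). equiv {1..n} R},
      Arr = {(A, \<theta>, B). equiv {1..fst A} (snd A) \<and> equiv {1..fst B} (snd B) \<and> \<theta> \<in> weil_homs A B},
      Dom = (\<lambda>(A, \<theta>, B). A),
      Cod = (\<lambda>(A, \<theta>, B). B),
      Id = (\<lambda>A. (A, (\<lambda>a\<in>carrier (weil_alg A). a), A)),
      Comp = (\<lambda>(B, \<phi>, C) (A, \<theta>, B'). (A, compose (carrier (weil_alg A)) \<phi> \<theta>, C)) \<rparr>"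

text \<open>The morphism \<open>A \<rightarrow> B\<close> sending each generator \<open>x\<^sub>i\<close> to \<open>u i\<close>; there is at most one, and there
  is one iff \<open>u i u j = 0\<close> whenever \<open>x\<^sub>i x\<^sub>j = 0\<close>.\<close>

definition weil_gen :: "weil_obj \<Rightarrow> weil_obj \<Rightarrow> (nat \<Rightarrow> weil_elt) \<Rightarrow> weil_arr"
  where "weil_gen A B u =
    (A, (THE \<theta>. \<theta> \<in> weil_homs A B \<and> (\<forall>i\<in>{1..fst A}. \<theta> (weil_class A (var i)) = u i)), B)"

subsection \<open>The monoidal structure\<close>

definition weil_unit :: weil_obj  ("\<N>")
  where "\<N> = (0, {})"

text \<open>With this presentation of the coproduct, \<open>\<otimes>\<close> is strictly associative and unital, the
  coherence isomorphisms of the coproduct being identities.\<close>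

definition weil_tensor :: "weil_obj \<Rightarrow> weil_obj \<Rightarrow> weil_obj"  (infixr "\<otimes>\<^sub>W" 75)
  where "A \<otimes>\<^sub>W B = (fst A + fst B, snd A \<union> (\<lambda>(i, j). (fst A + i, fst A + j)) ` snd B)"

definition weil_inl :: "weil_obj \<Rightarrow> weil_obj \<Rightarrow> weil_arr"
  where "weil_inl A B = weil_gen A (A \<otimes>\<^sub>W B) (\<lambda>i. weil_class (A \<otimes>\<^sub>W B) (var i))"

definition weil_inr :: "weil_obj \<Rightarrow> weil_obj \<Rightarrow> weil_arr"
  where "weil_inr A B = weil_gen B (A \<otimes>\<^sub>W B) (\<lambda>i. weil_class (A \<otimes>\<^sub>W B) (var (fst A + i)))"

definition weil_tensor_arr :: "weil_arr \<Rightarrow> weil_arr \<Rightarrow> weil_arr"  (infixr "\<otimes>\<^sub>A" 75)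
  where "f \<otimes>\<^sub>A g =
    (let A = Dom Weil f; B = Dom Weil g; A' = Cod Weil f; B' = Cod Weil g in
      THE h. h \<in> Hom Weil (A \<otimes>\<^sub>W B) (A' \<otimes>\<^sub>W B') \<and>
        h \<odot>\<^bsub>Weil\<^esub> weil_inl A B = weil_inl A' B' \<odot>\<^bsub>Weil\<^esub> f \<and>
        h \<odot>\<^bsub>Weil\<^esub> weil_inr A B = weil_inr A' B' \<odot>\<^bsub>Weil\<^esub> g)"

subsection \<open>Distinguished objects and morphisms\<close>

text \<open>\<open>weil_pow n\<close> is \<open>W\<^sup>n\<close>, and \<open>weil_tpow n\<close> is the \<open>n\<close>-th tensor power of \<open>W\<close>.\<close>

definition weil_pow :: "nat \<Rightarrow> weil_obj"
  where "weil_pow n = (n, {1..n} \<times> {1..n})"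

definition W :: weil_obj
  where "W = weil_pow 1"

primrec weil_tpow :: "nat \<Rightarrow> weil_obj"
  where
    "weil_tpow 0 = \<N>"
  | "weil_tpow (Suc n) = W \<otimes>\<^sub>W weil_tpow n"

definition weil_bang :: "weil_obj \<Rightarrow> weil_arr"
  where "weil_bang A = weil_gen A \<N> (\<lambda>_. weil_class \<N> 0)"

definition weil_p :: weil_arr
  where "weil_p = weil_gen W \<N> (\<lambda>_. weil_class \<N> 0)"

text \<open>\<open>\<N>\<close> has no generators, so the choice of images is immaterial.\<close>

definition weil_0 :: weil_arr
  where "weil_0 = weil_gen \<N> W (\<lambda>_. weil_class W 0)"

definition weil_plus :: weil_arr
  where "weil_plus = weil_gen (weil_pow 2) W (\<lambda>_. weil_class W (var 1))"

definition weil_l :: weil_arr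
  where "weil_l = weil_gen W (W \<otimes>\<^sub>W W) (\<lambda>_. weil_class (W \<otimes>\<^sub>W W) (var 1 * var 2))"

definition weil_nu :: weil_arr
  where "weil_nu = weil_gen (weil_pow 2) (W \<otimes>\<^sub>W W)
    (\<lambda>i. weil_class (W \<otimes>\<^sub>W W) (if i = 1 then var 1 * var 2 else var 2))"

text \<open>The projections of the product \<open>W \<times> W = W\<^sup>2\<close>: \<open>weil_proj k\<close> sends \<open>a\<^sub>1 x\<^sub>1 + a\<^sub>2 x\<^sub>2 + c\<close> to
  \<open>a\<^sub>k x + c\<close>.\<close>

definition weil_proj :: "nat \<Rightarrow> weil_arr"
  where "weil_proj k = weil_gen (weil_pow 2) W (\<lambda>i. weil_class W (if i = k then var 1 else 0))"

section \<open>Weil actegories and tangent actegories\<close>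

text \<open>\<open>act\<close> is \<open>T\<^sub>\<bullet>\<close>; \<open>unit_iso X : X \<rightarrow> T(\<N>, X)\<close> and
  \<open>mult_iso (A, B, X) : T(A, T(B, X)) \<rightarrow> T(A \<otimes> B, X)\<close> are the structure isomorphisms.\<close>

record ('o, 'm) wact = "('o, 'm) cat" +
  act :: "(weil_obj \<times> 'o, weil_arr \<times> 'm, 'o, 'm) ftor"
  unit_iso :: "'o \<Rightarrow> 'm"
  mult_iso :: "weil_obj \<times> weil_obj \<times> 'o \<Rightarrow> 'm"

text \<open>\<open>T_fun X A\<close> is the endofunctor \<open>T\<^sub>A\<close>; \<open>T_nat X \<theta> Y\<close> is the component at \<open>Y\<close> of \<open>T\<^sub>\<theta>\<close>.\<close>

definition T_fun :: "('o, 'm, 'z) wact_scheme \<Rightarrow> weil_obj \<Rightarrow> ('o, 'm, 'o, 'm) ftor"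
  where "T_fun \<X> A =
    \<lparr> FO = (\<lambda>Y. FO (act \<X>) (A, Y)), FA = (\<lambda>f. FA (act \<X>) (Id Weil A, f)) \<rparr>"

definition T_nat :: "('o, 'm, 'z) wact_scheme \<Rightarrow> weil_arr \<Rightarrow> 'o \<Rightarrow> 'm"
  where "T_nat \<X> \<theta> Y = FA (act \<X>) (\<theta>, Id \<X> Y)"

locale weil_actegory = category \<X> for \<X> :: "('o, 'm, 'z) wact_scheme" (structure) +
  assumes act_functor: "is_functor (prod_cat Weil \<X>) \<X> (act \<X>)"
    and unit_iso: "natural_isomorphism \<X> \<X> id_ftor (T_fun \<X> \<N>) (unit_iso \<X>)"
    and mult_iso: "natural_isomorphism (prod_cat Weil (prod_cat Weil \<X>)) \<X>
      (act \<X> \<circ>\<^sub>F (id_ftor \<times>\<^sub>F act \<X>))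
      \<lparr> FO = (\<lambda>(A, B, Y). FO (act \<X>) (A \<otimes>\<^sub>W B, Y)), FA = (\<lambda>(f, g, h). FA (act \<X>) (f \<otimes>\<^sub>A g, h)) \<rparr>
      (mult_iso \<X>)"
    and assoc_coherence: "\<lbrakk>A \<in> Obj Weil; B \<in> Obj Weil; D \<in> Obj Weil; Y \<in> Obj \<X>\<rbrakk> \<Longrightarrow>
      mult_iso \<X> (A \<otimes>\<^sub>W B, D, Y) \<odot> mult_iso \<X> (A, B, FO (T_fun \<X> D) Y) =
      mult_iso \<X> (A, B \<otimes>\<^sub>W D, Y) \<odot> FA (T_fun \<X> A) (mult_iso \<X> (B, D, Y))"
    and unit_coherence_left: "\<lbrakk>A \<in> Obj Weil; Y \<in> Obj \<X>\<rbrakk> \<Longrightarrow>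
      mult_iso \<X> (\<N>, A, Y) \<odot> unit_iso \<X> (FO (T_fun \<X> A) Y) = Id \<X> (FO (T_fun \<X> A) Y)"
    and unit_coherence_right: "\<lbrakk>A \<in> Obj Weil; Y \<in> Obj \<X>\<rbrakk> \<Longrightarrow>
      mult_iso \<X> (A, \<N>, Y) \<odot> FA (T_fun \<X> A) (unit_iso \<X> Y) = Id \<X> (FO (T_fun \<X> A) Y)"

locale tangent_actegory = weil_actegory \<X> for \<X> :: "('o, 'm, 'z) wact_scheme" (structure) +
  assumes tensor_product_pullback:
    "\<lbrakk>A \<in> Obj Weil; is_product Weil B D P p q; Y \<in> Obj \<X>\<rbrakk> \<Longrightarrow>
      is_pullback \<X>
        (T_nat \<X> (Id Weil A \<otimes>\<^sub>A p) Y) (T_nat \<X> (Id Weil A \<otimes>\<^sub>A q) Y)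
        (T_nat \<X> (Id Weil A \<otimes>\<^sub>A weil_bang B) Y) (T_nat \<X> (Id Weil A \<otimes>\<^sub>A weil_bang D) Y)"
    and vertical_lift_pullback:
    "Y \<in> Obj \<X> \<Longrightarrow>
      is_pullback \<X>
        (T_nat \<X> (Id Weil (weil_tpow n) \<otimes>\<^sub>A weil_nu) Y)
        (T_nat \<X> (Id Weil (weil_tpow n) \<otimes>\<^sub>A weil_bang (weil_pow 2)) Y)
        (T_nat \<X> (Id Weil (weil_tpow n) \<otimes>\<^sub>A (Id Weil W \<otimes>\<^sub>A weil_p)) Y)
        (T_nat \<X> (Id Weil (weil_tpow n) \<otimes>\<^sub>A weil_0) Y)"

text \<open>The tangent functor and its structure maps.  The structure isomorphisms of the actegory
  implement the identifications \<open>T\<^sub>\<N> = id\<close> and \<open>T\<^bsub>W \<otimes> W\<^esub> = T \<circ> T\<close>; the domain of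
  \<open>tangent_plus\<close> is \<open>T\<^sub>2 = T\<^bsub>W\<^sup>2\<^esub>\<close>, with projections \<open>tangent_proj 1\<close> and \<open>tangent_proj 2\<close>.\<close>

definition tangent :: "('o, 'm, 'z) wact_scheme \<Rightarrow> ('o, 'm, 'o, 'm) ftor"
  where "tangent \<X> = T_fun \<X> W"

definition tangent_p :: "('o, 'm, 'z) wact_scheme \<Rightarrow> 'o \<Rightarrow> 'm"
  where "tangent_p \<X> Y = inv_arr \<X> (unit_iso \<X> Y) \<odot>\<^bsub>\<X>\<^esub> T_nat \<X> weil_p Y"

definition tangent_0 :: "('o, 'm, 'z) wact_scheme \<Rightarrow> 'o \<Rightarrow> 'm"
  where "tangent_0 \<X> Y = T_nat \<X> weil_0 Y \<odot>\<^bsub>\<X>\<^esub> unit_iso \<X> Y"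

definition tangent_plus :: "('o, 'm, 'z) wact_scheme \<Rightarrow> 'o \<Rightarrow> 'm"
  where "tangent_plus \<X> Y = T_nat \<X> weil_plus Y"

definition tangent_proj :: "('o, 'm, 'z) wact_scheme \<Rightarrow> nat \<Rightarrow> 'o \<Rightarrow> 'm"
  where "tangent_proj \<X> k Y = T_nat \<X> (weil_proj k) Y"

definition tangent_l :: "('o, 'm, 'z) wact_scheme \<Rightarrow> 'o \<Rightarrow> 'm"
  where "tangent_l \<X> Y = inv_arr \<X> (mult_iso \<X> (W, W, Y)) \<odot>\<^bsub>\<X>\<^esub> T_nat \<X> weil_l Y"

section \<open>Differential bundles and differential objects\<close>

text \<open>The data of an additive bundle, including the chosen second pullback power \<open>Pow2\<close> of the
  projection, with its two projections \<open>Fst\<close> and \<open>Snd\<close>, which is the domain of the addition.\<close>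

record ('o, 'm) bundle_data =
  Tot :: 'o
  Base :: 'o
  Proj :: 'm
  Pow2 :: 'o
  Fst :: 'm
  Snd :: 'm
  Plus :: 'm
  Zero :: 'm

definition additive_bundle :: "('o, 'm, 'z) cat_scheme \<Rightarrow> ('o, 'm) bundle_data \<Rightarrow> bool"
  where "additive_bundle C B \<longleftrightarrow>
    Proj B \<in> Hom C (Tot B) (Base B) \<and>
    (\<forall>n. \<exists>P b \<pi>. is_pullback_power C (Proj B) n P b \<pi>) \<and>
    Fst B \<in> Hom C (Pow2 B) (Tot B) \<and> Snd B \<in> Hom C (Pow2 B) (Tot B) \<and>
    is_pullback C (Fst B) (Snd B) (Proj B) (Proj B) \<and>
    Plus B \<in> Hom C (Pow2 B) (Tot B) \<and> Zero B \<in> Hom C (Base B) (Tot B) \<and>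
    Proj B \<odot>\<^bsub>C\<^esub> Plus B = Proj B \<odot>\<^bsub>C\<^esub> Fst B \<and>
    Proj B \<odot>\<^bsub>C\<^esub> Plus B = Proj B \<odot>\<^bsub>C\<^esub> Snd B \<and>
    Proj B \<odot>\<^bsub>C\<^esub> Zero B = Id C (Base B) \<and>
    (\<forall>P b \<pi>. is_pullback_power C (Proj B) 3 P b \<pi> \<longrightarrow>
      Plus B \<odot>\<^bsub>C\<^esub> pairing C (Fst B) (Snd B)
        (Plus B \<odot>\<^bsub>C\<^esub> pairing C (Fst B) (Snd B) (\<pi> 0) (\<pi> 1)) (\<pi> 2) =
      Plus B \<odot>\<^bsub>C\<^esub> pairing C (Fst B) (Snd B)
        (\<pi> 0) (Plus B \<odot>\<^bsub>C\<^esub> pairing C (Fst B) (Snd B) (\<pi> 1) (\<pi> 2))) \<and>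
    Plus B \<odot>\<^bsub>C\<^esub> pairing C (Fst B) (Snd B) (Snd B) (Fst B) = Plus B \<and>
    Plus B \<odot>\<^bsub>C\<^esub> pairing C (Fst B) (Snd B) (Zero B \<odot>\<^bsub>C\<^esub> Proj B) (Id C (Tot B)) = Id C (Tot B) \<and>
    Plus B \<odot>\<^bsub>C\<^esub> pairing C (Fst B) (Snd B) (Id C (Tot B)) (Zero B \<odot>\<^bsub>C\<^esub> Proj B) = Id C (Tot B)"

definition additive_bundle_morphism ::
    "('o, 'm, 'z) cat_scheme \<Rightarrow> ('o, 'm) bundle_data \<Rightarrow> ('o, 'm) bundle_data \<Rightarrow> 'm \<Rightarrow> 'm \<Rightarrow> bool"
  where "additive_bundle_morphism C B B' f g \<longleftrightarrow>
    f \<in> Hom C (Tot B) (Tot B') \<and> g \<in> Hom C (Base B) (Base B') \<and>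
    Proj B' \<odot>\<^bsub>C\<^esub> f = g \<odot>\<^bsub>C\<^esub> Proj B \<and>
    f \<odot>\<^bsub>C\<^esub> Plus B =
      Plus B' \<odot>\<^bsub>C\<^esub> pairing C (Fst B') (Snd B') (f \<odot>\<^bsub>C\<^esub> Fst B) (f \<odot>\<^bsub>C\<^esub> Snd B) \<and>
    f \<odot>\<^bsub>C\<^esub> Zero B = Zero B' \<odot>\<^bsub>C\<^esub> g"

text \<open>For \<open>F = T\<close> this is the bundle \<open>(TE, TM, Tq, T\<sigma>, T\<zeta>)\<close>.\<close>

definition map_bundle :: "('o, 'm, 'p, 'n) ftor \<Rightarrow> ('o, 'm) bundle_data \<Rightarrow> ('p, 'n) bundle_data"
  where "map_bundle F B =
    \<lparr> Tot = FO F (Tot B), Base = FO F (Base B), Proj = FA F (Proj B), Pow2 = FO F (Pow2 B),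
      Fst = FA F (Fst B), Snd = FA F (Snd B), Plus = FA F (Plus B), Zero = FA F (Zero B) \<rparr>"

definition tangent_bundle :: "('o, 'm, 'z) wact_scheme \<Rightarrow> 'o \<Rightarrow> ('o, 'm) bundle_data"
  where "tangent_bundle \<X> Y =
    \<lparr> Tot = FO (tangent \<X>) Y, Base = Y, Proj = tangent_p \<X> Y,
      Pow2 = FO (T_fun \<X> (weil_pow 2)) Y,
      Fst = tangent_proj \<X> 1 Y, Snd = tangent_proj \<X> 2 Y,
      Plus = tangent_plus \<X> Y, Zero = tangent_0 \<X> Y \<rparr>"

text \<open>\<open>B\<close> is \<open>(E, M, q, \<zeta>, \<sigma>)\<close> together with \<open>E\<^sub>2\<close>, and \<open>l\<close> is the lift \<open>\<lambda>\<close>.\<close>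

definition differential_bundle :: "('o, 'm, 'z) wact_scheme \<Rightarrow> ('o, 'm) bundle_data \<Rightarrow> 'm \<Rightarrow> bool"
  where "differential_bundle \<X> B l \<longleftrightarrow>
    additive_bundle \<X> B \<and>
    (\<forall>n P b \<pi>. is_pullback_power \<X> (Proj B) n P b \<pi> \<longrightarrow>
      (\<forall>k. let Tk = ftor_power k (tangent \<X>) in
        is_pullback_power \<X> (FA Tk (Proj B)) n (FO Tk P) (FA Tk b) (\<lambda>i. FA Tk (\<pi> i)))) \<and>
    l \<in> Hom \<X> (Tot B) (FO (tangent \<X>) (Tot B)) \<and>
    additive_bundle_morphism \<X> B (map_bundle (tangent \<X>) B) l (tangent_0 \<X> (Base B)) \<and>
    additive_bundle_morphism \<X> B (tangent_bundle \<X> (Tot B)) l (Zero B) \<and>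
    tangent_l \<X> (Tot B) \<odot>\<^bsub>\<X>\<^esub> l = FA (tangent \<X>) l \<odot>\<^bsub>\<X>\<^esub> l \<and>
    is_pullback \<X>
      (FA (tangent \<X>) (Plus B) \<odot>\<^bsub>\<X>\<^esub>
        pairing \<X> (FA (tangent \<X>) (Fst B)) (FA (tangent \<X>) (Snd B))
          (l \<odot>\<^bsub>\<X>\<^esub> Fst B) (tangent_0 \<X> (Tot B) \<odot>\<^bsub>\<X>\<^esub> Snd B))
      (Proj B \<odot>\<^bsub>\<X>\<^esub> Fst B)
      (FA (tangent \<X>) (Proj B))
      (tangent_0 \<X> (Base B))"

definition differential_object :: "('o, 'm, 'z) wact_scheme \<Rightarrow> ('o, 'm) bundle_data \<Rightarrow> 'm \<Rightarrow> bool"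
  where "differential_object \<X> B l \<longleftrightarrow> terminal \<X> (Base B) \<and> differential_bundle \<X> B l"

section \<open>Differential functors\<close>

locale oplax_weil_linear_functor =
  source: weil_actegory \<X> + target: weil_actegory \<X>'
  for \<X> :: "('o, 'm, 'y) wact_scheme" and \<X>' :: "('p, 'n, 'z) wact_scheme" +
  fixes F :: "('o, 'm, 'p, 'n) ftor" and \<alpha> :: "weil_obj \<times> 'o \<Rightarrow> 'n"
  assumes is_functor: "is_functor \<X> \<X>' F"
    and natural: "natural_transformation (prod_cat Weil \<X>) \<X>'
      (F \<circ>\<^sub>F act \<X>) (act \<X>' \<circ>\<^sub>F (id_ftor \<times>\<^sub>F F)) \<alpha>"
    and mult_compat: "\<lbrakk>A \<in> Obj Weil; B \<in> Obj Weil; Y \<in> Obj \<X>\<rbrakk> \<Longrightarrow>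
      \<alpha> (A \<otimes>\<^sub>W B, Y) \<odot>\<^bsub>\<X>'\<^esub> FA F (mult_iso \<X> (A, B, Y)) =
      mult_iso \<X>' (A, B, FO F Y) \<odot>\<^bsub>\<X>'\<^esub>
        (FA (T_fun \<X>' A) (\<alpha> (B, Y)) \<odot>\<^bsub>\<X>'\<^esub> \<alpha> (A, FO (T_fun \<X> B) Y))"
    and unit_compat: "Y \<in> Obj \<X> \<Longrightarrow>
      \<alpha> (\<N>, Y) \<odot>\<^bsub>\<X>'\<^esub> FA F (unit_iso \<X> Y) = unit_iso \<X>' (FO F Y)"

definition preserves_pullbacks_over ::
    "('o, 'm, 'y) cat_scheme \<Rightarrow> ('p, 'n, 'z) cat_scheme \<Rightarrow> ('o, 'm, 'p, 'n) ftor \<Rightarrow> 'o \<Rightarrow> bool"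
  where "preserves_pullbacks_over C D F S \<longleftrightarrow>
    (\<forall>p q f g. is_pullback C p q f g \<and> Cod C f = S \<longrightarrow>
      is_pullback D (FA F p) (FA F q) (FA F f) (FA F g))"

definition lax_differential_functor ::
    "('o, 'm, 'y) wact_scheme \<Rightarrow> ('p, 'n, 'z) wact_scheme \<Rightarrow> 'o \<Rightarrow>
     ('o, 'm, 'p, 'n) ftor \<Rightarrow> (weil_obj \<times> 'o \<Rightarrow> 'n) \<Rightarrow> bool"
  where "lax_differential_functor \<X> \<X>' S F \<alpha> \<longleftrightarrow>
    oplax_weil_linear_functor \<X> \<X>' F \<alpha> \<and> terminal \<X> S \<and>
    (\<forall>A\<in>Obj Weil.
      preserves_pullbacks_over \<X> \<X>' (T_fun \<X>' A \<circ>\<^sub>F F) S \<and>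
      (\<forall>f\<in>Arr \<X>. is_pullback \<X>'
        (\<alpha> (A, Dom \<X> f)) (FA F (FA (T_fun \<X> A) f))
        (FA (T_fun \<X>' A) (FA F f)) (\<alpha> (A, Cod \<X> f))))"

definition strong_differential_functor ::
    "('o, 'm, 'y) wact_scheme \<Rightarrow> ('p, 'n, 'z) wact_scheme \<Rightarrow> 'o \<Rightarrow>
     ('o, 'm, 'p, 'n) ftor \<Rightarrow> (weil_obj \<times> 'o \<Rightarrow> 'n) \<Rightarrow> bool"
  where "strong_differential_functor \<X> \<X>' S F \<alpha> \<longleftrightarrow>
    lax_differential_functor \<X> \<X>' S F \<alpha> \<and> terminal \<X>' (FO F S)"

end

theory Submission
  imports Defs
begin

text \<open>
  The image of \<open>(X, \<sigma>, \<zeta>, \<lambda>)\<close> under \<open>F\<close> becomes a differential bundle for three separate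
  reasons.

  \<^bold>\<open>Pullbacks over the terminal object.\<close>  The pullback powers of \<open>! : X \<rightarrow> *\<close> are iterated pullbacks
  over \<open>*\<close>, and the functors \<open>T'\<^sub>A \<circ> F\<close> preserve those.  The structure isomorphisms of the actegory
  identify \<open>T'\<^sup>k\<close> with \<open>T'\<^sub>A\<close> for the \<open>k\<close>-th tensor power \<open>A\<close> of \<open>W\<close>, so \<open>T'\<^sup>k \<circ> F\<close>, and for \<open>k = 0\<close>
  the functor \<open>F\<close> itself, preserve them as well (\<open>preserves_pullbacks_over_tangent_power\<close>).
  Pairings are then preserved too, and with them the laws of an additive bundle
  (\<open>map_additive_bundle\<close>).  An arbitrary pullback power of \<open>F(!)\<close> is isomorphic to the image of one
  of \<open>!\<close>, whence it is preserved by every \<open>T'\<^sup>k\<close> (\<open>powers_preserved\<close>).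

  \<^bold>\<open>Naturality.\<close>  The transformation \<open>\<alpha>\<close> is natural in the object and in the Weil algebra, and
  compatible with \<open>\<otimes>\<close> and \<open>\<N>\<close>.  Therefore it turns \<open>F(p)\<close>, \<open>F(0)\<close> and \<open>F(\<ell>)\<close> into the
  corresponding structure maps of the target (\<open>alpha_p\<close>, \<open>alpha_0\<close>, \<open>alpha_l\<close>), and every equation
  for \<open>\<lambda>\<close> becomes the same equation for \<open>\<alpha> \<circ> F(\<lambda>)\<close>.  The equation relating \<open>\<lambda>\<close> to the fibrewise
  addition of \<open>TX\<close> involves pairings into \<open>T\<^sub>2\<close>; these are under control because \<open>W\<^sup>2\<close> is the
  product of two copies of \<open>W\<close> in \<open>Weil\<close> (\<open>weil_pow2_product\<close>).

  \<^bold>\<open>Universality of the lift.\<close>  Since \<open>*\<close> and \<open>T(*)\<close> are both terminal, \<open>0 : * \<rightarrow> T(*)\<close> is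
  invertible, so the lift square of \<open>X\<close> is a pullback along an isomorphism and its upper side
  \<open>\<mu> : X\<^sup>2 \<rightarrow> TX\<close> is invertible.  Applying \<open>F\<close> gives a square with invertible horizontal sides;
  pasting it to the naturality square of \<open>\<alpha>\<close> at \<open>!\<close>, which is a pullback by assumption, gives the
  lift square of the image (\<open>lift_universal\<close>).
\<close>

section \<open>Polynomials and substitution\<close>

lemma npolys_0: "0 \<in> npolys n" and npolys_1: "1 \<in> npolys n"
  by (simp_all add: npolys_def)

lemma npolys_var: "i \<in> {1..n} \<Longrightarrow> var i \<in> npolys n"
  by (simp add: npolys_def var_def)

lemma npolys_add: "\<lbrakk>P \<in> npolys n; Q \<in> npolys n\<rbrakk> \<Longrightarrow> P + Q \<in> npolys n"
  using keys_add[of P Q] by (auto simp: npolys_def)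

lemma npolys_mult:
  assumes "P \<in> npolys n" "Q \<in> npolys n"
  shows "P * Q \<in> npolys n"
proof -
  have "Poly_Mapping.keys m \<subseteq> {1..n}" if m: "m \<in> Poly_Mapping.keys (P * Q)" for m
  proof -
    obtain a b where "m = a + b" "a \<in> Poly_Mapping.keys P" "b \<in> Poly_Mapping.keys Q"
      using m keys_mult[of P Q] by blast
    with assms keys_add[of a b] show ?thesis
      unfolding npolys_def by blast
  qed
  then show ?thesis
    by (simp add: npolys_def)
qed

lemma npolys_of_nat: "of_nat c \<in> npolys n"
  by (induction c) (auto intro: npolys_0 npolys_1 npolys_add)

lemmas npolys_intros = npolys_0 npolys_1 npolys_add npolys_mult npolys_of_nat npolys_var

lemma poly_mapping_sum_single:
  "(\<Sum>m\<in>Poly_Mapping.keys P. Poly_Mapping.single m (Poly_Mapping.lookup P m)) = P"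
  by (rule poly_mapping_eqI)
     (simp add: lookup_sum lookup_single when_def in_keys_iff)

lemma mult_single_1:
  "Poly_Mapping.single (k + l) (1::'a::comm_semiring_1) = Poly_Mapping.single k 1 * Poly_Mapping.single l 1"
  by (simp add: mult_single)

lemma single_sum_eq_prod:
  "finite S \<Longrightarrow> Poly_Mapping.single (\<Sum>i\<in>S. g i) (1::'a::comm_semiring_1) = (\<Prod>i\<in>S. Poly_Mapping.single (g i) 1)"
  for g :: "'i \<Rightarrow> 'b::comm_monoid_add"
  by (induction S rule: finite_induct) (simp_all add: mult_single_1)

lemma single_var_power: "Poly_Mapping.single (Poly_Mapping.single i k) 1 = var i ^ k"
proof (induction k)
  case (Suc k)
  have "Poly_Mapping.single (Poly_Mapping.single i (Suc k)) 1 = 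
    Poly_Mapping.single (Poly_Mapping.single i 1 + Poly_Mapping.single i k) (1 * 1 :: nat)"
    by (simp flip: single_add)
  also have "\<dots> = var i ^ Suc k"
    unfolding mult_single[symmetric] Suc by (simp add: var_def)
  finally show ?case .
qed (simp del: One_nat_def)

text \<open>A homomorphism of Weil algebras is given only through its values on generators, so its
  properties are proved along the construction of a polynomial from the variables.\<close>

lemma npolys_induct [consumes 1, case_names zero one var add mult]:
  assumes P: "P \<in> npolys n"
    and "Q 0" "Q 1" and v: "\<And>i. i \<in> {1..n} \<Longrightarrow> Q (var i)"
    and add: "\<And>P P'. \<lbrakk>P \<in> npolys n; P' \<in> npolys n; Q P; Q P'\<rbrakk> \<Longrightarrow> Q (P + P')"
    and mult: "\<And>P P'. \<lbrakk>P \<in> npolys n; P' \<in> npolys n; Q P; Q P'\<rbrakk> \<Longrightarrow> Q (P * P')"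
  shows "Q P"
proof -
  let ?R = "\<lambda>P. P \<in> npolys n \<and> Q P"
  have R: "?R 0" "?R 1" "\<And>i. i \<in> {1..n} \<Longrightarrow> ?R (var i)"
      "\<And>P P'. ?R P \<Longrightarrow> ?R P' \<Longrightarrow> ?R (P + P')" "\<And>P P'. ?R P \<Longrightarrow> ?R P' \<Longrightarrow> ?R (P * P')"
    by (simp_all add: assms npolys_intros)
  have Rsum: "?R (sum f S)" if "finite S" "\<And>x. x \<in> S \<Longrightarrow> ?R (f x)" for f :: "(nat \<Rightarrow>\<^sub>0 nat) \<Rightarrow> npoly" and S
    using that by (induction S rule: finite_induct) (simp_all add: R)
  have Rprod: "?R (prod f S)" if "finite S" "\<And>x. x \<in> S \<Longrightarrow> ?R (f x)" for f :: "nat \<Rightarrow> npoly" and S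
    using that by (induction S rule: finite_induct) (simp_all add: R)
  have Rpow: "?R (p ^ k)" if "?R p" for p k
    using that by (induction k) (simp_all add: R)
  have Rnat: "?R (of_nat k)" for k
    by (induction k) (simp_all add: R)
  have "?R (Poly_Mapping.single m (Poly_Mapping.lookup P m))" if m: "m \<in> Poly_Mapping.keys P" for m
  proof -
    have sub: "Poly_Mapping.keys m \<subseteq> {1..n}"
      using P m by (auto simp: npolys_def)
    have "Poly_Mapping.single m (Poly_Mapping.lookup P m) = of_nat (Poly_Mapping.lookup P m) * Poly_Mapping.single m 1"
      unfolding single_of_nat[where 'b = nat, symmetric] mult_single by simp
    also have "Poly_Mapping.single m (1::nat) = (\<Prod>i\<in>Poly_Mapping.keys m. var i ^ Poly_Mapping.lookup m i)"
      using single_sum_eq_prod[where 'a = nat, of "Poly_Mapping.keys m" "\<lambda>i. Poly_Mapping.single i (Poly_Mapping.lookup m i)"]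
      by (simp add: poly_mapping_sum_single single_var_power del: One_nat_def)
    finally have eq: "Poly_Mapping.single m (Poly_Mapping.lookup P m) = of_nat (Poly_Mapping.lookup P m) * (\<Prod>i\<in>Poly_Mapping.keys m. var i ^ Poly_Mapping.lookup m i)" .
    show ?thesis
      unfolding eq using sub by (intro R(5) Rnat Rprod Rpow R(3)) auto
  qed
  then have "?R (\<Sum>m\<in>Poly_Mapping.keys P. Poly_Mapping.single m (Poly_Mapping.lookup P m))"
    by (intro Rsum) auto
  then show ?thesis
    by (simp add: poly_mapping_sum_single)
qed

definition poly_eval :: "(nat \<Rightarrow> npoly) \<Rightarrow> npoly \<Rightarrow> npoly"
  where "poly_eval U P = (\<Sum>m\<in>Poly_Mapping.keys P. of_nat (Poly_Mapping.lookup P m) * (\<Prod>i\<in>Poly_Mapping.keys m. U i ^ Poly_Mapping.lookup m i))"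

lemma poly_eval_add: "poly_eval U (P + Q) = poly_eval U P + poly_eval U Q"
  unfolding poly_eval_def by (rule setsum_keys_plus_distrib) (simp_all add: algebra_simps)

lemma poly_eval_0: "poly_eval U 0 = 0"
  by (simp add: poly_eval_def)

lemma poly_eval_single: "poly_eval U (Poly_Mapping.single m c) = of_nat c * (\<Prod>i\<in>Poly_Mapping.keys m. U i ^ Poly_Mapping.lookup m i)"
  by (simp add: poly_eval_def)

lemma poly_eval_1: "poly_eval U 1 = 1"
  by (simp add: poly_eval_def)

lemma poly_eval_var: "poly_eval U (var i) = U i"
  by (simp add: var_def poly_eval_single)

lemma prod_power_keys_add:
  fixes U :: "nat \<Rightarrow> 'a::comm_semiring_1"
  shows "(\<Prod>i\<in>Poly_Mapping.keys (m + m'). U i ^ Poly_Mapping.lookup (m + m') i) = (\<Prod>i\<in>Poly_Mapping.keys m. U i ^ Poly_Mapping.lookup m i) * (\<Prod>i\<in>Poly_Mapping.keys m'. U i ^ Poly_Mapping.lookup m' i)"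
proof -
  let ?S = "Poly_Mapping.keys m \<union> Poly_Mapping.keys m'"
  have ext: "(\<Prod>i\<in>Poly_Mapping.keys k. U i ^ Poly_Mapping.lookup k i) = (\<Prod>i\<in>?S. U i ^ Poly_Mapping.lookup k i)" if "Poly_Mapping.keys k \<subseteq> ?S" for k
    using that by (intro prod.mono_neutral_left) (auto simp: in_keys_iff)
  show ?thesis
    unfolding ext[OF keys_add] ext[OF Un_upper1] ext[OF Un_upper2]
    by (simp add: lookup_add power_add prod.distrib)
qed

lemma poly_eval_sum: "poly_eval U (sum f S) = (\<Sum>x\<in>S. poly_eval U (f x))"
  by (induction S rule: infinite_finite_induct) (simp_all add: poly_eval_0 poly_eval_add)

lemma poly_eval_mult: "poly_eval U (P * Q) = poly_eval U P * poly_eval U Q"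
proof -
  have s: "poly_eval U (Poly_Mapping.single m c * Poly_Mapping.single m' c') =
      poly_eval U (Poly_Mapping.single m c) * poly_eval U (Poly_Mapping.single m' c')" for m m' c c'
    by (simp add: mult_single poly_eval_single prod_power_keys_add algebra_simps)
  have "poly_eval U ((\<Sum>m\<in>Poly_Mapping.keys P. Poly_Mapping.single m (Poly_Mapping.lookup P m)) * (\<Sum>m\<in>Poly_Mapping.keys Q. Poly_Mapping.single m (Poly_Mapping.lookup Q m)))
    = poly_eval U (\<Sum>m\<in>Poly_Mapping.keys P. Poly_Mapping.single m (Poly_Mapping.lookup P m)) * poly_eval U (\<Sum>m\<in>Poly_Mapping.keys Q. Poly_Mapping.single m (Poly_Mapping.lookup Q m))"
    by (simp add: sum_product poly_eval_sum s)
  then show ?thesis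
    by (simp add: poly_mapping_sum_single)
qed

lemma poly_eval_npolys:
  assumes "P \<in> npolys n" "\<And>i. i \<in> {1..n} \<Longrightarrow> U i \<in> npolys k"
  shows "poly_eval U P \<in> npolys k"
  using assms(1)
  by (induction rule: npolys_induct)
     (simp_all add: poly_eval_0 poly_eval_1 poly_eval_var poly_eval_add poly_eval_mult npolys_intros assms(2))

section \<open>Weil algebras and their homomorphisms\<close>

lemma weil_obj_equiv: "A \<in> Obj Weil \<longleftrightarrow> equiv {1..fst A} (snd A)"
  by (cases A) (simp add: Weil_def)

lemma weil_obj_subset: "A \<in> Obj Weil \<Longrightarrow> snd A \<subseteq> {1..fst A} \<times> {1..fst A}"
  by (auto simp: weil_obj_equiv equiv_def)

lemma weil_obj_refl: "\<lbrakk>A \<in> Obj Weil; i \<in> {1..fst A}\<rbrakk> \<Longrightarrow> (i, i) \<in> snd A"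
  by (auto simp: weil_obj_equiv equiv_def refl_on_def)

lemma weil_ideal_npolys:
  assumes "A \<in> Obj Weil" "P \<in> weil_ideal A"
  shows "P \<in> npolys (fst A)"
  using assms(2)
proof induction
  case (gen i j P)
  then have "i \<in> {1..fst A}" "j \<in> {1..fst A}"
    using weil_obj_subset[OF assms(1)] by auto
  with gen show ?case
    by (intro npolys_intros)
qed (simp_all add: npolys_intros)

lemma weil_ideal_mult:
  assumes "P \<in> weil_ideal A" "Q \<in> npolys (fst A)"
  shows "Q * P \<in> weil_ideal A"
  using assms(1)
proof induction
  case (gen i j P)
  then show ?case
    using weil_ideal.gen[of i j A "Q * P"] assms(2) npolys_mult by (simp add: mult.assoc)
qed (auto intro: weil_ideal.intros simp: distrib_left)

text \<open>Transitivity works without cancellation because the ideal is closed under sums: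
  \<open>P + S = Q + S'\<close> and \<open>Q + T = R + T'\<close> give \<open>P + (S + T) = R + (T' + S')\<close>.\<close>

lemma weil_rel_equiv:
  assumes "A \<in> Obj Weil"
  shows "equiv (npolys (fst A)) (weil_rel A)"
proof (rule equivI)
  show "weil_rel A \<subseteq> npolys (fst A) \<times> npolys (fst A)"
    by (auto simp: weil_rel_def)
  show "refl_on (npolys (fst A)) (weil_rel A)"
    by (auto simp: refl_on_def weil_rel_def intro: weil_ideal.zero)
  show "sym (weil_rel A)"
    by (auto simp: sym_def weil_rel_def) metis
  show "trans (weil_rel A)"
  proof (rule transI)
    fix P Q R assume "(P, Q) \<in> weil_rel A" "(Q, R) \<in> weil_rel A"
    then obtain S S' T T' where *: "P \<in> npolys (fst A)" "R \<in> npolys (fst A)"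
        "S \<in> weil_ideal A" "S' \<in> weil_ideal A" "T \<in> weil_ideal A" "T' \<in> weil_ideal A"
        "P + S = Q + S'" "Q + T = R + T'"
      by (auto simp: weil_rel_def)
    have "P + (S + T) = (P + S) + T"
      by (simp add: ac_simps)
    also have "\<dots> = (Q + T) + S'"
      unfolding *(7) by (simp add: ac_simps)
    also have "\<dots> = R + (T' + S')"
      unfolding *(8) by (simp add: ac_simps)
    finally have "P + (S + T) = R + (T' + S')" .
    with * show "(P, R) \<in> weil_rel A"
      unfolding weil_rel_def by (auto intro: weil_ideal.add)
  qed
qed

lemma weil_class_eq_iff:
  assumes "A \<in> Obj Weil" "P \<in> npolys (fst A)" "Q \<in> npolys (fst A)"
  shows "weil_class A P = weil_class A Q \<longleftrightarrow> (P, Q) \<in> weil_rel A"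
  unfolding weil_class_def by (rule eq_equiv_class_iff[OF weil_rel_equiv]) (use assms in auto)

lemma weil_class_eqI: "\<lbrakk>A \<in> Obj Weil; (P, Q) \<in> weil_rel A\<rbrakk> \<Longrightarrow> weil_class A P = weil_class A Q"
  unfolding weil_class_def by (rule equiv_class_eq[OF weil_rel_equiv])

lemma weil_class_ideal:
  assumes "A \<in> Obj Weil" "P \<in> weil_ideal A"
  shows "weil_class A P = weil_class A 0"
proof (rule weil_class_eqI[OF assms(1)])
  show "(P, 0) \<in> weil_rel A"
  proof -
    have "P + 0 = 0 + P"
      by simp
    then show ?thesis
      unfolding weil_rel_def using assms npolys_0 weil_ideal_npolys weil_ideal.zero by blast
  qed
qed

lemma weil_carrier: "carrier (weil_alg A) = weil_class A ` npolys (fst A)"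
  by (auto simp: weil_alg_def weil_class_def quotient_def)

lemma weil_class_carrier: "P \<in> npolys (fst A) \<Longrightarrow> weil_class A P \<in> carrier (weil_alg A)"
  by (simp add: weil_carrier)

lemma weil_rel_add:
  assumes "(P, P') \<in> weil_rel A" "(Q, Q') \<in> weil_rel A"
  shows "(P + Q, P' + Q') \<in> weil_rel A"
proof -
  obtain S S' T T' where *: "P \<in> npolys (fst A)" "P' \<in> npolys (fst A)"
        "Q \<in> npolys (fst A)" "Q' \<in> npolys (fst A)"
        "S \<in> weil_ideal A" "S' \<in> weil_ideal A" "T \<in> weil_ideal A" "T' \<in> weil_ideal A"
        "P + S = P' + S'" "Q + T = Q' + T'"
    using assms by (auto simp: weil_rel_def)
  have "(P + Q) + (S + T) = (P + S) + (Q + T)"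
    by (simp add: ac_simps)
  also have "\<dots> = (P' + Q') + (S' + T')"
    unfolding * by (simp add: ac_simps)
  finally have "(P + Q) + (S + T) = (P' + Q') + (S' + T')" .
  moreover have "S + T \<in> weil_ideal A" "S' + T' \<in> weil_ideal A"
    using * by (auto intro: weil_ideal.add)
  ultimately show ?thesis
    using * npolys_add unfolding weil_rel_def by blast
qed

lemma weil_rel_mult:
  assumes "A \<in> Obj Weil" "(P, P') \<in> weil_rel A" "(Q, Q') \<in> weil_rel A"
  shows "(P * Q, P' * Q') \<in> weil_rel A"
proof -
  have left: "(R * P, R * P') \<in> weil_rel A" if R: "R \<in> npolys (fst A)" and PP': "(P, P') \<in> weil_rel A" for P P' R
  proof -
    obtain S S' where *: "P \<in> npolys (fst A)" "P' \<in> npolys (fst A)"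
        "S \<in> weil_ideal A" "S' \<in> weil_ideal A" "P + S = P' + S'"
      using PP' by (auto simp: weil_rel_def)
    then have "R * P + R * S = R * P' + R * S'"
      by (simp flip: distrib_left)
    with * R show ?thesis
      unfolding weil_rel_def using weil_ideal_mult npolys_mult by blast
  qed
  have "P \<in> npolys (fst A)" "Q' \<in> npolys (fst A)"
    using assms by (auto simp: weil_rel_def)
  then have "(P * Q, P * Q') \<in> weil_rel A" "(P * Q', P' * Q') \<in> weil_rel A"
    using left[of P Q Q'] left[of Q' P P'] assms by (simp_all add: mult.commute)
  then show ?thesis
    using weil_rel_equiv[OF assms(1)] by (meson equivE transD)
qed

lemma weil_add:
  assumes "A \<in> Obj Weil" "P \<in> npolys (fst A)" "Q \<in> npolys (fst A)"
  shows "weil_class A P \<oplus>\<^bsub>weil_alg A\<^esub> weil_class A Q = weil_class A (P + Q)"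
proof -
  have "(\<lambda>P Q. weil_class A (P + Q)) respects2 weil_rel A"
    by (rule congruent2I') (auto intro!: weil_class_eqI assms(1) weil_rel_add)
  from UN_equiv_class2[OF weil_rel_equiv weil_rel_equiv this, OF assms(1,1,2,3)] show ?thesis
    by (simp add: weil_alg_def weil_class_def)
qed

lemma weil_mult:
  assumes "A \<in> Obj Weil" "P \<in> npolys (fst A)" "Q \<in> npolys (fst A)"
  shows "weil_class A P \<otimes>\<^bsub>weil_alg A\<^esub> weil_class A Q = weil_class A (P * Q)"
proof -
  have "(\<lambda>P Q. weil_class A (P * Q)) respects2 weil_rel A"
    by (rule congruent2I') (auto intro!: weil_class_eqI assms(1) weil_rel_mult)
  from UN_equiv_class2[OF weil_rel_equiv weil_rel_equiv this, OF assms(1,1,2,3)] show ?thesis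
    by (simp add: weil_alg_def weil_class_def)
qed

lemma weil_zero: "\<zero>\<^bsub>weil_alg A\<^esub> = weil_class A 0" and weil_one: "\<one>\<^bsub>weil_alg A\<^esub> = weil_class A 1"
  by (simp_all add: weil_alg_def)

text \<open>Homomorphisms are checked on representatives; \<open>r\<close> need only be a homomorphism up to the
  congruence of \<open>B\<close>.\<close>

lemma weil_homsI:
  assumes "A \<in> Obj Weil" "B \<in> Obj Weil" "\<theta> \<in> extensional (carrier (weil_alg A))"
    and r: "\<And>P. P \<in> npolys (fst A) \<Longrightarrow> r P \<in> npolys (fst B)"
    and \<theta>: "\<And>P. P \<in> npolys (fst A) \<Longrightarrow> \<theta> (weil_class A P) = weil_class B (r P)"
    and "weil_class B (r 0) = weil_class B 0" "weil_class B (r 1) = weil_class B 1"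
    and "\<And>P Q. \<lbrakk>P \<in> npolys (fst A); Q \<in> npolys (fst A)\<rbrakk> \<Longrightarrow> weil_class B (r (P + Q)) = weil_class B (r P + r Q)"
    and "\<And>P Q. \<lbrakk>P \<in> npolys (fst A); Q \<in> npolys (fst A)\<rbrakk> \<Longrightarrow> weil_class B (r (P * Q)) = weil_class B (r P * r Q)"
  shows "\<theta> \<in> weil_homs A B"
  unfolding weil_homs_def ring_hom_def
  using assms
  by (auto simp: weil_carrier weil_zero weil_one weil_add weil_mult npolys_intros)

lemma weil_homsD:
  assumes "\<theta> \<in> weil_homs A B" "A \<in> Obj Weil"
  shows "\<theta> \<in> extensional (carrier (weil_alg A))"
    and "\<And>e. e \<in> carrier (weil_alg A) \<Longrightarrow> \<theta> e \<in> carrier (weil_alg B)"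
    and "\<theta> (weil_class A 0) = weil_class B 0" "\<theta> (weil_class A 1) = weil_class B 1"
    and "\<And>P Q. \<lbrakk>P \<in> npolys (fst A); Q \<in> npolys (fst A)\<rbrakk> \<Longrightarrow>
      \<theta> (weil_class A (P + Q)) = \<theta> (weil_class A P) \<oplus>\<^bsub>weil_alg B\<^esub> \<theta> (weil_class A Q)"
    and "\<And>P Q. \<lbrakk>P \<in> npolys (fst A); Q \<in> npolys (fst A)\<rbrakk> \<Longrightarrow>
      \<theta> (weil_class A (P * Q)) = \<theta> (weil_class A P) \<otimes>\<^bsub>weil_alg B\<^esub> \<theta> (weil_class A Q)"
  using assms
  unfolding weil_homs_def ring_hom_def
  by (auto simp: weil_zero weil_one weil_class_carrier simp flip: weil_add weil_mult)

lemma weil_homs_eqI: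
  assumes "A \<in> Obj Weil" "\<theta> \<in> weil_homs A B" "\<phi> \<in> weil_homs A B"
    and v: "\<And>i. i \<in> {1..fst A} \<Longrightarrow> \<theta> (weil_class A (var i)) = \<phi> (weil_class A (var i))"
  shows "\<theta> = \<phi>"
proof (rule extensionalityI)
  note t = weil_homsD[OF assms(2,1)] and p = weil_homsD[OF assms(3,1)]
  show "\<theta> \<in> extensional (carrier (weil_alg A))" "\<phi> \<in> extensional (carrier (weil_alg A))"
    by (rule t p)+
  fix e assume "e \<in> carrier (weil_alg A)"
  then obtain P where P: "P \<in> npolys (fst A)" "e = weil_class A P"
    by (auto simp: weil_carrier)
  from P(1) have "\<theta> (weil_class A P) = \<phi> (weil_class A P)"
    by (induction rule: npolys_induct) (simp_all only: t p v)
  with P show "\<theta> e = \<phi> e"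
    by simp
qed

text \<open>The presentation of \<open>A\<close> by generators and relations: substitution sends the ideal of \<open>A\<close> into
  that of \<open>B\<close> as soon as it does so for the generators \<open>x\<^sub>i x\<^sub>j\<close>, hence it respects the congruence.\<close>

lemma weil_homs_gen_exists:
  assumes A: "A \<in> Obj Weil" and B: "B \<in> Obj Weil"
    and U: "\<And>i. i \<in> {1..fst A} \<Longrightarrow> U i \<in> npolys (fst B)"
    and UU: "\<And>i j. (i, j) \<in> snd A \<Longrightarrow> U i * U j \<in> weil_ideal B"
  shows "\<exists>\<theta>\<in>weil_homs A B. \<forall>P\<in>npolys (fst A). \<theta> (weil_class A P) = weil_class B (poly_eval U P)"
proof -
  have eval: "poly_eval U P \<in> npolys (fst B)" if "P \<in> npolys (fst A)" for P
    using that U by (rule poly_eval_npolys)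
  have ideal: "poly_eval U S \<in> weil_ideal B" if "S \<in> weil_ideal A" for S
    using that
  proof induction
    case (gen i j P)
    then show ?case
      unfolding poly_eval_mult poly_eval_var
      by (intro weil_ideal_mult UU eval) auto
  qed (simp_all add: poly_eval_0 poly_eval_add weil_ideal.intros)
  have resp: "(\<lambda>P. weil_class B (poly_eval U P)) respects weil_rel A"
  proof (rule congruentI)
    fix P Q assume "(P, Q) \<in> weil_rel A"
    then obtain S S' where *: "P \<in> npolys (fst A)" "Q \<in> npolys (fst A)"
        "S \<in> weil_ideal A" "S' \<in> weil_ideal A" "P + S = Q + S'"
      by (auto simp: weil_rel_def)
    have "poly_eval U P + poly_eval U S = poly_eval U Q + poly_eval U S'"
      using *(5) by (metis poly_eval_add)
    then have "(poly_eval U P, poly_eval U Q) \<in> weil_rel B"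
      unfolding weil_rel_def using * ideal eval by blast
    then show "weil_class B (poly_eval U P) = weil_class B (poly_eval U Q)"
      by (rule weil_class_eqI[OF B])
  qed
  define \<theta> where "\<theta> = (\<lambda>e\<in>carrier (weil_alg A). \<Union>P\<in>e. weil_class B (poly_eval U P))"
  have \<theta>: "\<theta> (weil_class A P) = weil_class B (poly_eval U P)" if "P \<in> npolys (fst A)" for P
    using UN_equiv_class[OF weil_rel_equiv[OF A] resp that] weil_class_carrier[OF that]
    by (simp add: \<theta>_def weil_class_def)
  have "\<theta> \<in> weil_homs A B"
    by (rule weil_homsI[OF A B, where r = "poly_eval U"])
       (simp_all add: \<theta> eval poly_eval_0 poly_eval_1 poly_eval_add poly_eval_mult npolys_intros, simp add: \<theta>_def)
  with \<theta> show ?thesis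
    by blast
qed

abbreviation weil_fun :: "weil_arr \<Rightarrow> weil_elt \<Rightarrow> weil_elt"
  where "weil_fun f \<equiv> fst (snd f)"

lemma weil_hom_iff: "f \<in> Hom Weil A B \<longleftrightarrow>
    A \<in> Obj Weil \<and> B \<in> Obj Weil \<and> weil_fun f \<in> weil_homs A B \<and> f = (A, weil_fun f, B)"
  by (cases f; cases A; cases B) (auto simp: Hom_def Weil_def)

lemma weil_arr_eqI:
  assumes "f \<in> Hom Weil A B" "g \<in> Hom Weil A B"
    and "\<And>i. i \<in> {1..fst A} \<Longrightarrow> weil_fun f (weil_class A (var i)) = weil_fun g (weil_class A (var i))"
  shows "f = g"
  using assms weil_homs_eqI[of A "weil_fun f" B "weil_fun g"] by (metis weil_hom_iff)

text \<open>Existence and uniqueness together make the definite description in \<^const>\<open>weil_gen\<close> denote; the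
  polynomials \<open>U i\<close> are representatives of the prescribed images.\<close>

lemma weil_gen:
  assumes A: "A \<in> Obj Weil" and B: "B \<in> Obj Weil"
    and u: "\<And>i. i \<in> {1..fst A} \<Longrightarrow> u i = weil_class B (U i)"
    and U: "\<And>i. i \<in> {1..fst A} \<Longrightarrow> U i \<in> npolys (fst B)"
    and UU: "\<And>i j. (i, j) \<in> snd A \<Longrightarrow> U i * U j \<in> weil_ideal B"
  shows "weil_gen A B u \<in> Hom Weil A B"
    and "\<And>i. i \<in> {1..fst A} \<Longrightarrow> weil_fun (weil_gen A B u) (weil_class A (var i)) = u i"
proof -
  obtain \<theta> where \<theta>: "\<theta> \<in> weil_homs A B" "\<forall>P\<in>npolys (fst A). \<theta> (weil_class A P) = weil_class B (poly_eval U P)"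
    using weil_homs_gen_exists[where U = U, OF A B U UU] by blast
  let ?R = "\<lambda>\<theta>. \<theta> \<in> weil_homs A B \<and> (\<forall>i\<in>{1..fst A}. \<theta> (weil_class A (var i)) = u i)"
  have "?R \<theta>"
    using \<theta> by (simp add: u npolys_var poly_eval_var)
  moreover have "\<phi> = \<theta>" if "?R \<phi>" for \<phi>
    using that \<open>?R \<theta>\<close> by (intro weil_homs_eqI[OF A]) auto
  ultimately have the: "?R (THE \<theta>. ?R \<theta>)"
    by (rule theI)
  then show "weil_gen A B u \<in> Hom Weil A B"
    unfolding weil_gen_def weil_hom_iff using A B by simp
  show "\<And>i. i \<in> {1..fst A} \<Longrightarrow> weil_fun (weil_gen A B u) (weil_class A (var i)) = u i"
    unfolding weil_gen_def using the by simp
qed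

lemma weil_id_eq: "Id Weil A = (A, (\<lambda>e\<in>carrier (weil_alg A). e), A)"
  by (simp add: Weil_def)

lemma weil_id_hom: "A \<in> Obj Weil \<Longrightarrow> Id Weil A \<in> Hom Weil A A"
  unfolding weil_hom_iff weil_id_eq
  by (simp add: weil_homsI[where r = "\<lambda>P. P"] weil_class_carrier)

lemma weil_fun_id: "e \<in> carrier (weil_alg A) \<Longrightarrow> weil_fun (Id Weil A) e = e"
  by (simp add: weil_id_eq)

lemma weil_fun_carrier:
  assumes "f \<in> Hom Weil A B" "e \<in> carrier (weil_alg A)"
  shows "weil_fun f e \<in> carrier (weil_alg B)"
  using assms weil_homsD(2) unfolding weil_hom_iff by blast

lemma weil_comp_eq:
  assumes "f \<in> Hom Weil A B" "g \<in> Hom Weil B C"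
  shows "g \<odot>\<^bsub>Weil\<^esub> f = (A, compose (carrier (weil_alg A)) (weil_fun g) (weil_fun f), C)"
  using assms unfolding weil_hom_iff by (cases f; cases g) (auto simp: Weil_def)

lemma weil_fun_comp:
  assumes "f \<in> Hom Weil A B" "g \<in> Hom Weil B C" "e \<in> carrier (weil_alg A)"
  shows "weil_fun (g \<odot>\<^bsub>Weil\<^esub> f) e = weil_fun g (weil_fun f e)"
  using assms by (simp add: weil_comp_eq compose_eq)

lemma weil_comp_id_left:
  assumes "f \<in> Hom Weil A B"
  shows "Id Weil B \<odot>\<^bsub>Weil\<^esub> f = f"
proof -
  have f: "f = (A, weil_fun f, B)" "weil_fun f \<in> weil_homs A B" "A \<in> Obj Weil" "B \<in> Obj Weil"
    using assms unfolding weil_hom_iff by auto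
  have "compose (carrier (weil_alg A)) (weil_fun (Id Weil B)) (weil_fun f) = weil_fun f"
    using weil_homsD(1)[OF f(2,3)] weil_fun_carrier[OF assms]
    by (intro extensionalityI[of _ "carrier (weil_alg A)"]) (auto simp: compose_eq weil_fun_id)
  with f show ?thesis
    using weil_comp_eq[OF assms weil_id_hom] by metis
qed

lemma weil_comp_id_right:
  assumes "f \<in> Hom Weil A B"
  shows "f \<odot>\<^bsub>Weil\<^esub> Id Weil A = f"
proof -
  have f: "f = (A, weil_fun f, B)" "weil_fun f \<in> weil_homs A B" "A \<in> Obj Weil" "B \<in> Obj Weil"
    using assms unfolding weil_hom_iff by auto
  have "compose (carrier (weil_alg A)) (weil_fun f) (weil_fun (Id Weil A)) = weil_fun f"
    using weil_homsD(1)[OF f(2,3)] weil_fun_carrier[OF assms]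
    by (intro extensionalityI[of _ "carrier (weil_alg A)"]) (auto simp: compose_eq weil_fun_id)
  with f show ?thesis
    using weil_comp_eq[OF weil_id_hom assms] by metis
qed

section \<open>Tensor products and the distinguished morphisms\<close>

lemma weil_obj_pow: "weil_pow n \<in> Obj Weil"
  by (auto simp: weil_obj_equiv weil_pow_def equiv_def refl_on_def sym_def trans_def)

lemma weil_obj_W: "W \<in> Obj Weil"
  by (simp add: W_def weil_obj_pow)

lemma weil_obj_unit: "\<N> \<in> Obj Weil"
  by (auto simp: weil_obj_equiv weil_unit_def equiv_def refl_on_def sym_def trans_def)

lemma fst_weil [simp]: "fst \<N> = 0" "fst W = 1" "fst (weil_pow n) = n" "fst (A \<otimes>\<^sub>W B) = fst A + fst B"
  by (simp_all add: weil_unit_def W_def weil_pow_def weil_tensor_def)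

lemma weil_obj_tensor:
  assumes "A \<in> Obj Weil" "B \<in> Obj Weil"
  shows "A \<otimes>\<^sub>W B \<in> Obj Weil"
  unfolding weil_obj_equiv
proof (rule equivI)
  let ?s = "\<lambda>(i, j). (fst A + i, fst A + j)"
  have A: "snd A \<subseteq> {1..fst A} \<times> {1..fst A}" "refl_on {1..fst A} (snd A)" "sym (snd A)" "trans (snd A)"
    and B: "snd B \<subseteq> {1..fst B} \<times> {1..fst B}" "refl_on {1..fst B} (snd B)" "sym (snd B)" "trans (snd B)"
    using assms by (auto simp: weil_obj_equiv equiv_def)
  have mem: "(i, j) \<in> snd (A \<otimes>\<^sub>W B) \<longleftrightarrow>
      (i, j) \<in> snd A \<or> (i > fst A \<and> j > fst A \<and> (i - fst A, j - fst A) \<in> snd B)" for i j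
  proof
    assume "(i, j) \<in> snd A \<or> (i > fst A \<and> j > fst A \<and> (i - fst A, j - fst A) \<in> snd B)"
    then show "(i, j) \<in> snd (A \<otimes>\<^sub>W B)"
      by (force simp: weil_tensor_def image_iff)
  qed (use B(1) in \<open>auto simp: weil_tensor_def\<close>)
  have lt: "i \<le> fst A \<and> j \<le> fst A \<and> 1 \<le> i \<and> 1 \<le> j" if "(i, j) \<in> snd A" for i j
    using A(1) that by auto
  show "snd (A \<otimes>\<^sub>W B) \<subseteq> {1..fst (A \<otimes>\<^sub>W B)} \<times> {1..fst (A \<otimes>\<^sub>W B)}"
    using A(1) B(1) by (auto simp: weil_tensor_def)
  show "refl_on {1..fst (A \<otimes>\<^sub>W B)} (snd (A \<otimes>\<^sub>W B))"
  proof (rule refl_onI)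
    fix i assume i: "i \<in> {1..fst (A \<otimes>\<^sub>W B)}"
    show "(i, i) \<in> snd (A \<otimes>\<^sub>W B)"
    proof (cases "i \<le> fst A")
      case True
      with i A(2) show ?thesis by (simp add: mem refl_on_def)
    next
      case False
      then have "i - fst A \<in> {1..fst B}" using i by auto
      with B(2) False show ?thesis by (simp add: mem refl_on_def)
    qed
  qed
  show "sym (snd (A \<otimes>\<^sub>W B))"
    using A(3) B(3) by (auto simp: sym_def mem)
  show "trans (snd (A \<otimes>\<^sub>W B))"
  proof (rule transI)
    fix i j k assume "(i, j) \<in> snd (A \<otimes>\<^sub>W B)" "(j, k) \<in> snd (A \<otimes>\<^sub>W B)"
    then show "(i, k) \<in> snd (A \<otimes>\<^sub>W B)"
      unfolding mem using lt transD[OF A(4)] transD[OF B(4)] by (meson leD)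
  qed
qed

lemma weil_obj_tpow: "weil_tpow n \<in> Obj Weil"
  by (induction n) (simp_all add: weil_obj_unit weil_obj_tensor weil_obj_W)

lemma weil_unit_tensor: "\<N> \<otimes>\<^sub>W A = A"
  by (cases A) (auto simp: weil_tensor_def weil_unit_def image_iff)

lemma weil_gen_rel: "\<lbrakk>A \<in> Obj Weil; (i, j) \<in> snd A\<rbrakk> \<Longrightarrow> var i * var j \<in> weil_ideal A"
  using weil_ideal.gen[of i j A 1] by (simp add: npolys_1)

lemma weil_inl:
  assumes "A \<in> Obj Weil" "B \<in> Obj Weil"
  shows "weil_inl A B \<in> Hom Weil A (A \<otimes>\<^sub>W B)"
    and "i \<in> {1..fst A} \<Longrightarrow> weil_fun (weil_inl A B) (weil_class A (var i)) = weil_class (A \<otimes>\<^sub>W B) (var i)"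
proof -
  have "var i * var j \<in> weil_ideal (A \<otimes>\<^sub>W B)" if "(i, j) \<in> snd A" for i j
    using that by (intro weil_gen_rel weil_obj_tensor assms) (simp add: weil_tensor_def)
  note g = weil_gen[where U = var, OF assms(1) weil_obj_tensor[OF assms] refl npolys_var this]
  show "weil_inl A B \<in> Hom Weil A (A \<otimes>\<^sub>W B)"
    unfolding weil_inl_def by (rule g) auto
  show "i \<in> {1..fst A} \<Longrightarrow> weil_fun (weil_inl A B) (weil_class A (var i)) = weil_class (A \<otimes>\<^sub>W B) (var i)"
    unfolding weil_inl_def by (rule g) auto
qed

lemma weil_inr:
  assumes "A \<in> Obj Weil" "B \<in> Obj Weil"
  shows "weil_inr A B \<in> Hom Weil B (A \<otimes>\<^sub>W B)"
    and "i \<in> {1..fst B} \<Longrightarrow> weil_fun (weil_inr A B) (weil_class B (var i)) = weil_class (A \<otimes>\<^sub>W B) (var (fst A + i))"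
proof -
  have "var (fst A + i) * var (fst A + j) \<in> weil_ideal (A \<otimes>\<^sub>W B)" if "(i, j) \<in> snd B" for i j
    using that by (intro weil_gen_rel weil_obj_tensor assms) (force simp: weil_tensor_def)
  note g = weil_gen[where U = "\<lambda>i. var (fst A + i)", OF assms(2) weil_obj_tensor[OF assms] refl npolys_var this]
  show "weil_inr A B \<in> Hom Weil B (A \<otimes>\<^sub>W B)"
    unfolding weil_inr_def by (rule g) auto
  show "i \<in> {1..fst B} \<Longrightarrow> weil_fun (weil_inr A B) (weil_class B (var i)) = weil_class (A \<otimes>\<^sub>W B) (var (fst A + i))"
    unfolding weil_inr_def by (rule g) auto
qed

lemma weil_dom_cod: "f \<in> Hom Weil A B \<Longrightarrow> Dom Weil f = A" "f \<in> Hom Weil A B \<Longrightarrow> Cod Weil f = B"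
  by (simp_all add: Hom_def)

text \<open>The identity satisfies the equations defining the tensor product of arrows, and they determine
  an arrow on the generators of either factor.\<close>

lemma weil_tensor_id:
  assumes A: "A \<in> Obj Weil" and B: "B \<in> Obj Weil"
  shows "Id Weil A \<otimes>\<^sub>A Id Weil B = Id Weil (A \<otimes>\<^sub>W B)"
proof -
  note l = weil_inl[OF assms] and r = weil_inr[OF assms] and AB = weil_obj_tensor[OF assms]
  note dc = weil_dom_cod[OF weil_id_hom]
  show ?thesis
    unfolding weil_tensor_arr_def Let_def dc[OF A] dc[OF B]
  proof (rule the_equality)
    show "Id Weil (A \<otimes>\<^sub>W B) \<in> Hom Weil (A \<otimes>\<^sub>W B) (A \<otimes>\<^sub>W B) \<and>
      Id Weil (A \<otimes>\<^sub>W B) \<odot>\<^bsub>Weil\<^esub> weil_inl A B = weil_inl A B \<odot>\<^bsub>Weil\<^esub> Id Weil A \<and>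
      Id Weil (A \<otimes>\<^sub>W B) \<odot>\<^bsub>Weil\<^esub> weil_inr A B = weil_inr A B \<odot>\<^bsub>Weil\<^esub> Id Weil B"
      using weil_comp_id_left[OF l(1)] weil_comp_id_right[OF l(1)] weil_comp_id_left[OF r(1)]
        weil_comp_id_right[OF r(1)] weil_id_hom[OF AB] by simp
    fix h assume h: "h \<in> Hom Weil (A \<otimes>\<^sub>W B) (A \<otimes>\<^sub>W B) \<and>
      h \<odot>\<^bsub>Weil\<^esub> weil_inl A B = weil_inl A B \<odot>\<^bsub>Weil\<^esub> Id Weil A \<and>
      h \<odot>\<^bsub>Weil\<^esub> weil_inr A B = weil_inr A B \<odot>\<^bsub>Weil\<^esub> Id Weil B"
    show "h = Id Weil (A \<otimes>\<^sub>W B)"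
    proof (rule weil_arr_eqI[OF _ weil_id_hom[OF AB]])
      fix i assume i: "i \<in> {1..fst (A \<otimes>\<^sub>W B)}"
      have hl: "h \<odot>\<^bsub>Weil\<^esub> weil_inl A B = weil_inl A B" and hr: "h \<odot>\<^bsub>Weil\<^esub> weil_inr A B = weil_inr A B"
        using h weil_comp_id_right[OF l(1)] weil_comp_id_right[OF r(1)] by auto
      have c: "weil_class (A \<otimes>\<^sub>W B) (var i) \<in> carrier (weil_alg (A \<otimes>\<^sub>W B))"
        using i by (intro weil_class_carrier npolys_var) auto
      have "weil_fun h (weil_class (A \<otimes>\<^sub>W B) (var i)) = weil_class (A \<otimes>\<^sub>W B) (var i)"
      proof (cases "i \<le> fst A")
        case True
        with i have i: "i \<in> {1..fst A}" by auto
        show ?thesis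
          using weil_fun_comp[OF l(1), of h "A \<otimes>\<^sub>W B" "weil_class A (var i)"] h l(2)[OF i]
            weil_class_carrier[OF npolys_var[OF i]] unfolding hl by simp
      next
        case False
        with i have j: "i - fst A \<in> {1..fst B}" by auto
        show ?thesis
          using weil_fun_comp[OF r(1), of h "A \<otimes>\<^sub>W B" "weil_class B (var (i - fst A))"] h r(2)[OF j] False
            weil_class_carrier[OF npolys_var[OF j]] unfolding hr by simp
      qed
      with c show "weil_fun h (weil_class (A \<otimes>\<^sub>W B) (var i)) = weil_fun (Id Weil (A \<otimes>\<^sub>W B)) (weil_class (A \<otimes>\<^sub>W B) (var i))"
        by (simp add: weil_fun_id)
    qed (use h in simp)
  qed
qed

lemma weil_inr_unit: "B \<in> Obj Weil \<Longrightarrow> weil_inr \<N> B = Id Weil B"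
  using weil_inr[OF weil_obj_unit, of B]
  by (intro weil_arr_eqI[of _ B B])
     (auto simp: weil_unit_tensor weil_id_hom weil_fun_id weil_class_carrier npolys_var)

lemma weil_alg_closed:
  assumes "A \<in> Obj Weil"
  shows "\<zero>\<^bsub>weil_alg A\<^esub> \<in> carrier (weil_alg A)" "\<one>\<^bsub>weil_alg A\<^esub> \<in> carrier (weil_alg A)"
    and "\<And>x y. \<lbrakk>x \<in> carrier (weil_alg A); y \<in> carrier (weil_alg A)\<rbrakk> \<Longrightarrow> x \<oplus>\<^bsub>weil_alg A\<^esub> y \<in> carrier (weil_alg A)"
    and "\<And>x y. \<lbrakk>x \<in> carrier (weil_alg A); y \<in> carrier (weil_alg A)\<rbrakk> \<Longrightarrow> x \<otimes>\<^bsub>weil_alg A\<^esub> y \<in> carrier (weil_alg A)"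
  using assms by (auto simp: weil_carrier weil_zero weil_one weil_add weil_mult intro!: npolys_intros)

lemma weil_comp_hom:
  assumes "f \<in> Hom Weil A B" "g \<in> Hom Weil B C"
  shows "g \<odot>\<^bsub>Weil\<^esub> f \<in> Hom Weil A C"
proof -
  have f: "weil_fun f \<in> weil_homs A B" "A \<in> Obj Weil" and g: "weil_fun g \<in> weil_homs B C" "C \<in> Obj Weil" "B \<in> Obj Weil"
    using assms by (auto simp: weil_hom_iff)
  have "compose (carrier (weil_alg A)) (weil_fun g) (weil_fun f) \<in> weil_homs A C"
    using f(1) g(1) weil_alg_closed[OF f(2)]
    unfolding weil_homs_def ring_hom_def
    by (auto simp: compose_eq Pi_iff)
  with f g show ?thesis
    unfolding weil_comp_eq[OF assms] weil_hom_iff by simp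
qed

text \<open>As \<open>\<N> \<otimes> B\<close> is literally \<open>B\<close> and the right injection is the identity, one of the two equations
  defining \<open>Id \<otimes> f\<close> already says that it equals \<open>f\<close>; the other one compares arrows out of the
  initial object \<open>\<N>\<close>.  This turns the pullbacks \<open>A \<otimes> (B \<times> C)\<close> with \<open>A = \<N>\<close> into plain ones.\<close>

lemma weil_tensor_unit_left:
  assumes f: "f \<in> Hom Weil B B'"
  shows "Id Weil \<N> \<otimes>\<^sub>A f = f"
proof -
  have B: "B \<in> Obj Weil" "B' \<in> Obj Weil"
    using f by (auto simp: weil_hom_iff)
  note N = weil_obj_unit
  note l = weil_inl(1)[OF N] 
  show ?thesis
    unfolding weil_tensor_arr_def Let_def weil_dom_cod[OF f] weil_dom_cod[OF weil_id_hom[OF N]]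
      weil_unit_tensor weil_inr_unit[OF B(1)] weil_inr_unit[OF B(2)]
  proof (rule the_equality)
    have "f \<odot>\<^bsub>Weil\<^esub> weil_inl \<N> B = weil_inl \<N> B' \<odot>\<^bsub>Weil\<^esub> Id Weil \<N>"
      by (rule weil_arr_eqI[of _ \<N> B'])
         (use l[OF B(1)] l[OF B(2)] f weil_id_hom[OF N] in \<open>auto intro: weil_comp_hom simp: weil_unit_tensor\<close>)
    with f show "f \<in> Hom Weil B B' \<and> f \<odot>\<^bsub>Weil\<^esub> weil_inl \<N> B = weil_inl \<N> B' \<odot>\<^bsub>Weil\<^esub> Id Weil \<N> \<and>
        f \<odot>\<^bsub>Weil\<^esub> Id Weil B = Id Weil B' \<odot>\<^bsub>Weil\<^esub> f"
      by (simp add: weil_comp_id_left weil_comp_id_right)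
  qed (use f in \<open>auto simp: weil_comp_id_left weil_comp_id_right\<close>)
qed

lemma weil_p_hom: "weil_p \<in> Hom Weil W \<N>"
  unfolding weil_p_def
  by (rule weil_gen(1)[where U = "\<lambda>_. 0"]) (auto simp: weil_obj_W weil_obj_unit npolys_0 weil_ideal.zero)

lemma weil_0_hom: "weil_0 \<in> Hom Weil \<N> W"
  unfolding weil_0_def
  by (rule weil_gen(1)[where U = "\<lambda>_. 0"]) (auto simp: weil_obj_W weil_obj_unit npolys_0 weil_ideal.zero)

lemma weil_W_sq: "var (Suc 0) * var (Suc 0) \<in> weil_ideal W"
  by (rule weil_gen_rel[OF weil_obj_W]) (simp add: W_def weil_pow_def)

lemma weil_plus_hom: "weil_plus \<in> Hom Weil (weil_pow 2) W"
  unfolding weil_plus_def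
  by (rule weil_gen(1)[where U = "\<lambda>_. var 1"]) (auto simp: weil_obj_W weil_obj_pow npolys_var weil_W_sq)

text \<open>The relation \<open>x\<^sup>2 = 0\<close> is respected because \<open>(x\<^sub>1 x\<^sub>2)\<^sup>2\<close> is a multiple of \<open>x\<^sub>1\<^sup>2\<close>.\<close>

lemma weil_l_hom: "weil_l \<in> Hom Weil W (W \<otimes>\<^sub>W W)"
proof -
  have "var 1 * var 1 \<in> weil_ideal (W \<otimes>\<^sub>W W)"
    by (intro weil_gen_rel weil_obj_tensor weil_obj_W) (simp add: weil_tensor_def W_def weil_pow_def)
  from weil_ideal_mult[OF this, of "var 2 * var 2"]
  have "(var 1 * var 2) * (var 1 * var 2) \<in> weil_ideal (W \<otimes>\<^sub>W W)"
    by (simp add: npolys_intros ac_simps)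
  then show ?thesis
    unfolding weil_l_def
    by (intro weil_gen(1)[where U = "\<lambda>_. var 1 * var 2"])
       (auto simp: weil_obj_W weil_obj_tensor intro!: npolys_intros)
qed

lemma weil_proj:
  shows "weil_proj k \<in> Hom Weil (weil_pow 2) W"
    and "i \<in> {1..2} \<Longrightarrow> weil_fun (weil_proj k) (weil_class (weil_pow 2) (var i)) = weil_class W (if i = k then var 1 else 0)"
proof -
  note g = weil_gen[where U = "\<lambda>i. if i = k then var 1 else 0" and u = "\<lambda>i. weil_class W (if i = k then var 1 else 0)",
     of "weil_pow 2" W, OF weil_obj_pow weil_obj_W refl]
  show "weil_proj k \<in> Hom Weil (weil_pow 2) W"
    unfolding weil_proj_def by (rule g) (auto simp: npolys_intros weil_W_sq weil_ideal.zero)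
  show "i \<in> {1..2} \<Longrightarrow> weil_fun (weil_proj k) (weil_class (weil_pow 2) (var i)) = weil_class W (if i = k then var 1 else 0)"
    unfolding weil_proj_def by (rule g) (auto simp: npolys_intros weil_W_sq weil_ideal.zero)
qed

section \<open>The product of two copies of W\<close>

abbreviation const_coeff :: "npoly \<Rightarrow> nat"
  where "const_coeff P \<equiv> Poly_Mapping.lookup P 0"

abbreviation lin_coeff :: "nat \<Rightarrow> npoly \<Rightarrow> nat"
  where "lin_coeff i P \<equiv> Poly_Mapping.lookup P (Poly_Mapping.single i 1)"

lemma monomial_add_eq_0_iff: "(a + b = 0) \<longleftrightarrow> a = 0 \<and> b = 0" for a b :: "nat \<Rightarrow>\<^sub>0 nat"
  by (auto simp: poly_mapping_eq_iff lookup_add fun_eq_iff)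

lemma monomial_add_eq_single_iff:
  "(a + b = Poly_Mapping.single i 1) \<longleftrightarrow>
    a = 0 \<and> b = Poly_Mapping.single i 1 \<or> a = Poly_Mapping.single i 1 \<and> b = 0" for a b :: "nat \<Rightarrow>\<^sub>0 nat"
proof
  assume *: "a + b = Poly_Mapping.single i 1"
  have v: "Poly_Mapping.lookup a j + Poly_Mapping.lookup b j = (1 when i = j)" for j
    using arg_cong[OF *, of "\<lambda>m. Poly_Mapping.lookup m j"] by (simp add: lookup_add lookup_single)
  have z: "Poly_Mapping.lookup a j = 0" "Poly_Mapping.lookup b j = 0" if "i \<noteq> j" for j
    using v[of j] that by auto
  consider "Poly_Mapping.lookup a i = 0" "Poly_Mapping.lookup b i = 1" | "Poly_Mapping.lookup a i = 1" "Poly_Mapping.lookup b i = 0"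
    using v[of i] by (auto simp: add_is_1)
  then show "a = 0 \<and> b = Poly_Mapping.single i 1 \<or> a = Poly_Mapping.single i 1 \<and> b = 0"
  proof cases
    case 1
    then have "a = 0" "b = Poly_Mapping.single i 1"
      using z by (auto intro!: poly_mapping_eqI simp: lookup_single when_def) metis
    then show ?thesis by simp
  next
    case 2
    then have "b = 0" "a = Poly_Mapping.single i 1"
      using z by (auto intro!: poly_mapping_eqI simp: lookup_single when_def) metis
    then show ?thesis by simp
  qed
qed auto

lemma const_coeff_mult: "const_coeff (P * Q) = const_coeff P * const_coeff Q"
proof -
  have "(\<Sum>q. Poly_Mapping.lookup Q q when 0 = l + q) = (const_coeff Q when l = 0)" for l
  proof -
    have "(\<Sum>q. Poly_Mapping.lookup Q q when 0 = l + q) = (\<Sum>q. (Poly_Mapping.lookup Q q when l = 0) when q = 0)"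
      by (rule Sum_any.cong) (auto simp: when_def monomial_add_eq_0_iff eq_commute[of 0])
    then show ?thesis
      by simp
  qed
  then show ?thesis
    by (simp add: lookup_mult mult_when)
qed

text \<open>Taking the linear coefficients is a derivation over taking the constant coefficient.\<close>

lemma lin_coeff_mult: "lin_coeff i (P * Q) = const_coeff P * lin_coeff i Q + lin_coeff i P * const_coeff Q"
proof -
  let ?x = "Poly_Mapping.single i (1::nat)"
  have fin: "finite {a. (g a when a = k) \<noteq> (0::nat)}" for g and k :: "nat \<Rightarrow>\<^sub>0 nat"
    by (rule finite_subset[of _ "{k}"]) (auto simp: when_def)
  have ne: "?x \<noteq> 0"
    by (metis lookup_single_eq lookup_zero zero_neq_one)
  have "(\<Sum>q. Poly_Mapping.lookup Q q when ?x = l + q) = (lin_coeff i Q when l = 0) + (const_coeff Q when l = ?x)" for l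
  proof -
    have "(\<Sum>q. Poly_Mapping.lookup Q q when ?x = l + q) =
        (\<Sum>q. (Poly_Mapping.lookup Q q when l = 0) when q = ?x) + (\<Sum>q. (Poly_Mapping.lookup Q q when l = ?x) when q = 0)"
      unfolding eq_commute[of ?x] monomial_add_eq_single_iff
      unfolding Sum_any.distrib[OF fin fin, symmetric]
      using ne by (intro Sum_any.cong) (auto simp: when_def)
    then show ?thesis
      by simp
  qed
  moreover have "(\<Sum>l. Poly_Mapping.lookup P l * ((lin_coeff i Q when l = 0) + (const_coeff Q when l = ?x))) =
      (\<Sum>l. Poly_Mapping.lookup P l * lin_coeff i Q when l = 0) + (\<Sum>l. Poly_Mapping.lookup P l * const_coeff Q when l = ?x)"
    unfolding Sum_any.distrib[OF fin fin, symmetric] by (simp add: mult_when distrib_left)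
  ultimately show ?thesis
    by (simp add: lookup_mult)
qed

lemma const_coeff_var: "const_coeff (var i) = 0"
  and lin_coeff_var: "lin_coeff i (var j) = (if i = j then 1 else 0)"
  and lin_coeff_of_nat: "lin_coeff i (of_nat c) = 0"
  and lin_coeff_one: "lin_coeff i 1 = 0"
proof -
  have ne: "Poly_Mapping.single i (1::nat) \<noteq> 0" for i
    by (metis lookup_single_eq lookup_zero zero_neq_one)
  have "Poly_Mapping.single j (1::nat) = Poly_Mapping.single i 1 \<longleftrightarrow> i = j"
    by (metis lookup_single_eq lookup_single_not_eq zero_neq_one)
  then show "const_coeff (var i) = 0" "lin_coeff i (var j) = (if i = j then 1 else 0)" 
    "lin_coeff i (of_nat c) = 0" "lin_coeff i 1 = 0"
    using ne[of i] by (auto simp: var_def lookup_single lookup_of_nat lookup_one when_def)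
qed

lemmas coeff_simps = lookup_add const_coeff_mult lin_coeff_mult const_coeff_var lin_coeff_var
  lin_coeff_of_nat lookup_of_nat[of _ 0, simplified] lin_coeff_one lookup_one_zero

definition low_degree :: "(nat \<Rightarrow>\<^sub>0 nat) \<Rightarrow> bool"
  where "low_degree m \<longleftrightarrow> m = 0 \<or> (\<exists>i. m = Poly_Mapping.single i 1)"

lemma monomial_pos_split:
  assumes "m \<noteq> 0" 
  obtains i m' where "m = m' + Poly_Mapping.single i (1::nat)"
proof -
  obtain i where "Poly_Mapping.lookup m i \<noteq> 0"
    using assms by (metis poly_mapping_eqI lookup_zero)
  then have "m = (m - Poly_Mapping.single i 1) + Poly_Mapping.single i (1::nat)"
    by (intro poly_mapping_eqI) (auto simp: lookup_add lookup_minus lookup_single when_def)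
  then show ?thesis ..
qed

text \<open>A monomial of degree at least two is divisible by a product of two variables, and in \<open>W\<^sup>n\<close>
  every such product is a relation.\<close>

lemma weil_pow_ideal_single:
  assumes "\<not> low_degree m" and m: "Poly_Mapping.keys m \<subseteq> {1..n}"
  shows "Poly_Mapping.single m c \<in> weil_ideal (weil_pow n)"
proof -
  obtain i m' where m': "m = m' + Poly_Mapping.single i (1::nat)"
    using assms(1) monomial_pos_split by (metis low_degree_def)
  then have "m' \<noteq> 0"
    using assms(1) by (auto simp: low_degree_def)
  then obtain j m'' where m'': "m' = m'' + Poly_Mapping.single j (1::nat)"
    using monomial_pos_split by metis
  have look: "Poly_Mapping.lookup m k = Poly_Mapping.lookup m'' k + (1 when j = k) + (1 when i = k)" for k
    by (simp add: m' m'' lookup_add lookup_single)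
  have keys: "Poly_Mapping.keys m'' \<subseteq> {1..n}" "i \<in> {1..n}" "j \<in> {1..n}"
    using m by (auto simp: in_keys_iff look subset_iff)
  have "Poly_Mapping.single m c = Poly_Mapping.single m'' c * (var j * var i)"
    by (simp add: var_def mult_single m' m'' ac_simps)
  moreover have "Poly_Mapping.single m'' c \<in> npolys n"
    using keys(1) by (auto simp: npolys_def)
  moreover have "(j, i) \<in> snd (weil_pow n)"
    using keys by (simp add: weil_pow_def)
  ultimately show ?thesis
    using weil_ideal.gen[of j i "weil_pow n" "Poly_Mapping.single m'' c"] by simp
qed

lemma weil_pow_ideal_coeff:
  assumes "S \<in> weil_ideal (weil_pow n)"
  shows "const_coeff S = 0 \<and> lin_coeff i S = 0"
  using assms by induction (simp_all add: coeff_simps del: One_nat_def)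

text \<open>In \<open>W\<^sup>n\<close> exactly the terms of degree at most one survive.  If \<open>P\<close> and \<open>Q\<close> agree in these
  degrees, adding to each the terms of higher degree of the other gives the same polynomial.\<close>

lemma weil_pow_class_eq_iff:
  assumes P: "P \<in> npolys n" and Q: "Q \<in> npolys n"
  shows "weil_class (weil_pow n) P = weil_class (weil_pow n) Q \<longleftrightarrow>
    const_coeff P = const_coeff Q \<and> (\<forall>i\<in>{1..n}. lin_coeff i P = lin_coeff i Q)"
proof -
  have "(P, Q) \<in> weil_rel (weil_pow n)" 
    if c: "const_coeff P = const_coeff Q" and l: "\<forall>i\<in>{1..n}. lin_coeff i P = lin_coeff i Q"
  proof -
    \<comment> \<open>The part of a polynomial that lies in the ideal.\<close>
    define hi where "hi P = (\<Sum>m\<in>{m \<in> Poly_Mapping.keys P. \<not> low_degree m}. Poly_Mapping.single m (Poly_Mapping.lookup P m))" for P :: npoly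
    have hi_lookup: "Poly_Mapping.lookup (hi P) m = (if low_degree m then 0 else Poly_Mapping.lookup P m)" for m P
      by (simp add: hi_def lookup_sum lookup_single when_def in_keys_iff)
    have hi_ideal: "hi P \<in> weil_ideal (weil_pow n)" if P: "P \<in> npolys n" for P
    proof -
      have sum: "sum f X \<in> weil_ideal (weil_pow n)" if "finite X" "\<And>x. x \<in> X \<Longrightarrow> f x \<in> weil_ideal (weil_pow n)"
        for f :: "(nat \<Rightarrow>\<^sub>0 nat) \<Rightarrow> npoly" and X
        using that by (induction X rule: finite_induct) (simp_all add: weil_ideal.zero weil_ideal.add)
      show ?thesis
        unfolding hi_def
      proof (rule sum)
        fix m assume m: "m \<in> {m \<in> Poly_Mapping.keys P. \<not> low_degree m}"
        then have "Poly_Mapping.keys m \<subseteq> {1..n}"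
          using P by (simp add: npolys_def)
        with m show "Poly_Mapping.single m (Poly_Mapping.lookup P m) \<in> weil_ideal (weil_pow n)"
          by (simp add: weil_pow_ideal_single)
      qed simp
    qed
    have out: "lin_coeff i P = 0" if "P \<in> npolys n" "i \<notin> {1..n}" for i P
    proof (rule ccontr)
      assume "lin_coeff i P \<noteq> 0"
      then have "Poly_Mapping.single i 1 \<in> Poly_Mapping.keys P"
        unfolding in_keys_iff .
      then have "Poly_Mapping.keys (Poly_Mapping.single i (1::nat)) \<subseteq> {1..n}"
        using that(1) unfolding npolys_def by blast
      with that(2) show False
        by simp
    qed
    have low: "Poly_Mapping.lookup P m = Poly_Mapping.lookup Q m" if "low_degree m" for m
      using that c l out[OF P] out[OF Q] unfolding low_degree_def by metis
    have "P + hi Q = Q + hi P"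
      by (rule poly_mapping_eqI) (simp add: lookup_add hi_lookup low)
    with hi_ideal P Q show ?thesis
      unfolding weil_rel_def by auto
  qed
  moreover have "const_coeff P = const_coeff Q \<and> lin_coeff i P = lin_coeff i Q" if rel: "(P, Q) \<in> weil_rel (weil_pow n)" for i
  proof -
    obtain S S' where S: "S \<in> weil_ideal (weil_pow n)" "S' \<in> weil_ideal (weil_pow n)" "P + S = Q + S'"
      using rel by (auto simp: weil_rel_def)
    have "Poly_Mapping.lookup (P + S) m = Poly_Mapping.lookup (Q + S') m" for m
      by (simp add: S(3))
    from this[of 0] this[of "Poly_Mapping.single i 1"] show ?thesis
      using weil_pow_ideal_coeff[OF S(1), of i] weil_pow_ideal_coeff[OF S(2), of i] by (simp add: lookup_add)
  qed
  ultimately show ?thesis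
    using weil_class_eq_iff[OF weil_obj_pow, of P n Q] P Q by auto
qed

lemma W_class_eq_iff:
  assumes "P \<in> npolys 1" "Q \<in> npolys 1"
  shows "weil_class W P = weil_class W Q \<longleftrightarrow> const_coeff P = const_coeff Q \<and> lin_coeff 1 P = lin_coeff 1 Q"
  using weil_pow_class_eq_iff[of P 1 Q] assms by (simp add: W_def)

text \<open>Both sides are additive and obey the same product rules, so it suffices to compare them at the
  variables.\<close>

lemma weil_proj_coeffs:
  assumes "P \<in> npolys 2" and k: "k \<in> {1..2}"
  shows "\<exists>Q\<in>npolys 1. weil_fun (weil_proj k) (weil_class (weil_pow 2) P) = weil_class W Q \<and>
    const_coeff Q = const_coeff P \<and> lin_coeff 1 Q = lin_coeff k P"
  using assms(1)
proof (induction rule: npolys_induct)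
  have hom: "weil_fun (weil_proj k) \<in> weil_homs (weil_pow 2) W"
    using weil_proj(1)[of k] by (simp add: weil_hom_iff)
  note h = weil_homsD[OF hom weil_obj_pow, unfolded fst_weil]
  {
    case zero
    show ?case by (intro bexI[of _ 0]) (auto simp: h npolys_0)
  next
    case one
    show ?case by (intro bexI[of _ 1]) (auto simp: h npolys_1 coeff_simps simp del: One_nat_def)
  next
    case (var i)
    show ?case
      by (intro bexI[of _ "if i = k then var 1 else 0"])
         (use var in \<open>auto simp: weil_proj(2) coeff_simps npolys_0 npolys_var simp del: One_nat_def\<close>)
  next
    case (add P P')
    then obtain Q Q' where Q: "Q \<in> npolys 1" "weil_fun (weil_proj k) (weil_class (weil_pow 2) P) = weil_class W Q"
        "const_coeff Q = const_coeff P" "lin_coeff 1 Q = lin_coeff k P"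
      and Q': "Q' \<in> npolys 1" "weil_fun (weil_proj k) (weil_class (weil_pow 2) P') = weil_class W Q'"
        "const_coeff Q' = const_coeff P'" "lin_coeff 1 Q' = lin_coeff k P'"
      by blast
    then show ?case
      using add.hyps weil_add[OF weil_obj_W, of Q Q']
      by (intro bexI[of _ "Q + Q'"]) (auto simp: h coeff_simps npolys_add simp del: One_nat_def)
  next
    case (mult P P')
    then obtain Q Q' where Q: "Q \<in> npolys 1" "weil_fun (weil_proj k) (weil_class (weil_pow 2) P) = weil_class W Q"
        "const_coeff Q = const_coeff P" "lin_coeff 1 Q = lin_coeff k P"
      and Q': "Q' \<in> npolys 1" "weil_fun (weil_proj k) (weil_class (weil_pow 2) P') = weil_class W Q'"
        "const_coeff Q' = const_coeff P'" "lin_coeff 1 Q' = lin_coeff k P'"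
      by blast
    then show ?case
      using mult.hyps weil_mult[OF weil_obj_W, of Q Q']
      by (intro bexI[of _ "Q * Q'"]) (auto simp: h coeff_simps npolys_mult simp del: One_nat_def)
  }
qed

text \<open>This is terminality of \<open>\<N>\<close> seen on constant coefficients: each generator of \<open>Z\<close> squares to zero,
  so its image has a constant coefficient that squares to zero, and the naturals have no nilpotents.\<close>

lemma weil_homs_W_const_unique:
  assumes Z: "Z \<in> Obj Weil" and a: "a \<in> weil_homs Z W" and b: "b \<in> weil_homs Z W"
    and P: "P \<in> npolys (fst Z)"
    and Q: "Q \<in> npolys 1" "a (weil_class Z P) = weil_class W Q"
    and R: "R \<in> npolys 1" "b (weil_class Z P) = weil_class W R"
  shows "const_coeff Q = const_coeff R"
proof -
  note ha = weil_homsD[OF a Z] and hb = weil_homsD[OF b Z]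
  have rep: "\<exists>Q\<in>npolys 1. \<theta> (weil_class Z P) = weil_class W Q" if "\<theta> \<in> weil_homs Z W" "P \<in> npolys (fst Z)" for \<theta> P
    using weil_homsD(2)[OF that(1) Z weil_class_carrier[OF that(2)]] by (auto simp: weil_carrier)
  have nil: "const_coeff Q = 0" 
    if \<theta>: "\<theta> \<in> weil_homs Z W" and i: "i \<in> {1..fst Z}" and Q: "Q \<in> npolys 1" "\<theta> (weil_class Z (var i)) = weil_class W Q"
    for \<theta> i Q
  proof -
    have "weil_class Z (var i * var i) = weil_class Z 0"
      by (intro weil_class_ideal weil_gen_rel Z weil_obj_refl i)
    then have "weil_class W (Q * Q) = weil_class W 0"
      using weil_homsD(6)[OF \<theta> Z npolys_var[OF i] npolys_var[OF i]] weil_homsD(3)[OF \<theta> Z] Q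
      by (simp add: weil_mult[OF weil_obj_W])
    then show ?thesis
      using Q(1) by (simp add: W_class_eq_iff npolys_intros coeff_simps)
  qed
  from P have "\<exists>Q R. Q \<in> npolys 1 \<and> R \<in> npolys 1 \<and> a (weil_class Z P) = weil_class W Q \<and> b (weil_class Z P) = weil_class W R \<and>
    const_coeff Q = const_coeff R"
  proof (induction rule: npolys_induct)
    case zero
    show ?case by (intro exI[of _ 0]) (auto simp: ha hb npolys_0)
  next
    case one
    show ?case by (intro exI[of _ 1]) (auto simp: ha hb npolys_1)
  next
    case (var i)
    then show ?case using nil[OF a] nil[OF b] rep[OF a npolys_var] rep[OF b npolys_var] by metis
  next
    case (add P P')
    then obtain Q R Q' R' where *: "Q \<in> npolys 1" "R \<in> npolys 1" "a (weil_class Z P) = weil_class W Q"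
        "b (weil_class Z P) = weil_class W R" "const_coeff Q = const_coeff R"
        "Q' \<in> npolys 1" "R' \<in> npolys 1" "a (weil_class Z P') = weil_class W Q'"
        "b (weil_class Z P') = weil_class W R'" "const_coeff Q' = const_coeff R'"
      by blast
    with add.hyps show ?case
      by (intro exI[of _ "Q + Q'"] exI[of _ "R + R'"]) (simp add: ha hb weil_add[OF weil_obj_W] npolys_add lookup_add)
  next
    case (mult P P')
    then obtain Q R Q' R' where *: "Q \<in> npolys 1" "R \<in> npolys 1" "a (weil_class Z P) = weil_class W Q"
        "b (weil_class Z P) = weil_class W R" "const_coeff Q = const_coeff R"
        "Q' \<in> npolys 1" "R' \<in> npolys 1" "a (weil_class Z P') = weil_class W Q'"
        "b (weil_class Z P') = weil_class W R'" "const_coeff Q' = const_coeff R'"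
      by blast
    with mult.hyps show ?case
      by (intro exI[of _ "Q * Q'"] exI[of _ "R * R'"]) (simp add: ha hb weil_mult[OF weil_obj_W] npolys_mult const_coeff_mult)
  qed
  then show ?thesis
    using Q R by (metis W_class_eq_iff)
qed

text \<open>An element of \<open>W\<^sup>2\<close> is a constant together with two linear coefficients, and an element of \<open>W\<close>
  is a constant together with one.  Two homomorphisms into \<open>W\<close> have the same constant coefficients, so
  their values can be recombined into a value in \<open>W\<^sup>2\<close>, in exactly one way.\<close>

lemma weil_pow2_product: "is_product Weil W W (weil_pow 2) (weil_proj 1) (weil_proj 2)"
proof -
  have "\<exists>!h. h \<in> Hom Weil Z (weil_pow 2) \<and> weil_proj 1 \<odot>\<^bsub>Weil\<^esub> h = a \<and> weil_proj 2 \<odot>\<^bsub>Weil\<^esub> h = b"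
    if a: "a \<in> Hom Weil Z W" and b: "b \<in> Hom Weil Z W" for Z a b
  proof -
    have Z: "Z \<in> Obj Weil" and a': "weil_fun a \<in> weil_homs Z W" and b': "weil_fun b \<in> weil_homs Z W"
      using a b by (auto simp: weil_hom_iff)
    note ha = weil_homsD[OF a' Z] and hb = weil_homsD[OF b' Z]
    have rep: "\<exists>Q\<in>npolys 1. \<theta> (weil_class Z P) = weil_class W Q" if "\<theta> \<in> weil_homs Z W" "P \<in> npolys (fst Z)" for \<theta> P
      using weil_homsD(2)[OF that(1) Z weil_class_carrier[OF that(2)]] by (auto simp: weil_carrier)
    define rp where "rp e = (SOME Q. Q \<in> npolys 1 \<and> e = weil_class W Q)" for e
    define A where "A P = rp (weil_fun a (weil_class Z P))" for P
    define B where "B P = rp (weil_fun b (weil_class Z P))" for P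
    have A: "A P \<in> npolys 1" "weil_fun a (weil_class Z P) = weil_class W (A P)" if "P \<in> npolys (fst Z)" for P
      using someI_ex[of "\<lambda>Q. Q \<in> npolys 1 \<and> weil_fun a (weil_class Z P) = weil_class W Q"] rep[OF a' that]
      unfolding A_def rp_def by auto
    have B: "B P \<in> npolys 1" "weil_fun b (weil_class Z P) = weil_class W (B P)" if "P \<in> npolys (fst Z)" for P
      using someI_ex[of "\<lambda>Q. Q \<in> npolys 1 \<and> weil_fun b (weil_class Z P) = weil_class W Q"] rep[OF b' that]
      unfolding B_def rp_def by auto
    have AB: "const_coeff (B P) = const_coeff (A P)" if "P \<in> npolys (fst Z)" for P
      using weil_homs_W_const_unique[OF Z b' a' that B[OF that] A[OF that]] .
    have A_eq: "const_coeff (A P) = const_coeff Q \<and> lin_coeff 1 (A P) = lin_coeff 1 Q"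
      if "P \<in> npolys (fst Z)" "Q \<in> npolys 1" "weil_fun a (weil_class Z P) = weil_class W Q" for P Q
      using W_class_eq_iff[of "A P" Q] A[OF that(1)] that by simp
    have B_eq: "const_coeff (B P) = const_coeff Q \<and> lin_coeff 1 (B P) = lin_coeff 1 Q"
      if "P \<in> npolys (fst Z)" "Q \<in> npolys 1" "weil_fun b (weil_class Z P) = weil_class W Q" for P Q
      using W_class_eq_iff[of "B P" Q] B[OF that(1)] that by simp
    have A_hom: "const_coeff (A 0) = 0 \<and> lin_coeff 1 (A 0) = 0" "const_coeff (A 1) = 1 \<and> lin_coeff 1 (A 1) = 0"
      using A_eq[of 0 0] A_eq[of 1 1] by (simp_all add: ha npolys_intros coeff_simps del: One_nat_def)
    have B_hom: "const_coeff (B 0) = 0 \<and> lin_coeff 1 (B 0) = 0" "const_coeff (B 1) = 1 \<and> lin_coeff 1 (B 1) = 0"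
      using B_eq[of 0 0] B_eq[of 1 1] by (simp_all add: hb npolys_intros coeff_simps del: One_nat_def)
    have A_add: "const_coeff (A (P + Q)) = const_coeff (A P + A Q) \<and> lin_coeff 1 (A (P + Q)) = lin_coeff 1 (A P + A Q)"
      and A_mult: "const_coeff (A (P * Q)) = const_coeff (A P * A Q) \<and> lin_coeff 1 (A (P * Q)) = lin_coeff 1 (A P * A Q)"
      if "P \<in> npolys (fst Z)" "Q \<in> npolys (fst Z)" for P Q
    proof -
      have "weil_fun a (weil_class Z (P + Q)) = weil_class W (A P + A Q)"
        unfolding ha(5)[OF that] A(2)[OF that(1)] A(2)[OF that(2)]
        by (simp add: weil_add[OF weil_obj_W] A(1)[unfolded One_nat_def] that)
      then show "const_coeff (A (P + Q)) = const_coeff (A P + A Q) \<and> lin_coeff 1 (A (P + Q)) = lin_coeff 1 (A P + A Q)"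
        using that by (intro A_eq npolys_add A(1))
      have "weil_fun a (weil_class Z (P * Q)) = weil_class W (A P * A Q)"
        unfolding ha(6)[OF that] A(2)[OF that(1)] A(2)[OF that(2)]
        by (simp add: weil_mult[OF weil_obj_W] A(1)[unfolded One_nat_def] that)
      then show "const_coeff (A (P * Q)) = const_coeff (A P * A Q) \<and> lin_coeff 1 (A (P * Q)) = lin_coeff 1 (A P * A Q)"
        using that by (intro A_eq npolys_mult A(1))
    qed
    have B_add: "const_coeff (B (P + Q)) = const_coeff (B P + B Q) \<and> lin_coeff 1 (B (P + Q)) = lin_coeff 1 (B P + B Q)"
      and B_mult: "const_coeff (B (P * Q)) = const_coeff (B P * B Q) \<and> lin_coeff 1 (B (P * Q)) = lin_coeff 1 (B P * B Q)"
      if "P \<in> npolys (fst Z)" "Q \<in> npolys (fst Z)" for P Q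
    proof -
      have "weil_fun b (weil_class Z (P + Q)) = weil_class W (B P + B Q)"
        unfolding hb(5)[OF that] B(2)[OF that(1)] B(2)[OF that(2)]
        by (simp add: weil_add[OF weil_obj_W] B(1)[unfolded One_nat_def] that)
      then show "const_coeff (B (P + Q)) = const_coeff (B P + B Q) \<and> lin_coeff 1 (B (P + Q)) = lin_coeff 1 (B P + B Q)"
        using that by (intro B_eq npolys_add B(1))
      have "weil_fun b (weil_class Z (P * Q)) = weil_class W (B P * B Q)"
        unfolding hb(6)[OF that] B(2)[OF that(1)] B(2)[OF that(2)]
        by (simp add: weil_mult[OF weil_obj_W] B(1)[unfolded One_nat_def] that)
      then show "const_coeff (B (P * Q)) = const_coeff (B P * B Q) \<and> lin_coeff 1 (B (P * Q)) = lin_coeff 1 (B P * B Q)"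
        using that by (intro B_eq npolys_mult B(1))
    qed
    \<comment> \<open>The constant coefficient could equally be read off \<open>B P\<close>, by \<open>AB\<close>.\<close>
    define f :: "npoly \<Rightarrow> npoly" where "f P = of_nat (const_coeff (A P)) + of_nat (lin_coeff 1 (A P)) * var 1 + of_nat (lin_coeff 1 (B P)) * var 2" for P
    have f: "f P \<in> npolys 2" for P
      by (simp add: f_def npolys_intros)
    have fc: "const_coeff (f P) = const_coeff (A P)" "lin_coeff 1 (f P) = lin_coeff 1 (A P)" "lin_coeff 2 (f P) = lin_coeff 1 (B P)" for P
      by (simp_all add: f_def coeff_simps del: One_nat_def)
    have ball: "(\<forall>i\<in>{1..2}. Q i) \<longleftrightarrow> Q 1 \<and> Q 2" for Q :: "nat \<Rightarrow> bool"
      by (auto simp: le_Suc_eq numeral_2_eq_2)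
    note eq2 = weil_pow_class_eq_iff[of _ 2, unfolded ball]
    have well: "weil_class (weil_pow 2) (f P) = weil_class (weil_pow 2) (f Q)" if "weil_class Z P = weil_class Z Q" for P Q
      by (simp add: f_def A_def B_def that)
    \<comment> \<open>By \<open>well\<close>, the choice of a representative does not affect the class.\<close>
    define \<theta> where "\<theta> = (\<lambda>e\<in>carrier (weil_alg Z). weil_class (weil_pow 2) (f (SOME P. P \<in> npolys (fst Z) \<and> e = weil_class Z P)))"
    have \<theta>: "\<theta> (weil_class Z P) = weil_class (weil_pow 2) (f P)" if P: "P \<in> npolys (fst Z)" for P
    proof -
      have "weil_class Z P = weil_class Z (SOME P'. P' \<in> npolys (fst Z) \<and> weil_class Z P = weil_class Z P')"
        by (rule conjunct2[OF someI[of "\<lambda>P'. P' \<in> npolys (fst Z) \<and> weil_class Z P = weil_class Z P'" P, OF conjI[OF P refl]]])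
      from well[OF this] show ?thesis
        using weil_class_carrier[OF P] by (simp add: \<theta>_def)
    qed
    have \<theta>_hom: "\<theta> \<in> weil_homs Z (weil_pow 2)"
    proof (rule weil_homsI[OF Z weil_obj_pow, where r = f])
      show "\<theta> \<in> extensional (carrier (weil_alg Z))"
        by (simp add: \<theta>_def)
    qed (simp_all add: f \<theta> eq2 npolys_intros fc coeff_simps A_hom B_hom A_add B_add A_mult B_mult AB del: One_nat_def)
    have h: "(Z, \<theta>, weil_pow 2) \<in> Hom Weil Z (weil_pow 2)"
      using \<theta>_hom Z weil_obj_pow by (simp add: weil_hom_iff)
    have proj: "weil_fun (weil_proj k \<odot>\<^bsub>Weil\<^esub> h) (weil_class Z P) = weil_class W Q \<longleftrightarrow>
        const_coeff Q = const_coeff R \<and> lin_coeff 1 Q = lin_coeff k R"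
      if h: "h \<in> Hom Weil Z (weil_pow 2)" "weil_fun h (weil_class Z P) = weil_class (weil_pow 2) R"
        and P: "P \<in> npolys (fst Z)" and R: "R \<in> npolys 2" and Q: "Q \<in> npolys 1" and k: "k \<in> {1..2}" for k h P Q R
    proof -
      obtain S where "S \<in> npolys 1" "weil_fun (weil_proj k) (weil_class (weil_pow 2) R) = weil_class W S"
          "const_coeff S = const_coeff R" "lin_coeff 1 S = lin_coeff k R"
        using weil_proj_coeffs[OF R k] by blast
      with weil_fun_comp[OF h(1) weil_proj(1)[of k] weil_class_carrier[OF P]] h(2) show ?thesis
        using W_class_eq_iff[of S Q] Q by auto
    qed
    show ?thesis
    proof (rule ex1I)
      have "weil_proj 1 \<odot>\<^bsub>Weil\<^esub> (Z, \<theta>, weil_pow 2) = a"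
      proof (rule weil_arr_eqI[OF weil_comp_hom[OF h weil_proj(1)] a])
        fix i assume "i \<in> {1..fst Z}"
        then have i: "var i \<in> npolys (fst Z)" by (rule npolys_var)
        show "weil_fun (weil_proj 1 \<odot>\<^bsub>Weil\<^esub> (Z, \<theta>, weil_pow 2)) (weil_class Z (var i)) = weil_fun a (weil_class Z (var i))"
          unfolding A(2)[OF i] using proj[OF h _ i f A(1)[OF i]] \<theta>[OF i] by (simp add: fc del: One_nat_def)
      qed
      moreover have "weil_proj 2 \<odot>\<^bsub>Weil\<^esub> (Z, \<theta>, weil_pow 2) = b"
      proof (rule weil_arr_eqI[OF weil_comp_hom[OF h weil_proj(1)] b])
        fix i assume "i \<in> {1..fst Z}"
        then have i: "var i \<in> npolys (fst Z)" by (rule npolys_var)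
        show "weil_fun (weil_proj 2 \<odot>\<^bsub>Weil\<^esub> (Z, \<theta>, weil_pow 2)) (weil_class Z (var i)) = weil_fun b (weil_class Z (var i))"
          unfolding B(2)[OF i] using proj[OF h _ i f B(1)[OF i]] \<theta>[OF i] by (simp add: fc AB i del: One_nat_def)
      qed
      ultimately show "(Z, \<theta>, weil_pow 2) \<in> Hom Weil Z (weil_pow 2) \<and>
          weil_proj 1 \<odot>\<^bsub>Weil\<^esub> (Z, \<theta>, weil_pow 2) = a \<and> weil_proj 2 \<odot>\<^bsub>Weil\<^esub> (Z, \<theta>, weil_pow 2) = b"
        using h by simp
    next
      fix g assume g: "g \<in> Hom Weil Z (weil_pow 2) \<and> weil_proj 1 \<odot>\<^bsub>Weil\<^esub> g = a \<and> weil_proj 2 \<odot>\<^bsub>Weil\<^esub> g = b"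
      show "g = (Z, \<theta>, weil_pow 2)"
      proof (rule weil_arr_eqI[OF _ h])
        fix i assume "i \<in> {1..fst Z}"
        then have i: "var i \<in> npolys (fst Z)" by (rule npolys_var)
        have "weil_fun g (weil_class Z (var i)) \<in> carrier (weil_alg (weil_pow 2))"
          using g i by (intro weil_fun_carrier[of _ Z] weil_class_carrier) auto
        then obtain R where R: "R \<in> npolys 2" "weil_fun g (weil_class Z (var i)) = weil_class (weil_pow 2) R"
          by (auto simp: weil_carrier)
        show "weil_fun g (weil_class Z (var i)) = weil_fun (Z, \<theta>, weil_pow 2) (weil_class Z (var i))"
          using proj[of g "var i" R "A (var i)" 1] proj[of g "var i" R "B (var i)" 2] g i R A[OF i] B[OF i]
          by (simp add: \<theta> eq2 f fc del: One_nat_def)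
      qed (use g in simp)
    qed
  qed
  then show ?thesis
    unfolding is_product_def by (simp add: weil_obj_W weil_obj_pow weil_proj(1))
qed

section \<open>Isomorphisms, pullbacks and pairings\<close>

lemma ex1_eqD: "\<lbrakk>\<exists>!x. P x; P a; P b\<rbrakk> \<Longrightarrow> a = b"
  by blast

context category
begin

lemma comp_arr:
  assumes "f \<in> Arr C" "g \<in> Arr C" "Dom C g = Cod C f"
  shows "g \<odot> f \<in> Arr C" "Dom C (g \<odot> f) = Dom C f" "Cod C (g \<odot> f) = Cod C g"
  using comp_hom[of f "Dom C f" "Cod C f" g "Cod C g"] assms by (auto simp: Hom_def)

lemma id_arr:
  assumes "X \<in> Obj C"
  shows "Id C X \<in> Arr C" "Dom C (Id C X) = X" "Cod C (Id C X) = X"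
  using id_hom[OF assms] by (auto simp: Hom_def)

lemma assoc:
  assumes "f \<in> Arr C" "g \<in> Arr C" "h \<in> Arr C" "Dom C g = Cod C f" "Dom C h = Cod C g"
  shows "(h \<odot> g) \<odot> f = h \<odot> (g \<odot> f)"
  using comp_assoc[of f "Dom C f" "Cod C f" g "Cod C g" h "Cod C h"] assms by (auto simp: Hom_def)

lemma id_left: "\<lbrakk>f \<in> Arr C; Cod C f = X\<rbrakk> \<Longrightarrow> Id C X \<odot> f = f"
  using comp_id_left[of f "Dom C f" X] by (auto simp: Hom_def)

lemma id_right: "\<lbrakk>f \<in> Arr C; Dom C f = X\<rbrakk> \<Longrightarrow> f \<odot> Id C X = f"
  using comp_id_right[of f X "Cod C f"] by (auto simp: Hom_def)

lemmas cat_simps = comp_arr id_arr assoc id_left id_right dom_obj cod_obj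

lemma inverse_arrowsD:
  assumes "inverse_arrows C f g"
  shows "f \<in> Arr C" "g \<in> Arr C" "Dom C g = Cod C f" "Cod C g = Dom C f"
    "g \<odot> f = Id C (Dom C f)" "f \<odot> g = Id C (Cod C f)"
  using assms by (auto simp: inverse_arrows_def Hom_def)

lemma inverse_cancel:
  assumes "inverse_arrows C f g"
  shows "\<lbrakk>x \<in> Arr C; Cod C x = Dom C f\<rbrakk> \<Longrightarrow> g \<odot> (f \<odot> x) = x"
    and "\<lbrakk>x \<in> Arr C; Cod C x = Cod C f\<rbrakk> \<Longrightarrow> f \<odot> (g \<odot> x) = x"
  using inverse_arrowsD[OF assms] by (simp_all add: id_left flip: assoc)

lemma inverse_cancel_right:
  assumes "inverse_arrows C f g"
  shows "\<lbrakk>x \<in> Arr C; Dom C x = Dom C f\<rbrakk> \<Longrightarrow> (x \<odot> g) \<odot> f = x"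
    and "\<lbrakk>x \<in> Arr C; Dom C x = Cod C f\<rbrakk> \<Longrightarrow> (x \<odot> f) \<odot> g = x"
  using inverse_arrowsD[OF assms] by (simp_all add: id_right assoc)

lemma inverse_arrows_unique:
  assumes "inverse_arrows C f g" "inverse_arrows C f g'"
  shows "g = g'"
  using inverse_cancel(1)[OF assms(1), of g'] inverse_arrowsD[OF assms(1)] inverse_arrowsD[OF assms(2)]
  by (simp add: id_right)

lemma inv_arr:
  assumes "\<exists>g. inverse_arrows C f g"
  shows "inverse_arrows C f (inv_arr C f)"
  using assms unfolding inv_arr_def by (metis inverse_arrows_unique theI)

lemma inverse_arrows_comp:
  assumes "inverse_arrows C f f'" "inverse_arrows C g g'" "Dom C g = Cod C f"
  shows "inverse_arrows C (g \<odot> f) (f' \<odot> g')"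
  using inverse_arrowsD[OF assms(1)] inverse_arrowsD[OF assms(2)] assms(3)
    inverse_cancel[OF assms(1)] inverse_cancel[OF assms(2)]
  unfolding inverse_arrows_def by (simp add: Hom_def comp_arr assoc)

lemma is_pullbackD:
  assumes "is_pullback C p q f g"
  shows "p \<in> Arr C" "q \<in> Arr C" "f \<in> Arr C" "g \<in> Arr C" "Dom C q = Dom C p"
    "Cod C p = Dom C f" "Cod C q = Dom C g" "Cod C g = Cod C f" "f \<odot> p = g \<odot> q"
  using assms by (auto simp: is_pullback_def)

lemma is_pullback_ex1:
  assumes "is_pullback C p q f g"
    and "a \<in> Arr C" "b \<in> Arr C" "Dom C b = Dom C a" "Cod C a = Dom C f" "Cod C b = Dom C g" "f \<odot> a = g \<odot> b"
  shows "\<exists>!h. h \<in> Arr C \<and> Dom C h = Dom C a \<and> Cod C h = Dom C p \<and> p \<odot> h = a \<and> q \<odot> h = b"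
proof -
  have "a \<in> Hom C (Dom C a) (Dom C f)" "b \<in> Hom C (Dom C a) (Dom C g)"
    using assms by (simp_all add: Hom_def)
  then have "\<exists>!h. h \<in> Hom C (Dom C a) (Dom C p) \<and> p \<odot> h = a \<and> q \<odot> h = b"
    using assms(1,7) dom_obj[OF assms(2)] unfolding is_pullback_def by blast
  then show ?thesis
    by (simp add: Hom_def conj_assoc)
qed

lemma is_pullbackI:
  assumes "p \<in> Arr C" "q \<in> Arr C" "f \<in> Arr C" "g \<in> Arr C" "Dom C q = Dom C p"
    "Cod C p = Dom C f" "Cod C q = Dom C g" "Cod C g = Cod C f" "f \<odot> p = g \<odot> q"
    and ex: "\<And>a b. \<lbrakk>a \<in> Arr C; b \<in> Arr C; Dom C b = Dom C a; Cod C a = Dom C f; Cod C b = Dom C g; f \<odot> a = g \<odot> b\<rbrakk> \<Longrightarrow>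
      \<exists>h. h \<in> Arr C \<and> Dom C h = Dom C a \<and> Cod C h = Dom C p \<and> p \<odot> h = a \<and> q \<odot> h = b"
    and uniq: "\<And>h k. \<lbrakk>h \<in> Arr C; k \<in> Arr C; Dom C h = Dom C k; Cod C h = Dom C p; Cod C k = Dom C p;
      p \<odot> h = p \<odot> k; q \<odot> h = q \<odot> k\<rbrakk> \<Longrightarrow> h = k"
  shows "is_pullback C p q f g"
  unfolding is_pullback_def
proof (intro conjI ballI impI)
  fix Z a b assume "Z \<in> Obj C" "a \<in> Hom C Z (Dom C f)" "b \<in> Hom C Z (Dom C g)" "f \<odot> a = g \<odot> b"
  then obtain h where h: "h \<in> Hom C Z (Dom C p)" "p \<odot> h = a" "q \<odot> h = b"
    using ex[of a b] by (auto simp: Hom_def)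
  then show "\<exists>!h. h \<in> Hom C Z (Dom C p) \<and> p \<odot> h = a \<and> q \<odot> h = b"
  proof (intro ex1I[of _ h] conjI)
    fix k assume "k \<in> Hom C Z (Dom C p) \<and> p \<odot> k = a \<and> q \<odot> k = b"
    with h show "k = h"
      by - (rule uniq, auto simp: Hom_def)
  qed
qed (use assms in simp_all)

lemma is_pullback_joint_mono:
  assumes pb: "is_pullback C p q f g"
    and "h \<in> Arr C" "k \<in> Arr C" "Dom C h = Dom C k" "Cod C h = Dom C p" "Cod C k = Dom C p"
      "p \<odot> h = p \<odot> k" "q \<odot> h = q \<odot> k"
  shows "h = k"
proof -
  note d = is_pullbackD[OF pb]
  have "f \<odot> (p \<odot> h) = g \<odot> (q \<odot> h)"
    using d assms(2,5) by (simp flip: assoc)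
  moreover have "p \<odot> h \<in> Hom C (Dom C h) (Dom C f)" "q \<odot> h \<in> Hom C (Dom C h) (Dom C g)"
    using d assms(2,5) by (simp_all add: Hom_def comp_arr)
  ultimately have "\<exists>!k. k \<in> Hom C (Dom C h) (Dom C p) \<and> p \<odot> k = p \<odot> h \<and> q \<odot> k = q \<odot> h"
    using pb dom_obj[OF assms(2)] unfolding is_pullback_def by blast
  then show ?thesis
    by (rule ex1_eqD) (use assms in \<open>simp_all add: Hom_def\<close>)
qed

lemma pairing_eqI:
  assumes pb: "is_pullback C p q f g"
    and h: "h \<in> Arr C" "Dom C h = Dom C a" "Cod C h = Dom C p" "p \<odot> h = a" "q \<odot> h = b"
  shows "pairing C p q a b = h"
  unfolding pairing_def
proof (rule the_equality)
  fix k assume "k \<in> Hom C (Dom C a) (Dom C p) \<and> p \<odot> k = a \<and> q \<odot> k = b"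
  with h show "k = h"
    by - (rule is_pullback_joint_mono[OF pb], auto simp: Hom_def)
qed (use h in \<open>simp add: Hom_def\<close>)

lemma pairing:
  assumes pb: "is_pullback C p q f g"
    and "a \<in> Arr C" "b \<in> Arr C" "Dom C b = Dom C a" "Cod C a = Dom C f" "Cod C b = Dom C g" "f \<odot> a = g \<odot> b"
  shows "pairing C p q a b \<in> Arr C" "Dom C (pairing C p q a b) = Dom C a" "Cod C (pairing C p q a b) = Dom C p"
    "p \<odot> pairing C p q a b = a" "q \<odot> pairing C p q a b = b"
proof -
  obtain h where h: "h \<in> Arr C" "Dom C h = Dom C a" "Cod C h = Dom C p" "p \<odot> h = a" "q \<odot> h = b"
    using is_pullback_ex1[OF assms] by blast
  then show "pairing C p q a b \<in> Arr C" "Dom C (pairing C p q a b) = Dom C a" "Cod C (pairing C p q a b) = Dom C p"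
    "p \<odot> pairing C p q a b = a" "q \<odot> pairing C p q a b = b"
    unfolding pairing_eqI[OF pb h] .
qed

lemma pairing_comp:
  assumes pb: "is_pullback C p q f g"
    and ab: "a \<in> Arr C" "b \<in> Arr C" "Dom C b = Dom C a" "Cod C a = Dom C f" "Cod C b = Dom C g" "f \<odot> a = g \<odot> b"
    and e: "e \<in> Arr C" "Cod C e = Dom C a"
  shows "pairing C p q (a \<odot> e) (b \<odot> e) = pairing C p q a b \<odot> e"
  using pairing[OF pb ab] is_pullbackD[OF pb] ab e
  by - (rule pairing_eqI[OF pb], simp_all add: comp_arr flip: assoc)

lemma pullback_of_iso:
  assumes pb: "is_pullback C p q f g" and g: "inverse_arrows C g g'"
  shows "\<exists>p'. inverse_arrows C p p'"
proof -
  note d = is_pullbackD[OF pb] and i = inverse_arrowsD[OF g]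
  let ?a = "Id C (Dom C f)" and ?b = "g' \<odot> f"
  have ab: "?a \<in> Arr C" "?b \<in> Arr C" "Dom C ?b = Dom C ?a" "Cod C ?a = Dom C f" "Cod C ?b = Dom C g" "f \<odot> ?a = g \<odot> ?b"
    using d i by (simp_all add: cat_simps inverse_cancel[OF g])
  note h = pairing[OF pb ab]
  have "pairing C p q ?a ?b \<odot> p = Id C (Dom C p)"
  proof (rule is_pullback_joint_mono[OF pb])
    show "p \<odot> pairing C p q ?a ?b \<odot> p = p \<odot> Id C (Dom C p)"
      using h d by (simp add: cat_simps flip: assoc)
    have "q \<odot> pairing C p q ?a ?b \<odot> p = (g' \<odot> f) \<odot> p"
      using h d by (simp add: cat_simps flip: assoc)
    also have "\<dots> = q"
      using d i by (simp add: assoc inverse_cancel[OF g])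
    finally show "q \<odot> pairing C p q ?a ?b \<odot> p = q \<odot> Id C (Dom C p)"
      using d by (simp add: cat_simps)
  qed (use h d in \<open>simp_all add: cat_simps\<close>)
  then have "inverse_arrows C p (pairing C p q ?a ?b)"
    using h d by (simp add: inverse_arrows_def Hom_def cat_simps)
  then show ?thesis ..
qed

text \<open>Pasting a pullback to a square whose horizontal sides are invertible.\<close>

lemma pullback_precomp_iso:
  assumes pb: "is_pullback C p q f g" and m: "inverse_arrows C m m'" and n: "inverse_arrows C n n'"
    and q': "q' \<in> Arr C" "Dom C q' = Dom C m" "Cod C q' = Dom C n"
    and mn: "Cod C m = Dom C p" "Cod C n = Dom C g" "q \<odot> m = n \<odot> q'"
  shows "is_pullback C (p \<odot> m) q' f (g \<odot> n)"
proof -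
  note d = is_pullbackD[OF pb] and im = inverse_arrowsD[OF m] and i = inverse_arrowsD[OF n]
  show ?thesis
  proof (rule is_pullbackI)
    have "f \<odot> p \<odot> m = (g \<odot> q) \<odot> m"
      using d im mn by (simp flip: assoc)
    also have "\<dots> = g \<odot> n \<odot> q'"
      using d im mn by (simp add: assoc)
    finally show "f \<odot> p \<odot> m = (g \<odot> n) \<odot> q'"
      using d i q' mn by (simp add: assoc)
  next
    fix a b assume ab: "a \<in> Arr C" "b \<in> Arr C" "Dom C b = Dom C a" "Cod C a = Dom C f" "Cod C b = Dom C (g \<odot> n)"
      "f \<odot> a = (g \<odot> n) \<odot> b"
    then have nb: "n \<odot> b \<in> Arr C" "Dom C (n \<odot> b) = Dom C a" "Cod C (n \<odot> b) = Dom C g" "f \<odot> a = g \<odot> n \<odot> b" "Cod C b = Dom C n"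
      using d i mn by (simp_all add: cat_simps)
    note h = pairing[OF pb ab(1) nb(1,2) ab(4) nb(3,4)]
    let ?h = "m' \<odot> pairing C p q a (n \<odot> b)"
    have "n \<odot> q' \<odot> ?h = (q \<odot> m) \<odot> ?h"
      using h im i q' mn by (simp add: comp_arr flip: assoc)
    also have "\<dots> = n \<odot> b"
      using h im d mn(1,2) by (simp add: comp_arr assoc inverse_cancel[OF m])
    finally have "n' \<odot> n \<odot> q' \<odot> ?h = n' \<odot> n \<odot> b"
      by simp
    then have "q' \<odot> ?h = b"
      using h im i q' mn nb ab by (simp add: comp_arr inverse_cancel[OF n])
    with h show "\<exists>h. h \<in> Arr C \<and> Dom C h = Dom C a \<and> Cod C h = Dom C (p \<odot> m) \<and> (p \<odot> m) \<odot> h = a \<and> q' \<odot> h = b"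
      using d im mn by (intro exI[of _ ?h]) (simp add: cat_simps inverse_cancel[OF m])
  next
    fix h k assume hk: "h \<in> Arr C" "k \<in> Arr C" "Dom C h = Dom C k" "Cod C h = Dom C (p \<odot> m)" "Cod C k = Dom C (p \<odot> m)"
      "(p \<odot> m) \<odot> h = (p \<odot> m) \<odot> k" "q' \<odot> h = q' \<odot> k"
    then have hk': "Cod C h = Dom C m" "Cod C k = Dom C m"
      using d im mn by (simp_all add: comp_arr)
    have "q \<odot> m \<odot> h = n \<odot> q' \<odot> h" if "h \<in> Arr C" "Cod C h = Dom C m" for h
      using that d im i mn q' by (simp flip: assoc)
    then have "m \<odot> h = m \<odot> k"
      using hk hk' d im mn by - (rule is_pullback_joint_mono[OF pb], simp_all add: cat_simps)
    then show "h = k"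
      using inverse_cancel(1)[OF m] hk hk' by metis
  qed (use d im i q' mn in \<open>simp_all add: cat_simps\<close>)
qed

end

section \<open>Pullback powers\<close>

context category
begin

lemma is_pullback_powerD:
  assumes "is_pullback_power C q n P b \<pi>"
  shows "q \<in> Arr C" "P \<in> Obj C" "b \<in> Arr C" "Dom C b = P" "Cod C b = Cod C q"
    "\<And>i. i < n \<Longrightarrow> \<pi> i \<in> Arr C" "\<And>i. i < n \<Longrightarrow> Dom C (\<pi> i) = P" "\<And>i. i < n \<Longrightarrow> Cod C (\<pi> i) = Dom C q" 
    "\<And>i. i < n \<Longrightarrow> q \<odot> \<pi> i = b"
  using assms by (auto simp: is_pullback_power_def Hom_def)

lemma is_pullback_power_ex1:
  assumes "is_pullback_power C q n P b \<pi>" "Z \<in> Obj C" "z \<in> Hom C Z (Cod C q)"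
    "\<forall>i<n. a i \<in> Hom C Z (Dom C q) \<and> q \<odot> a i = z"
  shows "\<exists>!h. h \<in> Hom C Z P \<and> b \<odot> h = z \<and> (\<forall>i<n. \<pi> i \<odot> h = a i)"
  using assms unfolding is_pullback_power_def by blast

lemma is_pullback_power_ex:
  assumes "is_pullback_power C q n P b \<pi>"
    and "z \<in> Arr C" "Cod C z = Cod C q"
    and "\<And>i. i < n \<Longrightarrow> a i \<in> Arr C" "\<And>i. i < n \<Longrightarrow> Dom C (a i) = Dom C z" "\<And>i. i < n \<Longrightarrow> Cod C (a i) = Dom C q" 
    "\<And>i. i < n \<Longrightarrow> q \<odot> a i = z"
  shows "\<exists>h. h \<in> Arr C \<and> Dom C h = Dom C z \<and> Cod C h = P \<and> b \<odot> h = z \<and> (\<forall>i<n. \<pi> i \<odot> h = a i)"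
proof -
  have "\<forall>i<n. a i \<in> Hom C (Dom C z) (Dom C q) \<and> q \<odot> a i = z" "z \<in> Hom C (Dom C z) (Cod C q)"
    using assms by (simp_all add: Hom_def)
  then have "\<exists>!h. h \<in> Hom C (Dom C z) P \<and> b \<odot> h = z \<and> (\<forall>i<n. \<pi> i \<odot> h = a i)"
    by (intro is_pullback_power_ex1[OF assms(1) dom_obj[OF assms(2)]])
  then show ?thesis
    by (auto simp: Hom_def)
qed

lemma is_pullback_power_joint_mono:
  assumes pow: "is_pullback_power C q n P b \<pi>"
    and h: "h \<in> Arr C" "k \<in> Arr C" "Dom C h = Dom C k" "Cod C h = P" "Cod C k = P" "b \<odot> h = b \<odot> k"
      "\<And>i. i < n \<Longrightarrow> \<pi> i \<odot> h = \<pi> i \<odot> k"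
  shows "h = k"
proof -
  note d = is_pullback_powerD[OF pow]
  have "q \<odot> \<pi> i \<odot> h = b \<odot> h" if "i < n" for i
    using assoc[of h "\<pi> i" q] d(1) d(6-9)[OF that] h(1,4) by simp
  moreover have "\<pi> i \<odot> h \<in> Hom C (Dom C h) (Dom C q)" if "i < n" for i
    using d(6-9)[OF that] h(1,4) by (simp add: Hom_def comp_arr)
  ultimately have "\<forall>i<n. \<pi> i \<odot> h \<in> Hom C (Dom C h) (Dom C q) \<and> q \<odot> \<pi> i \<odot> h = b \<odot> h"
    by blast
  moreover have "b \<odot> h \<in> Hom C (Dom C h) (Cod C q)"
    using d(3-5) h(1,4) by (simp add: Hom_def comp_arr)
  ultimately have "\<exists>!k. k \<in> Hom C (Dom C h) P \<and> b \<odot> k = b \<odot> h \<and> (\<forall>i<n. \<pi> i \<odot> k = \<pi> i \<odot> h)"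
    by (intro is_pullback_power_ex1[OF pow dom_obj[OF h(1)]])
  then show ?thesis
    by (rule ex1_eqD) (use h in \<open>simp_all add: Hom_def\<close>)
qed

lemma is_pullback_powerI:
  assumes "q \<in> Arr C" "b \<in> Arr C" "Dom C b = P" "Cod C b = Cod C q"
    "\<And>i. i < n \<Longrightarrow> \<pi> i \<in> Arr C \<and> Dom C (\<pi> i) = P \<and> Cod C (\<pi> i) = Dom C q \<and> q \<odot> \<pi> i = b"
    and ex: "\<And>z a. \<lbrakk>z \<in> Arr C; Cod C z = Cod C q;
        \<And>i. i < n \<Longrightarrow> a i \<in> Arr C; \<And>i. i < n \<Longrightarrow> Dom C (a i) = Dom C z; \<And>i. i < n \<Longrightarrow> Cod C (a i) = Dom C q;
        \<And>i. i < n \<Longrightarrow> q \<odot> a i = z\<rbrakk> \<Longrightarrow>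
      \<exists>h. h \<in> Arr C \<and> Dom C h = Dom C z \<and> Cod C h = P \<and> b \<odot> h = z \<and> (\<forall>i<n. \<pi> i \<odot> h = a i)"
    and uniq: "\<And>h k. \<lbrakk>h \<in> Arr C; k \<in> Arr C; Dom C h = Dom C k; Cod C h = P; Cod C k = P;
      b \<odot> h = b \<odot> k; \<And>i. i < n \<Longrightarrow> \<pi> i \<odot> h = \<pi> i \<odot> k\<rbrakk> \<Longrightarrow> h = k"
  shows "is_pullback_power C q n P b \<pi>"
  unfolding is_pullback_power_def
proof (intro conjI ballI allI impI)
  fix Z z a assume *: "Z \<in> Obj C" "z \<in> Hom C Z (Cod C q)" "\<forall>i<n. a i \<in> Hom C Z (Dom C q) \<and> q \<odot> a i = z"
  then obtain h where h: "h \<in> Arr C \<and> Dom C h = Dom C z \<and> Cod C h = P \<and> b \<odot> h = z \<and> (\<forall>i<n. \<pi> i \<odot> h = a i)"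
    using ex[of z a] by (auto simp: Hom_def)
  show "\<exists>!h. h \<in> Hom C Z P \<and> b \<odot> h = z \<and> (\<forall>i<n. \<pi> i \<odot> h = a i)"
  proof (intro ex1I[of _ h])
    show "h \<in> Hom C Z P \<and> b \<odot> h = z \<and> (\<forall>i<n. \<pi> i \<odot> h = a i)"
      using h * by (simp add: Hom_def)
    fix k assume "k \<in> Hom C Z P \<and> b \<odot> k = z \<and> (\<forall>i<n. \<pi> i \<odot> k = a i)"
    with h * show "k = h"
      by - (rule uniq, auto simp: Hom_def)
  qed
qed (use assms(1-5) dom_obj[OF assms(2)] in \<open>auto simp: Hom_def\<close>)

lemma is_pullback_power_cong:
  assumes "is_pullback_power C q n P b \<pi>" "\<And>i. i < n \<Longrightarrow> \<pi> i = \<rho> i"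
  shows "is_pullback_power C q n P b \<rho>"
  using assms unfolding is_pullback_power_def by simp

text \<open>Together with the next lemma, this reduces pullback powers to iterated binary pullbacks, the
  only ones that a functor may be known to preserve.\<close>

lemma is_pullback_power_Suc:
  assumes pow: "is_pullback_power C q n P b \<pi>" and pb: "is_pullback C r s b q"
  shows "is_pullback_power C q (Suc n) (Dom C r) (b \<odot> r) (\<lambda>i. if i < n then \<pi> i \<odot> r else s)"
proof -
  note d = is_pullback_powerD[OF pow] and e = is_pullbackD[OF pb]
  show ?thesis
  proof (rule is_pullback_powerI)
    fix i assume "i < Suc n"
    show "(if i < n then \<pi> i \<odot> r else s) \<in> Arr C \<and> Dom C (if i < n then \<pi> i \<odot> r else s) = Dom C r \<and>
        Cod C (if i < n then \<pi> i \<odot> r else s) = Dom C q \<and> q \<odot> (if i < n then \<pi> i \<odot> r else s) = b \<odot> r"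
      using d e by (auto simp: comp_arr simp flip: assoc)
  next
    fix z a assume z: "z \<in> Arr C" "Cod C z = Cod C q"
        "\<And>i. i < Suc n \<Longrightarrow> a i \<in> Arr C" "\<And>i. i < Suc n \<Longrightarrow> Dom C (a i) = Dom C z" "\<And>i. i < Suc n \<Longrightarrow> Cod C (a i) = Dom C q"
        "\<And>i. i < Suc n \<Longrightarrow> q \<odot> a i = z"
    obtain k where k: "k \<in> Arr C" "Dom C k = Dom C z" "Cod C k = P" "b \<odot> k = z" "\<forall>i<n. \<pi> i \<odot> k = a i"
      using is_pullback_power_ex[OF pow, of z a] z by auto
    obtain h where h: "h \<in> Arr C" "Dom C h = Dom C k" "Cod C h = Dom C r" "r \<odot> h = k" "s \<odot> h = a n"
      using is_pullback_ex1[OF pb, of k "a n"] k z d by auto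
    show "\<exists>h. h \<in> Arr C \<and> Dom C h = Dom C z \<and> Cod C h = Dom C r \<and> (b \<odot> r) \<odot> h = z \<and>
        (\<forall>i<Suc n. (if i < n then \<pi> i \<odot> r else s) \<odot> h = a i)"
      using h k d e z(6)[of n] by (intro exI[of _ h]) (auto simp: assoc less_Suc_eq)
  next
    fix h k assume h: "h \<in> Arr C" "k \<in> Arr C" "Dom C h = Dom C k" "Cod C h = Dom C r" "Cod C k = Dom C r"
      "(b \<odot> r) \<odot> h = (b \<odot> r) \<odot> k"
      and i: "\<And>i. i < Suc n \<Longrightarrow> (if i < n then \<pi> i \<odot> r else s) \<odot> h = (if i < n then \<pi> i \<odot> r else s) \<odot> k"
    have "\<pi> i \<odot> r \<odot> h = \<pi> i \<odot> r \<odot> k" if "i < n" for i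
      using i[of i] that h d e by (simp add: assoc)
    then have "r \<odot> h = r \<odot> k"
      using h d e(1-8) by - (rule is_pullback_power_joint_mono[OF pow], simp_all add: comp_arr assoc)
    then show "h = k"
      using h e i[of n] by - (rule is_pullback_joint_mono[OF pb], simp_all)
  qed (use d e in \<open>simp_all add: comp_arr\<close>)
qed

lemma is_pullback_power_Suc_pullback:
  assumes pow: "is_pullback_power C q n P b \<pi>" and pow': "is_pullback_power C q (Suc n) Q c \<rho>"
  shows "\<exists>r. is_pullback C r (\<rho> n) b q \<and> b \<odot> r = c \<and> (\<forall>i<n. \<pi> i \<odot> r = \<rho> i)"
proof -
  note d = is_pullback_powerD[OF pow] and e = is_pullback_powerD[OF pow']
  obtain r where r: "r \<in> Arr C" "Dom C r = Dom C c" "Cod C r = P" "b \<odot> r = c" "\<forall>i<n. \<pi> i \<odot> r = \<rho> i"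
    using is_pullback_power_ex[OF pow, of c \<rho>] e by auto
  have "is_pullback C r (\<rho> n) b q"
  proof (rule is_pullbackI)
    fix x y assume xy: "x \<in> Arr C" "y \<in> Arr C" "Dom C y = Dom C x" "Cod C x = Dom C b" "Cod C y = Dom C q" "b \<odot> x = q \<odot> y"
    let ?a = "\<lambda>i. if i < n then \<pi> i \<odot> x else y"
    have "\<exists>h. h \<in> Arr C \<and> Dom C h = Dom C (b \<odot> x) \<and> Cod C h = Q \<and> c \<odot> h = b \<odot> x \<and> (\<forall>i<Suc n. \<rho> i \<odot> h = ?a i)"
      using d xy by (intro is_pullback_power_ex[OF pow']) (auto simp: comp_arr simp flip: assoc)
    then obtain h where h: "h \<in> Arr C" "Dom C h = Dom C (b \<odot> x)" "Cod C h = Q" "c \<odot> h = b \<odot> x" "\<forall>i<Suc n. \<rho> i \<odot> h = ?a i"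
      by blast
    have "r \<odot> h = x"
    proof (rule is_pullback_power_joint_mono[OF pow])
      show "b \<odot> r \<odot> h = b \<odot> x"
        using h r d e by (simp flip: assoc)
      fix i assume "i < n"
      then show "\<pi> i \<odot> r \<odot> h = \<pi> i \<odot> x"
        using h r d e by (simp flip: assoc)
    qed (use h r d e xy in \<open>simp_all add: comp_arr\<close>)
    with h r e xy d show "\<exists>h. h \<in> Arr C \<and> Dom C h = Dom C x \<and> Cod C h = Dom C r \<and> r \<odot> h = x \<and> \<rho> n \<odot> h = y"
      by (intro exI[of _ h]) (simp add: comp_arr)
  next
    fix h k assume h: "h \<in> Arr C" "k \<in> Arr C" "Dom C h = Dom C k" "Cod C h = Dom C r" "Cod C k = Dom C r"
      "r \<odot> h = r \<odot> k" "\<rho> n \<odot> h = \<rho> n \<odot> k"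
    have "c \<odot> h = b \<odot> r \<odot> h" "c \<odot> k = b \<odot> r \<odot> k"
      using h(1-5) r d e by (simp_all flip: assoc)
    moreover have "\<rho> i \<odot> h = \<pi> i \<odot> r \<odot> h" "\<rho> i \<odot> k = \<pi> i \<odot> r \<odot> k" if "i < n" for i
      using that h(1-5) r d e by (simp_all flip: assoc)
    ultimately show "h = k"
      using h r e by - (rule is_pullback_power_joint_mono[OF pow'], auto simp: less_Suc_eq)
  qed (use r d e in simp_all)
  with r show ?thesis
    by blast
qed

lemma is_pullback_power_2_pullback:
  assumes pow: "is_pullback_power C q 2 P b \<pi>"
  shows "is_pullback C (\<pi> 0) (\<pi> 1) q q"
proof -
  note d = is_pullback_powerD[OF pow]
  have all2: "(\<forall>i<2. Q i) \<longleftrightarrow> Q 0 \<and> Q 1" for Q :: "nat \<Rightarrow> bool"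
    by (auto simp: less_Suc_eq numeral_2_eq_2)
  show ?thesis
  proof (rule is_pullbackI)
    fix x y assume xy: "x \<in> Arr C" "y \<in> Arr C" "Dom C y = Dom C x" "Cod C x = Dom C q" "Cod C y = Dom C q" "q \<odot> x = q \<odot> y"
    have "\<exists>h. h \<in> Arr C \<and> Dom C h = Dom C (q \<odot> x) \<and> Cod C h = P \<and> b \<odot> h = q \<odot> x \<and> (\<forall>i<2. \<pi> i \<odot> h = (if i = 0 then x else y))"
      using d xy by (intro is_pullback_power_ex[OF pow]) (auto simp: comp_arr)
    with d xy show "\<exists>h. h \<in> Arr C \<and> Dom C h = Dom C x \<and> Cod C h = Dom C (\<pi> 0) \<and> \<pi> 0 \<odot> h = x \<and> \<pi> 1 \<odot> h = y"
      by (auto simp: all2 comp_arr)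
  next
    fix h k assume h: "h \<in> Arr C" "k \<in> Arr C" "Dom C h = Dom C k" "Cod C h = Dom C (\<pi> 0)" "Cod C k = Dom C (\<pi> 0)"
      "\<pi> 0 \<odot> h = \<pi> 0 \<odot> k" "\<pi> 1 \<odot> h = \<pi> 1 \<odot> k"
    have "b \<odot> h = q \<odot> \<pi> 0 \<odot> h" "b \<odot> k = q \<odot> \<pi> 0 \<odot> k"
      using h(1-5) d by (simp_all flip: assoc)
    moreover have "\<pi> i \<odot> h = \<pi> i \<odot> k" if "i < 2" for i
      using that h by (auto simp: less_Suc_eq numeral_2_eq_2)
    ultimately show "h = k"
      using h d by - (rule is_pullback_power_joint_mono[OF pow], simp_all)
  qed (use d in simp_all)
qed

lemma is_pullback_power_2:
  assumes pb: "is_pullback C p1 p2 q q"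
  shows "is_pullback_power C q 2 (Dom C p1) (q \<odot> p1) (\<lambda>i. if i = 0 then p1 else p2)"
proof -
  note d = is_pullbackD[OF pb]
  show ?thesis
  proof (rule is_pullback_powerI)
    fix z a assume z: "z \<in> Arr C" "Cod C z = Cod C q"
        "\<And>i. i < 2 \<Longrightarrow> a i \<in> Arr C" "\<And>i. i < 2 \<Longrightarrow> Dom C (a i) = Dom C z" "\<And>i. i < 2 \<Longrightarrow> Cod C (a i) = Dom C q"
        "\<And>i::nat. i < 2 \<Longrightarrow> q \<odot> a i = z"
    have lt: "0 < (2::nat)" "1 < (2::nat)" by simp_all
    have "Dom C (a 1) = Dom C (a 0)" "q \<odot> a 0 = q \<odot> a 1"
      by (simp_all only: z(4,6)[OF lt(1)] z(4,6)[OF lt(2)])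
    then obtain h where h: "h \<in> Arr C" "Dom C h = Dom C (a 0)" "Cod C h = Dom C p1" "p1 \<odot> h = a 0" "p2 \<odot> h = a 1"
      using is_pullback_ex1[OF pb z(3)[OF lt(1)] z(3)[OF lt(2)] _ z(5)[OF lt(1)] z(5)[OF lt(2)]] by blast
    have "(q \<odot> p1) \<odot> h = z"
      using h d(1-8) z(6)[OF lt(1)] by (simp add: assoc)
    moreover have "(if i = 0 then p1 else p2) \<odot> h = a i" if "i < 2" for i
    proof (cases "i = 0")
      case False
      with that have "i = 1" by simp
      with h show ?thesis by simp
    qed (use h in simp)
    ultimately show "\<exists>h. h \<in> Arr C \<and> Dom C h = Dom C z \<and> Cod C h = Dom C p1 \<and> (q \<odot> p1) \<odot> h = z \<and>
        (\<forall>i<2. (if i = 0 then p1 else p2) \<odot> h = a i)"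
      using h(1-3) z(4)[OF lt(1)] by metis
  next
    fix h k assume h: "h \<in> Arr C" "k \<in> Arr C" "Dom C h = Dom C k" "Cod C h = Dom C p1" "Cod C k = Dom C p1"
      "\<And>i::nat. i < 2 \<Longrightarrow> (if i = 0 then p1 else p2) \<odot> h = (if i = 0 then p1 else p2) \<odot> k"
    show "h = k"
      by (rule is_pullback_joint_mono[OF pb]) (use h(1-5) h(6)[of 0] h(6)[of 1] in simp_all)
  qed (use d in \<open>auto simp: comp_arr\<close>)
qed

lemma is_pullback_power_iso:
  assumes pow: "is_pullback_power C q n P b \<pi>" and e: "inverse_arrows C e e'" "Cod C e = P"
  shows "is_pullback_power C q n (Dom C e) (b \<odot> e) (\<lambda>i. \<pi> i \<odot> e)"
proof -
  note d = is_pullback_powerD[OF pow] and i = inverse_arrowsD[OF e(1)]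
  show ?thesis
  proof (rule is_pullback_powerI)
    fix z a assume z: "z \<in> Arr C" "Cod C z = Cod C q"
        "\<And>i. i < n \<Longrightarrow> a i \<in> Arr C" "\<And>i. i < n \<Longrightarrow> Dom C (a i) = Dom C z" "\<And>i. i < n \<Longrightarrow> Cod C (a i) = Dom C q"
        "\<And>i. i < n \<Longrightarrow> q \<odot> a i = z"
    obtain k where k: "k \<in> Arr C" "Dom C k = Dom C z" "Cod C k = P" "b \<odot> k = z" "\<forall>i<n. \<pi> i \<odot> k = a i"
      using is_pullback_power_ex[where a = a, OF pow z] by blast
    show "\<exists>h. h \<in> Arr C \<and> Dom C h = Dom C z \<and> Cod C h = Dom C e \<and> (b \<odot> e) \<odot> h = z \<and> (\<forall>i<n. (\<pi> i \<odot> e) \<odot> h = a i)"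
      using k d i e(2) by (intro exI[of _ "e' \<odot> k"]) (simp add: cat_simps inverse_cancel[OF e(1)])
  next
    fix h k assume h: "h \<in> Arr C" "k \<in> Arr C" "Dom C h = Dom C k" "Cod C h = Dom C e" "Cod C k = Dom C e"
      "(b \<odot> e) \<odot> h = (b \<odot> e) \<odot> k" "\<And>i. i < n \<Longrightarrow> (\<pi> i \<odot> e) \<odot> h = (\<pi> i \<odot> e) \<odot> k"
    have "e \<odot> h = e \<odot> k"
      using h d i e(2) by - (rule is_pullback_power_joint_mono[OF pow], simp_all add: cat_simps)
    then show "h = k"
      using inverse_cancel(1)[OF e(1)] h by metis
  qed (use d i e(2) in \<open>simp_all add: comp_arr flip: assoc\<close>)
qed

lemma is_pullback_power_unique:
  assumes pow: "is_pullback_power C q n P b \<pi>" and pow': "is_pullback_power C q n P' b' \<pi>'"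
  shows "\<exists>e e'. inverse_arrows C e e' \<and> Dom C e = P' \<and> Cod C e = P \<and> b \<odot> e = b' \<and> (\<forall>i<n. \<pi> i \<odot> e = \<pi>' i)"
proof -
  note d = is_pullback_powerD[OF pow] and d' = is_pullback_powerD[OF pow']
  obtain e where e: "e \<in> Arr C" "Dom C e = P'" "Cod C e = P" "b \<odot> e = b'" "\<forall>i<n. \<pi> i \<odot> e = \<pi>' i"
    using is_pullback_power_ex[OF pow, of b' \<pi>'] d' by auto
  obtain e' where e': "e' \<in> Arr C" "Dom C e' = P" "Cod C e' = P'" "b' \<odot> e' = b" "\<forall>i<n. \<pi>' i \<odot> e' = \<pi> i"
    using is_pullback_power_ex[OF pow', of b \<pi>] d by auto
  have "e \<odot> e' = Id C P"
    using e e' d d' by - (rule is_pullback_power_joint_mono[OF pow], simp_all add: comp_arr id_arr id_right flip: assoc)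
  moreover have "e' \<odot> e = Id C P'"
    using e e' d d' by - (rule is_pullback_power_joint_mono[OF pow'], simp_all add: comp_arr id_arr id_right flip: assoc)
  ultimately have "inverse_arrows C e e'"
    using e e' by (simp add: inverse_arrows_def Hom_def)
  with e show ?thesis
    by blast
qed

text \<open>The zeroth power of \<open>q\<close> is an object isomorphic to the base.  Expressing this by a pullback of
  identities lets it be transported by functors that preserve pullbacks over the base.\<close>

lemma is_pullback_power_0_pullback:
  assumes pow: "is_pullback_power C q 0 P b \<pi>"
  shows "is_pullback C b b (Id C (Cod C q)) (Id C (Cod C q))"
proof -
  note d = is_pullback_powerD[OF pow]
  show ?thesis
  proof (rule is_pullbackI)
    fix x y assume xy: "x \<in> Arr C" "y \<in> Arr C" "Dom C y = Dom C x" "Cod C x = Dom C (Id C (Cod C q))" "Cod C y = Dom C (Id C (Cod C q))"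
      "Id C (Cod C q) \<odot> x = Id C (Cod C q) \<odot> y"
    then have "x = y" "Cod C x = Cod C q"
      using d by (simp_all add: cat_simps)
    with xy is_pullback_power_ex[OF pow, of x] d show "\<exists>h. h \<in> Arr C \<and> Dom C h = Dom C x \<and> Cod C h = Dom C b \<and> b \<odot> h = x \<and> b \<odot> h = y"
      by auto
  qed (use d is_pullback_power_joint_mono[OF pow] in \<open>simp_all add: cat_simps\<close>)
qed

lemma is_pullback_power_0:
  assumes pb: "is_pullback C b b (Id C (Cod C q)) (Id C (Cod C q))" and q: "q \<in> Arr C"
  shows "is_pullback_power C q 0 (Dom C b) b \<pi>"
proof -
  note d = is_pullbackD[OF pb]
  show ?thesis
  proof (rule is_pullback_powerI)
    fix z assume z: "z \<in> Arr C" "Cod C z = Cod C q"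
    with is_pullback_ex1[OF pb, of z z] q show "\<exists>h. h \<in> Arr C \<and> Dom C h = Dom C z \<and> Cod C h = Dom C b \<and> b \<odot> h = z \<and> (\<forall>i<0. \<pi> i \<odot> h = a i)" for a
      by (auto simp: cat_simps)
  qed (use d q is_pullback_joint_mono[OF pb] in \<open>simp_all add: cat_simps\<close>)
qed

end

section \<open>Functors preserving pullbacks over an object\<close>

locale cat_functor = C: category C + D: category D
  for C :: "('o, 'm, 'y) cat_scheme" and D :: "('p, 'n, 'z) cat_scheme" +
  fixes G :: "('o, 'm, 'p, 'n) ftor"
  assumes is_ftor: "is_functor C D G"
begin

lemma map_obj: "X \<in> Obj C \<Longrightarrow> FO G X \<in> Obj D"
  using is_ftor by (simp add: is_functor_def)

lemma map_arr:
  assumes "f \<in> Arr C"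
  shows "FA G f \<in> Arr D" "Dom D (FA G f) = FO G (Dom C f)" "Cod D (FA G f) = FO G (Cod C f)"
  using is_ftor assms by (auto simp: is_functor_def Hom_def)

lemma map_id: "X \<in> Obj C \<Longrightarrow> FA G (Id C X) = Id D (FO G X)"
  using is_ftor by (simp add: is_functor_def)

lemma map_comp: "\<lbrakk>f \<in> Arr C; g \<in> Arr C; Dom C g = Cod C f\<rbrakk> \<Longrightarrow> FA G (g \<odot>\<^bsub>C\<^esub> f) = FA G g \<odot>\<^bsub>D\<^esub> FA G f"
  using is_ftor by (simp add: is_functor_def)

lemma map_inverse:
  assumes "inverse_arrows C f g"
  shows "inverse_arrows D (FA G f) (FA G g)"
  using C.inverse_arrowsD[OF assms]
  by (simp add: inverse_arrows_def Hom_def map_arr map_id C.dom_obj C.cod_obj flip: map_comp)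

lemma map_pairing:
  assumes pb: "is_pullback C p q f g" and pb': "is_pullback D (FA G p) (FA G q) (FA G f) (FA G g)"
    and ab: "a \<in> Arr C" "b \<in> Arr C" "Dom C b = Dom C a" "Cod C a = Dom C f" "Cod C b = Dom C g" "f \<odot>\<^bsub>C\<^esub> a = g \<odot>\<^bsub>C\<^esub> b"
  shows "pairing D (FA G p) (FA G q) (FA G a) (FA G b) = FA G (pairing C p q a b)"
  using C.pairing[OF pb ab] C.is_pullbackD[OF pb] ab(1,2)
  by - (rule D.pairing_eqI[OF pb'], simp_all add: map_arr flip: map_comp)

text \<open>By induction, writing the next power as a pullback of the previous one along \<open>q\<close>; the existence
  of all powers provides the previous one.\<close>

lemma map_pullback_power:
  assumes pres: "preserves_pullbacks_over C D G (Cod C q)"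
    and all: "\<And>n. \<exists>P b \<pi>. is_pullback_power C q n P b \<pi>"
    and pow: "is_pullback_power C q n P b \<pi>"
  shows "is_pullback_power D (FA G q) n (FO G P) (FA G b) (\<lambda>i. FA G (\<pi> i))"
  using pow
proof (induction n arbitrary: P b \<pi>)
  case 0
  note d = C.is_pullback_powerD[OF 0]
  have pb: "is_pullback C b b (Id C (Cod C q)) (Id C (Cod C q))"
    by (rule C.is_pullback_power_0_pullback[OF 0])
  have "is_pullback D (FA G b) (FA G b) (FA G (Id C (Cod C q))) (FA G (Id C (Cod C q)))"
    using pres pb C.id_arr[OF C.cod_obj[OF d(1)]] unfolding preserves_pullbacks_over_def by blast
  then have "is_pullback_power D (FA G q) 0 (Dom D (FA G b)) (FA G b) (\<lambda>i. FA G (\<pi> i))"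
    using d by (intro D.is_pullback_power_0) (simp_all add: map_id map_arr C.cod_obj)
  then show ?case
    using d by (simp add: map_arr)
next
  case (Suc n)
  obtain P' b' \<pi>' where pow': "is_pullback_power C q n P' b' \<pi>'"
    using all by blast
  note d = C.is_pullback_powerD[OF Suc.prems] and d' = C.is_pullback_powerD[OF pow']
  obtain r where r: "is_pullback C r (\<pi> n) b' q" "b' \<odot>\<^bsub>C\<^esub> r = b" "\<forall>i<n. \<pi>' i \<odot>\<^bsub>C\<^esub> r = \<pi> i"
    using C.is_pullback_power_Suc_pullback[OF pow' Suc.prems] by blast
  note e = C.is_pullbackD[OF r(1)]
  have "is_pullback D (FA G r) (FA G (\<pi> n)) (FA G b') (FA G q)"
    using pres r(1) d'(5) unfolding preserves_pullbacks_over_def by blast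
  from D.is_pullback_power_Suc[OF Suc.IH[OF pow'] this]
  have "is_pullback_power D (FA G q) (Suc n) (FO G (Dom C r)) (FA G b' \<odot>\<^bsub>D\<^esub> FA G r)
      (\<lambda>i. if i < n then FA G (\<pi>' i) \<odot>\<^bsub>D\<^esub> FA G r else FA G (\<pi> n))"
    using e by (simp add: map_arr)
  moreover have "FO G (Dom C r) = FO G P" "FA G b' \<odot>\<^bsub>D\<^esub> FA G r = FA G b"
    using e d d' r(2) by (auto simp flip: map_comp)
  moreover have "(if i < n then FA G (\<pi>' i) \<odot>\<^bsub>D\<^esub> FA G r else FA G (\<pi> n)) = FA G (\<pi> i)" if "i < Suc n" for i
  proof (cases "i < n")
    case True
    with d'(6,7)[of i] e(1,6) d'(4) r(3) show ?thesis
      by (simp flip: map_comp)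
  next
    case False
    with that have "i = n" by simp
    then show ?thesis by simp
  qed
  ultimately show ?case
    using D.is_pullback_power_cong by fastforce
qed

text \<open>All laws but associativity concern pairings into the chosen pullback, which \<open>G\<close> preserves.
  Associativity is stated for an arbitrary third power of \<open>G(q)\<close>; there is a comparison
  arrow from it to the image of a third power of \<open>q\<close>, along which the law is pulled back.\<close>

lemma map_additive_bundle:
  assumes pres: "preserves_pullbacks_over C D G (Base B)" and B: "additive_bundle C B"
  shows "additive_bundle D (map_bundle G B)"
proof -
  define q p1 p2 s z where "q = Proj B" and "p1 = Fst B" and "p2 = Snd B" and "s = Plus B" and "z = Zero B"
  note defs = this
  have q: "q \<in> Arr C" "Dom C q = Tot B" "Cod C q = Base B"
    and p1: "p1 \<in> Arr C" "Dom C p1 = Pow2 B" "Cod C p1 = Tot B"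
    and p2: "p2 \<in> Arr C" "Dom C p2 = Pow2 B" "Cod C p2 = Tot B"
    and s: "s \<in> Arr C" "Dom C s = Pow2 B" "Cod C s = Tot B"
    and z: "z \<in> Arr C" "Dom C z = Base B" "Cod C z = Tot B"
    and all: "\<And>n. \<exists>P b \<pi>. is_pullback_power C q n P b \<pi>"
    and pb: "is_pullback C p1 p2 q q"
    and qs: "q \<odot>\<^bsub>C\<^esub> s = q \<odot>\<^bsub>C\<^esub> p1" "q \<odot>\<^bsub>C\<^esub> s = q \<odot>\<^bsub>C\<^esub> p2" and qz: "q \<odot>\<^bsub>C\<^esub> z = Id C (Base B)"
    and ass: "\<And>P b \<pi>. is_pullback_power C q 3 P b \<pi> \<Longrightarrow>
      s \<odot>\<^bsub>C\<^esub> pairing C p1 p2 (s \<odot>\<^bsub>C\<^esub> pairing C p1 p2 (\<pi> 0) (\<pi> 1)) (\<pi> 2) =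
      s \<odot>\<^bsub>C\<^esub> pairing C p1 p2 (\<pi> 0) (s \<odot>\<^bsub>C\<^esub> pairing C p1 p2 (\<pi> 1) (\<pi> 2))"
    and comm: "s \<odot>\<^bsub>C\<^esub> pairing C p1 p2 p2 p1 = s"
    and unitl: "s \<odot>\<^bsub>C\<^esub> pairing C p1 p2 (z \<odot>\<^bsub>C\<^esub> q) (Id C (Tot B)) = Id C (Tot B)"
    and unitr: "s \<odot>\<^bsub>C\<^esub> pairing C p1 p2 (Id C (Tot B)) (z \<odot>\<^bsub>C\<^esub> q) = Id C (Tot B)"
    using B unfolding additive_bundle_def defs Hom_def by blast+
  have obj: "Tot B \<in> Obj C" "Base B \<in> Obj C"
    using C.dom_obj[OF q(1)] C.cod_obj[OF q(1)] q by simp_all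
  have pbD: "is_pullback D (FA G p1) (FA G p2) (FA G q) (FA G q)"
    using pres pb q(3) unfolding preserves_pullbacks_over_def by blast
  have GB: "Tot (map_bundle G B) = FO G (Tot B)" "Base (map_bundle G B) = FO G (Base B)"
    "Proj (map_bundle G B) = FA G q" "Pow2 (map_bundle G B) = FO G (Pow2 B)"
    "Fst (map_bundle G B) = FA G p1" "Snd (map_bundle G B) = FA G p2"
    "Plus (map_bundle G B) = FA G s" "Zero (map_bundle G B) = FA G z"
    by (simp_all add: map_bundle_def defs)
  note pair = map_pairing[OF pb pbD]
  have powD: "is_pullback_power D (FA G q) n (FO G P) (FA G b) (\<lambda>i. FA G (\<pi> i))"
    if "is_pullback_power C q n P b \<pi>" for n P b \<pi>
    using map_pullback_power[OF _ all that] pres q(3) by simp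
  have "FA G s \<odot>\<^bsub>D\<^esub> pairing D (FA G p1) (FA G p2) (FA G p2) (FA G p1) = FA G s"
    using q p1 p2 s C.pairing[OF pb, of p2 p1] qs comm
    by (subst pair) (simp_all flip: map_comp)
  moreover have "FA G s \<odot>\<^bsub>D\<^esub> pairing D (FA G p1) (FA G p2) (FA G z \<odot>\<^bsub>D\<^esub> FA G q) (Id D (FO G (Tot B))) = Id D (FO G (Tot B))"
  proof -
    have ab: "z \<odot>\<^bsub>C\<^esub> q \<in> Arr C" "Id C (Tot B) \<in> Arr C" "Dom C (Id C (Tot B)) = Dom C (z \<odot>\<^bsub>C\<^esub> q)"
      "Cod C (z \<odot>\<^bsub>C\<^esub> q) = Dom C q" "Cod C (Id C (Tot B)) = Dom C q" "q \<odot>\<^bsub>C\<^esub> z \<odot>\<^bsub>C\<^esub> q = q \<odot>\<^bsub>C\<^esub> Id C (Tot B)"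
      using q z qz obj by (simp_all add: C.comp_arr C.id_arr C.id_left C.id_right flip: C.assoc)
    show ?thesis
      using pair[OF ab] C.pairing[OF pb ab] s p1 unitl q z obj
      by (simp add: map_id flip: map_comp)
  qed
  moreover have "FA G s \<odot>\<^bsub>D\<^esub> pairing D (FA G p1) (FA G p2) (Id D (FO G (Tot B))) (FA G z \<odot>\<^bsub>D\<^esub> FA G q) = Id D (FO G (Tot B))"
  proof -
    have ab: "Id C (Tot B) \<in> Arr C" "z \<odot>\<^bsub>C\<^esub> q \<in> Arr C" "Dom C (z \<odot>\<^bsub>C\<^esub> q) = Dom C (Id C (Tot B))"
      "Cod C (Id C (Tot B)) = Dom C q" "Cod C (z \<odot>\<^bsub>C\<^esub> q) = Dom C q" "q \<odot>\<^bsub>C\<^esub> Id C (Tot B) = q \<odot>\<^bsub>C\<^esub> z \<odot>\<^bsub>C\<^esub> q"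
      using q z qz obj by (simp_all add: C.comp_arr C.id_arr C.id_left C.id_right flip: C.assoc)
    show ?thesis
      using pair[OF ab] C.pairing[OF pb ab] s p1 unitr q z obj
      by (simp add: map_id flip: map_comp)
  qed
  moreover have "FA G s \<odot>\<^bsub>D\<^esub> pairing D (FA G p1) (FA G p2) (FA G s \<odot>\<^bsub>D\<^esub> pairing D (FA G p1) (FA G p2) (\<pi> 0) (\<pi> 1)) (\<pi> 2) =
      FA G s \<odot>\<^bsub>D\<^esub> pairing D (FA G p1) (FA G p2) (\<pi> 0) (FA G s \<odot>\<^bsub>D\<^esub> pairing D (FA G p1) (FA G p2) (\<pi> 1) (\<pi> 2))"
    if pow: "is_pullback_power D (FA G q) 3 P b \<pi>" for P b \<pi>
  proof -
    obtain Q c \<rho> where \<rho>: "is_pullback_power C q 3 Q c \<rho>"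
      using all by blast
    obtain e where e: "e \<in> Arr D" "Cod D e = FO G Q" "\<forall>i<3. FA G (\<rho> i) \<odot>\<^bsub>D\<^esub> e = \<pi> i"
      using D.is_pullback_power_unique[OF powD[OF \<rho>] pow] D.inverse_arrowsD(1) by blast
    have \<pi>: "\<pi> 0 = FA G (\<rho> 0) \<odot>\<^bsub>D\<^esub> e" "\<pi> 1 = FA G (\<rho> 1) \<odot>\<^bsub>D\<^esub> e" "\<pi> 2 = FA G (\<rho> 2) \<odot>\<^bsub>D\<^esub> e"
      using e(3) by simp_all
    note d = C.is_pullback_powerD[OF \<rho>]
    \<comment> \<open>Both the pairing and the composite with the addition commute with \<open>G\<close> and with \<open>e\<close>.\<close>
    have add: "FA G s \<odot>\<^bsub>D\<^esub> pairing D (FA G p1) (FA G p2) (FA G x \<odot>\<^bsub>D\<^esub> e) (FA G y \<odot>\<^bsub>D\<^esub> e) =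
        FA G (s \<odot>\<^bsub>C\<^esub> pairing C p1 p2 x y) \<odot>\<^bsub>D\<^esub> e \<and>
        s \<odot>\<^bsub>C\<^esub> pairing C p1 p2 x y \<in> Arr C \<and> Dom C (s \<odot>\<^bsub>C\<^esub> pairing C p1 p2 x y) = Q \<and>
        Cod C (s \<odot>\<^bsub>C\<^esub> pairing C p1 p2 x y) = Tot B \<and> q \<odot>\<^bsub>C\<^esub> s \<odot>\<^bsub>C\<^esub> pairing C p1 p2 x y = c"
      if "x \<in> Arr C \<and> Dom C x = Q \<and> Cod C x = Tot B \<and> q \<odot>\<^bsub>C\<^esub> x = c" "y \<in> Arr C \<and> Dom C y = Q \<and> Cod C y = Tot B \<and> q \<odot>\<^bsub>C\<^esub> y = c" for x y
    proof -
      have xy: "x \<in> Arr C" "y \<in> Arr C" "Dom C y = Dom C x" "Cod C x = Dom C q" "Cod C y = Dom C q" "q \<odot>\<^bsub>C\<^esub> x = q \<odot>\<^bsub>C\<^esub> y"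
        using that q by simp_all
      note pr = C.pairing[OF pb xy]
      have xyD: "FA G x \<in> Arr D" "FA G y \<in> Arr D" "Dom D (FA G y) = Dom D (FA G x)" "Cod D (FA G x) = Dom D (FA G q)"
        "Cod D (FA G y) = Dom D (FA G q)" "FA G q \<odot>\<^bsub>D\<^esub> FA G x = FA G q \<odot>\<^bsub>D\<^esub> FA G y"
        using xy q by (simp_all add: map_arr flip: map_comp)
      have "pairing D (FA G p1) (FA G p2) (FA G x \<odot>\<^bsub>D\<^esub> e) (FA G y \<odot>\<^bsub>D\<^esub> e) = FA G (pairing C p1 p2 x y) \<odot>\<^bsub>D\<^esub> e"
        using D.pairing_comp[OF pbD xyD e(1)] pair[OF xy] e(2) that by (simp add: map_arr)
      moreover have "q \<odot>\<^bsub>C\<^esub> s \<odot>\<^bsub>C\<^esub> pairing C p1 p2 x y = (q \<odot>\<^bsub>C\<^esub> p1) \<odot>\<^bsub>C\<^esub> pairing C p1 p2 x y"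
        using pr q s p1 by (simp flip: qs(1) C.assoc)
      then have "q \<odot>\<^bsub>C\<^esub> s \<odot>\<^bsub>C\<^esub> pairing C p1 p2 x y = c"
        using pr q p1 that by (simp add: C.assoc)
      ultimately show ?thesis
        using pr s p1 e that by (simp add: C.comp_arr map_comp map_arr D.assoc)
    qed
    have ok: "\<rho> i \<in> Arr C \<and> Dom C (\<rho> i) = Q \<and> Cod C (\<rho> i) = Tot B \<and> q \<odot>\<^bsub>C\<^esub> \<rho> i = c" if "i < 3" for i
      using d that q by simp
    have ok: "\<rho> 0 \<in> Arr C \<and> Dom C (\<rho> 0) = Q \<and> Cod C (\<rho> 0) = Tot B \<and> q \<odot>\<^bsub>C\<^esub> \<rho> 0 = c"
      "\<rho> 1 \<in> Arr C \<and> Dom C (\<rho> 1) = Q \<and> Cod C (\<rho> 1) = Tot B \<and> q \<odot>\<^bsub>C\<^esub> \<rho> 1 = c"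
      "\<rho> 2 \<in> Arr C \<and> Dom C (\<rho> 2) = Q \<and> Cod C (\<rho> 2) = Tot B \<and> q \<odot>\<^bsub>C\<^esub> \<rho> 2 = c"
      using ok[of 0] ok[of 1] ok[of 2] by simp_all
    note a01 = add[OF ok(1,2)] and a12 = add[OF ok(2,3)]
    note l = add[OF conjunct2[OF a01] ok(3)] and r = add[OF ok(1) conjunct2[OF a12]]
    show ?thesis
      unfolding \<pi> conjunct1[OF a01] conjunct1[OF a12] conjunct1[OF l] conjunct1[OF r] ass[OF \<rho>] ..
  qed
  moreover have "\<exists>P b \<pi>. is_pullback_power D (FA G q) n P b \<pi>" for n
    using all[of n] powD by blast
  ultimately show ?thesis
    unfolding additive_bundle_def GB
    using pbD q p1 p2 s z qs qz obj
    by (auto simp: Hom_def map_arr map_id simp flip: map_comp) 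
qed

end

lemma comp_is_functor:
  assumes "is_functor C D F" "is_functor D E G"
  shows "is_functor C E (G \<circ>\<^sub>F F)"
  using assms unfolding is_functor_def comp_ftor_def Hom_def by simp

text \<open>Cones over the image under \<open>G\<close> correspond to cones over the image under \<open>H\<close>.\<close>

lemma preserves_pullbacks_over_iso:
  assumes "category C" "category D"
    and iso: "natural_isomorphism C D G H \<phi>" and pres: "preserves_pullbacks_over C D H S"
  shows "preserves_pullbacks_over C D G S"
  unfolding preserves_pullbacks_over_def
proof (intro allI impI)
  interpret C: category C by fact
  interpret D: category D by fact
  have nat: "natural_transformation C D G H \<phi>" and inv: "\<And>X. X \<in> Obj C \<Longrightarrow> \<exists>g. inverse_arrows D (\<phi> X) g"
    using iso by (auto simp: natural_isomorphism_def)
  interpret G: cat_functor C D G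
    using nat by unfold_locales (simp add: natural_transformation_def)
  interpret H: cat_functor C D H
    using nat by unfold_locales (simp add: natural_transformation_def)
  have \<phi>: "\<phi> X \<in> Arr D" "Dom D (\<phi> X) = FO G X" "Cod D (\<phi> X) = FO H X" if "X \<in> Obj C" for X
    using nat that by (auto simp: natural_transformation_def Hom_def)
  have nt: "\<phi> (Cod C f) \<odot>\<^bsub>D\<^esub> FA G f = FA H f \<odot>\<^bsub>D\<^esub> \<phi> (Dom C f)" if "f \<in> Arr C" for f
    using nat that by (simp add: natural_transformation_def)
  have nt': "\<phi> (Cod C f) \<odot>\<^bsub>D\<^esub> FA G f \<odot>\<^bsub>D\<^esub> x = FA H f \<odot>\<^bsub>D\<^esub> \<phi> (Dom C f) \<odot>\<^bsub>D\<^esub> x"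
    if "f \<in> Arr C" "x \<in> Arr D" "Cod D x = FO G (Dom C f)" for f x
    using D.assoc[of x "FA G f" "\<phi> (Cod C f)"] D.assoc[of x "\<phi> (Dom C f)" "FA H f"] nt[of f] that
    by (simp add: G.map_arr H.map_arr \<phi> C.dom_obj C.cod_obj)
  have mono: "x = y" if "\<phi> X \<odot>\<^bsub>D\<^esub> x = \<phi> X \<odot>\<^bsub>D\<^esub> y" "X \<in> Obj C" "x \<in> Arr D" "y \<in> Arr D" "Cod D x = FO G X" "Cod D y = FO G X" for x y X
    using inv[OF that(2)] D.inverse_cancel(1) \<phi>[OF that(2)] that by metis
  fix p q f g assume "is_pullback C p q f g \<and> Cod C f = S"
  then have pb: "is_pullback C p q f g" and pbH: "is_pullback D (FA H p) (FA H q) (FA H f) (FA H g)"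
    using pres by (auto simp: preserves_pullbacks_over_def)
  note d = C.is_pullbackD[OF pb]
  have o: "Dom C f \<in> Obj C" "Dom C g \<in> Obj C" "Dom C p \<in> Obj C" "Cod C f \<in> Obj C"
    using d C.dom_obj C.cod_obj by auto
  show "is_pullback D (FA G p) (FA G q) (FA G f) (FA G g)"
  proof (rule D.is_pullbackI)
    show "FA G f \<odot>\<^bsub>D\<^esub> FA G p = FA G g \<odot>\<^bsub>D\<^esub> FA G q"
      using d by (simp flip: G.map_comp)
  next
    fix a b assume ab: "a \<in> Arr D" "b \<in> Arr D" "Dom D b = Dom D a" "Cod D a = Dom D (FA G f)" "Cod D b = Dom D (FA G g)"
      "FA G f \<odot>\<^bsub>D\<^esub> a = FA G g \<odot>\<^bsub>D\<^esub> b"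
    then have ab': "Cod D a = FO G (Dom C f)" "Cod D b = FO G (Dom C g)"
      using d by (simp_all add: G.map_arr)
    let ?a = "\<phi> (Dom C f) \<odot>\<^bsub>D\<^esub> a" and ?b = "\<phi> (Dom C g) \<odot>\<^bsub>D\<^esub> b"
    have "FA H f \<odot>\<^bsub>D\<^esub> ?a = FA H g \<odot>\<^bsub>D\<^esub> ?b"
      using nt'[of f a] nt'[of g b] ab ab' d by simp
    then obtain k where k: "k \<in> Arr D" "Dom D k = Dom D ?a" "Cod D k = Dom D (FA H p)" "FA H p \<odot>\<^bsub>D\<^esub> k = ?a" "FA H q \<odot>\<^bsub>D\<^esub> k = ?b"
      using D.is_pullback_ex1[OF pbH, of ?a ?b] ab ab' d o by (auto simp: D.comp_arr \<phi> H.map_arr)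
    obtain i where i: "inverse_arrows D (\<phi> (Dom C p)) i"
      using inv o by blast
    note id = D.inverse_arrowsD[OF i]
    let ?h = "i \<odot>\<^bsub>D\<^esub> k"
    have h: "?h \<in> Arr D" "Dom D ?h = Dom D a" "Cod D ?h = FO G (Dom C p)"
      using k id o d ab ab' by (simp_all add: D.comp_arr \<phi> H.map_arr)
    have \<phi>h: "\<phi> (Dom C p) \<odot>\<^bsub>D\<^esub> ?h = k"
      using k d o by (intro D.inverse_cancel(2)[OF i]) (simp_all add: \<phi> H.map_arr)
    have "FA G p \<odot>\<^bsub>D\<^esub> ?h = a"
      by (rule mono[of "Dom C f"]) (use nt'[of p ?h] d o h \<phi>h k ab ab' in \<open>simp_all add: D.comp_arr G.map_arr\<close>)
    moreover have "FA G q \<odot>\<^bsub>D\<^esub> ?h = b"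
      by (rule mono[of "Dom C g"]) (use nt'[of q ?h] d o h \<phi>h k ab ab' in \<open>simp_all add: D.comp_arr G.map_arr\<close>)
    ultimately show "\<exists>h. h \<in> Arr D \<and> Dom D h = Dom D a \<and> Cod D h = Dom D (FA G p) \<and> FA G p \<odot>\<^bsub>D\<^esub> h = a \<and> FA G q \<odot>\<^bsub>D\<^esub> h = b"
      using h d by (intro exI[of _ ?h]) (simp add: G.map_arr)
  next
    fix h k assume h: "h \<in> Arr D" "k \<in> Arr D" "Dom D h = Dom D k" "Cod D h = Dom D (FA G p)" "Cod D k = Dom D (FA G p)"
      "FA G p \<odot>\<^bsub>D\<^esub> h = FA G p \<odot>\<^bsub>D\<^esub> k" "FA G q \<odot>\<^bsub>D\<^esub> h = FA G q \<odot>\<^bsub>D\<^esub> k"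
    then have h': "Cod D h = FO G (Dom C p)" "Cod D k = FO G (Dom C p)"
      using d by (simp_all add: G.map_arr)
    have "\<phi> (Dom C p) \<odot>\<^bsub>D\<^esub> h = \<phi> (Dom C p) \<odot>\<^bsub>D\<^esub> k"
    proof (rule D.is_pullback_joint_mono[OF pbH])
      show "FA H p \<odot>\<^bsub>D\<^esub> \<phi> (Dom C p) \<odot>\<^bsub>D\<^esub> h = FA H p \<odot>\<^bsub>D\<^esub> \<phi> (Dom C p) \<odot>\<^bsub>D\<^esub> k"
        using nt'[of p h] nt'[of p k] h h' d by simp
      show "FA H q \<odot>\<^bsub>D\<^esub> \<phi> (Dom C p) \<odot>\<^bsub>D\<^esub> h = FA H q \<odot>\<^bsub>D\<^esub> \<phi> (Dom C p) \<odot>\<^bsub>D\<^esub> k"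
        using nt'[of q h] nt'[of q k] h h' d by simp
    qed (use h h' d o in \<open>simp_all add: D.comp_arr \<phi> H.map_arr\<close>)
    then show "h = k"
      using mono o h h' by blast
  qed (use d in \<open>simp_all add: G.map_arr\<close>)
qed

lemma natural_isomorphism_precomp:
  assumes F: "is_functor C D F" and iso: "natural_isomorphism D E G H \<phi>"
  shows "natural_isomorphism C E (G \<circ>\<^sub>F F) (H \<circ>\<^sub>F F) (\<lambda>X. \<phi> (FO F X))"
proof -
  have nt: "natural_transformation D E G H \<phi>"
    using iso by (simp add: natural_isomorphism_def)
  have obj: "FO F X \<in> Obj D" if "X \<in> Obj C" for X
    using F that by (simp add: is_functor_def)
  have arr: "FA F f \<in> Arr D" "Dom D (FA F f) = FO F (Dom C f)" "Cod D (FA F f) = FO F (Cod C f)" if "f \<in> Arr C" for f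
    using F that by (auto simp: is_functor_def Hom_def)
  have nat: "\<phi> (FO F (Cod C f)) \<odot>\<^bsub>E\<^esub> FA G (FA F f) = FA H (FA F f) \<odot>\<^bsub>E\<^esub> \<phi> (FO F (Dom C f))" if "f \<in> Arr C" for f
    using nt arr[OF that] unfolding natural_transformation_def by metis
  have "natural_transformation C E (G \<circ>\<^sub>F F) (H \<circ>\<^sub>F F) (\<lambda>X. \<phi> (FO F X))"
    using nt comp_is_functor[OF F, of E] obj nat
    unfolding natural_transformation_def by (simp add: comp_ftor_def)
  with iso obj show ?thesis
    by (simp add: natural_isomorphism_def)
qed

section \<open>Actegories and powers of the tangent functor\<close>

context weil_actegory
begin

lemma act_arr:
  assumes "\<theta> \<in> Hom Weil A B" "f \<in> Arr \<X>"
  shows "FA (act \<X>) (\<theta>, f) \<in> Arr \<X>" "Dom \<X> (FA (act \<X>) (\<theta>, f)) = FO (act \<X>) (A, Dom \<X> f)"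
    "Cod \<X> (FA (act \<X>) (\<theta>, f)) = FO (act \<X>) (B, Cod \<X> f)"
proof -
  have "FA (act \<X>) (\<theta>, f) \<in> Hom \<X> (FO (act \<X>) (A, Dom \<X> f)) (FO (act \<X>) (B, Cod \<X> f))"
    using act_functor assms unfolding is_functor_def by (force simp: prod_cat_def Hom_def)
  then show "FA (act \<X>) (\<theta>, f) \<in> Arr \<X>" "Dom \<X> (FA (act \<X>) (\<theta>, f)) = FO (act \<X>) (A, Dom \<X> f)"
    "Cod \<X> (FA (act \<X>) (\<theta>, f)) = FO (act \<X>) (B, Cod \<X> f)"
    by (simp_all add: Hom_def)
qed

lemma act_obj: "\<lbrakk>A \<in> Obj Weil; Y \<in> Obj \<X>\<rbrakk> \<Longrightarrow> FO (act \<X>) (A, Y) \<in> Obj \<X>"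
  using act_functor unfolding is_functor_def by (simp add: prod_cat_def)

lemma act_id: "\<lbrakk>A \<in> Obj Weil; Y \<in> Obj \<X>\<rbrakk> \<Longrightarrow> FA (act \<X>) (Id Weil A, Id \<X> Y) = Id \<X> (FO (act \<X>) (A, Y))"
  using act_functor unfolding is_functor_def by (force simp: prod_cat_def)

lemma act_comp:
  assumes "\<theta> \<in> Hom Weil A B" "\<theta>' \<in> Hom Weil B D" "f \<in> Arr \<X>" "g \<in> Arr \<X>" "Dom \<X> g = Cod \<X> f"
  shows "FA (act \<X>) (\<theta>', g) \<odot> FA (act \<X>) (\<theta>, f) = FA (act \<X>) (\<theta>' \<odot>\<^bsub>Weil\<^esub> \<theta>, g \<odot> f)"
proof -
  have "\<forall>x\<in>Arr (prod_cat Weil \<X>). \<forall>y\<in>Arr (prod_cat Weil \<X>). Dom (prod_cat Weil \<X>) y = Cod (prod_cat Weil \<X>) x \<longrightarrow>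
      FA (act \<X>) (y \<odot>\<^bsub>prod_cat Weil \<X>\<^esub> x) = FA (act \<X>) y \<odot> FA (act \<X>) x"
    using act_functor unfolding is_functor_def by blast
  from this[rule_format, of "(\<theta>, f)" "(\<theta>', g)"] show ?thesis
    using assms by (simp add: prod_cat_def Hom_def)
qed

lemma T_fun_functor:
  assumes A: "A \<in> Obj Weil"
  shows "cat_functor \<X> \<X> (T_fun \<X> A)"
proof unfold_locales
  note i = weil_id_hom[OF A]
  show "is_functor \<X> \<X> (T_fun \<X> A)"
    unfolding is_functor_def T_fun_def Hom_def
    using act_arr[OF i] act_obj[OF A] act_id[OF A] act_comp[OF i i] by (simp add: weil_comp_id_left[OF i])
qed

lemma T_fun_simps: "FO (T_fun \<X> A) Y = FO (act \<X>) (A, Y)" "FA (T_fun \<X> A) f = FA (act \<X>) (Id Weil A, f)"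
  by (simp_all add: T_fun_def)

lemma T_nat_arr:
  assumes "\<theta> \<in> Hom Weil A B" "Y \<in> Obj \<X>"
  shows "T_nat \<X> \<theta> Y \<in> Arr \<X>" "Dom \<X> (T_nat \<X> \<theta> Y) = FO (T_fun \<X> A) Y" "Cod \<X> (T_nat \<X> \<theta> Y) = FO (T_fun \<X> B) Y"
  using act_arr[OF assms(1), of "Id \<X> Y"] assms(2) by (simp_all add: T_nat_def T_fun_def id_arr)

lemma T_nat_natural:
  assumes \<theta>: "\<theta> \<in> Hom Weil A B" and f: "f \<in> Arr \<X>"
  shows "T_nat \<X> \<theta> (Cod \<X> f) \<odot> FA (T_fun \<X> A) f = FA (T_fun \<X> B) f \<odot> T_nat \<X> \<theta> (Dom \<X> f)"
proof -
  have o: "A \<in> Obj Weil" "B \<in> Obj Weil" "Dom \<X> f \<in> Obj \<X>" "Cod \<X> f \<in> Obj \<X>"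
    using \<theta> f dom_obj cod_obj by (auto simp: weil_hom_iff)
  show ?thesis
    unfolding T_nat_def T_fun_simps
    using f o by (simp add: act_comp[OF weil_id_hom \<theta>] act_comp[OF \<theta> weil_id_hom] id_arr
        weil_comp_id_left[OF \<theta>] weil_comp_id_right[OF \<theta>] id_left id_right)
qed

lemma unit:
  assumes "Y \<in> Obj \<X>"
  shows "unit_iso \<X> Y \<in> Arr \<X>" "Dom \<X> (unit_iso \<X> Y) = Y" "Cod \<X> (unit_iso \<X> Y) = FO (T_fun \<X> \<N>) Y"
    "inverse_arrows \<X> (unit_iso \<X> Y) (inv_arr \<X> (unit_iso \<X> Y))"
  using unit_iso assms inv_arr unfolding natural_isomorphism_def natural_transformation_def
  by (auto simp: Hom_def id_ftor_def)

lemma unit_natural: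
  "f \<in> Arr \<X> \<Longrightarrow> unit_iso \<X> (Cod \<X> f) \<odot> f = FA (T_fun \<X> \<N>) f \<odot> unit_iso \<X> (Dom \<X> f)"
  using unit_iso unfolding natural_isomorphism_def natural_transformation_def by (auto simp: id_ftor_def)

lemma mult:
  assumes "A \<in> Obj Weil" "B \<in> Obj Weil" "Y \<in> Obj \<X>"
  shows "mult_iso \<X> (A, B, Y) \<in> Arr \<X>" "Dom \<X> (mult_iso \<X> (A, B, Y)) = FO (T_fun \<X> A) (FO (T_fun \<X> B) Y)"
    "Cod \<X> (mult_iso \<X> (A, B, Y)) = FO (T_fun \<X> (A \<otimes>\<^sub>W B)) Y"
    "inverse_arrows \<X> (mult_iso \<X> (A, B, Y)) (inv_arr \<X> (mult_iso \<X> (A, B, Y)))"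
proof -
  have "(A, B, Y) \<in> Obj (prod_cat Weil (prod_cat Weil \<X>))"
    using assms by (simp add: prod_cat_def)
  then have "mult_iso \<X> (A, B, Y) \<in> Hom \<X> (FO (T_fun \<X> A) (FO (T_fun \<X> B) Y)) (FO (T_fun \<X> (A \<otimes>\<^sub>W B)) Y)"
    and "\<exists>g. inverse_arrows \<X> (mult_iso \<X> (A, B, Y)) g"
    using mult_iso unfolding natural_isomorphism_def natural_transformation_def
    by (force simp: comp_ftor_def prod_ftor_def id_ftor_def T_fun_def)+
  then show "mult_iso \<X> (A, B, Y) \<in> Arr \<X>" "Dom \<X> (mult_iso \<X> (A, B, Y)) = FO (T_fun \<X> A) (FO (T_fun \<X> B) Y)"
    "Cod \<X> (mult_iso \<X> (A, B, Y)) = FO (T_fun \<X> (A \<otimes>\<^sub>W B)) Y"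
    "inverse_arrows \<X> (mult_iso \<X> (A, B, Y)) (inv_arr \<X> (mult_iso \<X> (A, B, Y)))"
    using inv_arr by (auto simp: Hom_def)
qed

text \<open>Naturality of the multiplication in the object only: the Weil component \<open>Id \<otimes> Id\<close> has to be
  recognised as an identity.\<close>

lemma mult_natural:
  assumes A: "A \<in> Obj Weil" and B: "B \<in> Obj Weil" and f: "f \<in> Arr \<X>"
  shows "mult_iso \<X> (A, B, Cod \<X> f) \<odot> FA (T_fun \<X> A) (FA (T_fun \<X> B) f) =
    FA (T_fun \<X> (A \<otimes>\<^sub>W B)) f \<odot> mult_iso \<X> (A, B, Dom \<X> f)"
proof -
  let ?x = "(Id Weil A, Id Weil B, f)"
  have "?x \<in> Arr (prod_cat Weil (prod_cat Weil \<X>))" 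
    "Dom (prod_cat Weil (prod_cat Weil \<X>)) ?x = (A, B, Dom \<X> f)" "Cod (prod_cat Weil (prod_cat Weil \<X>)) ?x = (A, B, Cod \<X> f)"
    using weil_id_hom[OF A] weil_id_hom[OF B] f by (simp_all add: prod_cat_def Hom_def)
  moreover have "\<forall>x\<in>Arr (prod_cat Weil (prod_cat Weil \<X>)). mult_iso \<X> (Cod (prod_cat Weil (prod_cat Weil \<X>)) x) \<odot>
        FA (act \<X> \<circ>\<^sub>F (id_ftor \<times>\<^sub>F act \<X>)) x =
      FA \<lparr> FO = (\<lambda>(A, B, Y). FO (act \<X>) (A \<otimes>\<^sub>W B, Y)), FA = (\<lambda>(f, g, h). FA (act \<X>) (f \<otimes>\<^sub>A g, h)) \<rparr> x \<odot>
        mult_iso \<X> (Dom (prod_cat Weil (prod_cat Weil \<X>)) x)"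
    using mult_iso unfolding natural_isomorphism_def natural_transformation_def by blast
  ultimately show ?thesis
    by (auto simp: comp_ftor_def prod_ftor_def id_ftor_def T_fun_def weil_tensor_id[OF A B] dest!: bspec[of _ _ ?x])
qed

text \<open>The canonical comparison from \<open>T\<^sup>k\<close> to the action of the \<open>k\<close>-th tensor power of \<open>W\<close>.\<close>

primrec tpow_iso :: "nat \<Rightarrow> 'o \<Rightarrow> 'm"
  where "tpow_iso 0 = unit_iso \<X>"
  | "tpow_iso (Suc k) = (\<lambda>Y. mult_iso \<X> (W, weil_tpow k, Y) \<odot> FA (T_fun \<X> W) (tpow_iso k Y))"

lemma ftor_power_Suc: "ftor_power (Suc k) F = F \<circ>\<^sub>F ftor_power k F"
  by (simp add: ftor_power_def comp_ftor_def)

text \<open>This is what makes statements about all \<open>T\<^sub>A\<close> apply to the powers of the tangent functor.\<close>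

lemma tpow_iso: "natural_isomorphism \<X> \<X> (ftor_power k (tangent \<X>)) (T_fun \<X> (weil_tpow k)) (tpow_iso k)"
proof (induction k)
  case 0
  have "ftor_power 0 (tangent \<X>) = id_ftor"
    by (simp add: ftor_power_def id_ftor_def id_def)
  with unit_iso show ?case by simp
next
  case (Suc k)
  let ?A = "weil_tpow k" and ?P = "ftor_power k (tangent \<X>)"
  note A = weil_obj_tpow[of k]
  interpret T: cat_functor \<X> \<X> "T_fun \<X> W"
    by (rule T_fun_functor[OF weil_obj_W])
  interpret S: cat_functor \<X> \<X> "T_fun \<X> (weil_tpow (Suc k))"
    by (rule T_fun_functor[OF weil_obj_tpow])
  interpret A: cat_functor \<X> \<X> "T_fun \<X> ?A"
    by (rule T_fun_functor[OF A])
  have nt: "natural_transformation \<X> \<X> ?P (T_fun \<X> ?A) (tpow_iso k)"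
    using Suc.IH by (simp add: natural_isomorphism_def)
  interpret P: cat_functor \<X> \<X> ?P
    using nt by unfold_locales (simp add: natural_transformation_def)
  have i: "tpow_iso k Y \<in> Arr \<X>" "Dom \<X> (tpow_iso k Y) = FO ?P Y" "Cod \<X> (tpow_iso k Y) = FO (T_fun \<X> ?A) Y"
    if "Y \<in> Obj \<X>" for Y
    using nt that by (auto simp: natural_transformation_def Hom_def)
  have nat: "tpow_iso k (Cod \<X> f) \<odot> FA ?P f = FA (T_fun \<X> ?A) f \<odot> tpow_iso k (Dom \<X> f)" if "f \<in> Arr \<X>" for f
    using nt that by (simp add: natural_transformation_def)
  have inv: "\<exists>g. inverse_arrows \<X> (tpow_iso k Y) g" if "Y \<in> Obj \<X>" for Y
    using Suc.IH that by (simp add: natural_isomorphism_def)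
  note m = mult[OF weil_obj_W A]
  have PS: "ftor_power (Suc k) (tangent \<X>) = T_fun \<X> W \<circ>\<^sub>F ?P"
    by (simp add: ftor_power_Suc tangent_def)
  have "natural_transformation \<X> \<X> (T_fun \<X> W \<circ>\<^sub>F ?P) (T_fun \<X> (weil_tpow (Suc k))) (tpow_iso (Suc k))"
    unfolding natural_transformation_def
  proof (intro conjI ballI)
    show "is_functor \<X> \<X> (T_fun \<X> W \<circ>\<^sub>F ?P)"
      by (rule comp_is_functor[OF P.is_ftor T.is_ftor])
    show "is_functor \<X> \<X> (T_fun \<X> (weil_tpow (Suc k)))"
      by (rule S.is_ftor)
    fix Y assume "Y \<in> Obj \<X>"
    with i m show "tpow_iso (Suc k) Y \<in> Hom \<X> (FO (T_fun \<X> W \<circ>\<^sub>F ?P) Y) (FO (T_fun \<X> (weil_tpow (Suc k))) Y)"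
      by (simp add: Hom_def comp_ftor_def comp_arr T.map_arr)
  next
    fix f assume f: "f \<in> Arr \<X>"
    then have o: "Dom \<X> f \<in> Obj \<X>" "Cod \<X> f \<in> Obj \<X>"
      by (simp_all add: dom_obj cod_obj)
    have "(mult_iso \<X> (W, ?A, Cod \<X> f) \<odot> FA (T_fun \<X> W) (tpow_iso k (Cod \<X> f))) \<odot> FA (T_fun \<X> W) (FA ?P f) =
        mult_iso \<X> (W, ?A, Cod \<X> f) \<odot> FA (T_fun \<X> W) (tpow_iso k (Cod \<X> f) \<odot> FA ?P f)"
      using f o i m by (simp add: assoc T.map_arr P.map_arr T.map_comp)
    also have "\<dots> = (mult_iso \<X> (W, ?A, Cod \<X> f) \<odot> FA (T_fun \<X> W) (FA (T_fun \<X> ?A) f)) \<odot> FA (T_fun \<X> W) (tpow_iso k (Dom \<X> f))"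
      unfolding nat[OF f] using f o i m by (simp add: assoc T.map_arr A.map_arr T.map_comp)
    also have "\<dots> = FA (T_fun \<X> (weil_tpow (Suc k))) f \<odot> mult_iso \<X> (W, ?A, Dom \<X> f) \<odot> FA (T_fun \<X> W) (tpow_iso k (Dom \<X> f))"
      unfolding mult_natural[OF weil_obj_W A f] using f o i m S.map_arr[OF f] by (simp add: assoc T.map_arr)
    finally show "tpow_iso (Suc k) (Cod \<X> f) \<odot> FA (T_fun \<X> W \<circ>\<^sub>F ?P) f =
        FA (T_fun \<X> (weil_tpow (Suc k))) f \<odot> tpow_iso (Suc k) (Dom \<X> f)"
      by (simp add: comp_ftor_def)
  qed
  moreover have "\<exists>g. inverse_arrows \<X> (tpow_iso (Suc k) Y) g" if Y: "Y \<in> Obj \<X>" for Y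
  proof -
    obtain g where g: "inverse_arrows \<X> (tpow_iso k Y) g"
      using inv[OF Y] by blast
    have "inverse_arrows \<X> (mult_iso \<X> (W, ?A, Y) \<odot> FA (T_fun \<X> W) (tpow_iso k Y))
        (FA (T_fun \<X> W) g \<odot> inv_arr \<X> (mult_iso \<X> (W, ?A, Y)))"
      by (rule inverse_arrows_comp[OF T.map_inverse[OF g] m(4)[OF Y]]) (simp add: m[OF Y] i[OF Y] T.map_arr)
    then show ?thesis
      by auto
  qed
  ultimately show ?case
    unfolding natural_isomorphism_def PS by blast
qed

lemma p_arr:
  assumes "Y \<in> Obj \<X>"
  shows "tangent_p \<X> Y \<in> Arr \<X>" "Dom \<X> (tangent_p \<X> Y) = FO (tangent \<X>) Y" "Cod \<X> (tangent_p \<X> Y) = Y"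
  using T_nat_arr[OF weil_p_hom assms] unit[OF assms] inverse_arrowsD[OF unit(4)[OF assms]]
  by (simp_all add: tangent_p_def tangent_def comp_arr)

lemma zero_arr:
  assumes "Y \<in> Obj \<X>"
  shows "tangent_0 \<X> Y \<in> Arr \<X>" "Dom \<X> (tangent_0 \<X> Y) = Y" "Cod \<X> (tangent_0 \<X> Y) = FO (tangent \<X>) Y"
  using T_nat_arr[OF weil_0_hom assms] unit[OF assms]
  by (simp_all add: tangent_0_def tangent_def comp_arr)

lemma zero_natural:
  assumes f: "f \<in> Arr \<X>"
  shows "tangent_0 \<X> (Cod \<X> f) \<odot> f = FA (tangent \<X>) f \<odot> tangent_0 \<X> (Dom \<X> f)"
proof -
  have o: "Dom \<X> f \<in> Obj \<X>" "Cod \<X> f \<in> Obj \<X>"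
    using f by (simp_all add: dom_obj cod_obj)
  interpret N: cat_functor \<X> \<X> "T_fun \<X> \<N>"
    by (rule T_fun_functor[OF weil_obj_unit])
  interpret T: cat_functor \<X> \<X> "T_fun \<X> W"
    by (rule T_fun_functor[OF weil_obj_W])
  note t = T_nat_arr[OF weil_0_hom]
  have "tangent_0 \<X> (Cod \<X> f) \<odot> f = T_nat \<X> weil_0 (Cod \<X> f) \<odot> unit_iso \<X> (Cod \<X> f) \<odot> f"
    using f o t unit by (simp add: tangent_0_def assoc)
  also have "\<dots> = (T_nat \<X> weil_0 (Cod \<X> f) \<odot> FA (T_fun \<X> \<N>) f) \<odot> unit_iso \<X> (Dom \<X> f)"
    using f o t unit by (simp add: unit_natural assoc N.map_arr)
  also have "\<dots> = FA (tangent \<X>) f \<odot> tangent_0 \<X> (Dom \<X> f)"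
    using f o t unit by (simp add: T_nat_natural[OF weil_0_hom] assoc T.map_arr tangent_0_def tangent_def)
  finally show ?thesis .
qed

lemma l_arr:
  assumes "Y \<in> Obj \<X>"
  shows "tangent_l \<X> Y \<in> Arr \<X>" "Dom \<X> (tangent_l \<X> Y) = FO (tangent \<X>) Y" "Cod \<X> (tangent_l \<X> Y) = FO (tangent \<X>) (FO (tangent \<X>) Y)"
  using T_nat_arr[OF weil_l_hom assms] mult[OF weil_obj_W weil_obj_W assms] inverse_arrowsD[OF mult(4)[OF weil_obj_W weil_obj_W assms]]
  by (simp_all add: tangent_l_def tangent_def comp_arr)

end

text \<open>The fibre product \<open>T\<^sub>2 Y\<close> of the tangent bundle with itself.  Comparing with \<open>T\<^sub>p\<close> instead of
  \<open>tangent_p\<close> is harmless, as they differ by an isomorphism.\<close>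

lemma (in tangent_actegory) tangent_proj_pullback:
  assumes "Y \<in> Obj \<X>"
  shows "is_pullback \<X> (tangent_proj \<X> 1 Y) (tangent_proj \<X> 2 Y) (T_nat \<X> weil_p Y) (T_nat \<X> weil_p Y)"
proof -
  have "weil_bang W = weil_p"
    by (simp add: weil_bang_def weil_p_def)
  with tensor_product_pullback[OF weil_obj_unit weil_pow2_product assms] show ?thesis
    by (simp add: weil_tensor_unit_left[OF weil_proj(1)] weil_tensor_unit_left[OF weil_p_hom] tangent_proj_def)
qed

context oplax_weil_linear_functor
begin

sublocale F: cat_functor \<X> \<X>' F
  by unfold_locales (rule is_functor)

lemma alpha_arr:
  assumes "A \<in> Obj Weil" "Y \<in> Obj \<X>"
  shows "\<alpha> (A, Y) \<in> Arr \<X>'" "Dom \<X>' (\<alpha> (A, Y)) = FO F (FO (T_fun \<X> A) Y)" "Cod \<X>' (\<alpha> (A, Y)) = FO (T_fun \<X>' A) (FO F Y)"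
proof -
  have "(A, Y) \<in> Obj (prod_cat Weil \<X>)"
    using assms by (simp add: prod_cat_def)
  then have "\<alpha> (A, Y) \<in> Hom \<X>' (FO (F \<circ>\<^sub>F act \<X>) (A, Y)) (FO (act \<X>' \<circ>\<^sub>F (id_ftor \<times>\<^sub>F F)) (A, Y))"
    using natural unfolding natural_transformation_def by blast
  then show "\<alpha> (A, Y) \<in> Arr \<X>'" "Dom \<X>' (\<alpha> (A, Y)) = FO F (FO (T_fun \<X> A) Y)" "Cod \<X>' (\<alpha> (A, Y)) = FO (T_fun \<X>' A) (FO F Y)"
    by (simp_all add: Hom_def comp_ftor_def prod_ftor_def id_ftor_def T_fun_def)
qed

lemma alpha_natural:
  assumes "\<theta> \<in> Hom Weil A B" "f \<in> Arr \<X>"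
  shows "\<alpha> (B, Cod \<X> f) \<odot>\<^bsub>\<X>'\<^esub> FA F (FA (act \<X>) (\<theta>, f)) = FA (act \<X>') (\<theta>, FA F f) \<odot>\<^bsub>\<X>'\<^esub> \<alpha> (A, Dom \<X> f)"
proof -
  have x: "(\<theta>, f) \<in> Arr (prod_cat Weil \<X>)" "Dom (prod_cat Weil \<X>) (\<theta>, f) = (A, Dom \<X> f)" "Cod (prod_cat Weil \<X>) (\<theta>, f) = (B, Cod \<X> f)"
    using assms by (simp_all add: prod_cat_def Hom_def)
  have "\<forall>x\<in>Arr (prod_cat Weil \<X>). \<alpha> (Cod (prod_cat Weil \<X>) x) \<odot>\<^bsub>\<X>'\<^esub> FA (F \<circ>\<^sub>F act \<X>) x =
      FA (act \<X>' \<circ>\<^sub>F (id_ftor \<times>\<^sub>F F)) x \<odot>\<^bsub>\<X>'\<^esub> \<alpha> (Dom (prod_cat Weil \<X>) x)"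
    using natural unfolding natural_transformation_def by blast
  from bspec[OF this x(1)] show ?thesis
    unfolding x(2,3) by (simp add: comp_ftor_def prod_ftor_def id_ftor_def)
qed

lemma alpha_natural_arr:
  assumes "A \<in> Obj Weil" "f \<in> Arr \<X>"
  shows "\<alpha> (A, Cod \<X> f) \<odot>\<^bsub>\<X>'\<^esub> FA F (FA (T_fun \<X> A) f) = FA (T_fun \<X>' A) (FA F f) \<odot>\<^bsub>\<X>'\<^esub> \<alpha> (A, Dom \<X> f)"
  using alpha_natural[OF weil_id_hom[OF assms(1)] assms(2)] by (simp add: T_fun_def)

lemma alpha_natural_weil:
  assumes "\<theta> \<in> Hom Weil A B" "Y \<in> Obj \<X>"
  shows "\<alpha> (B, Y) \<odot>\<^bsub>\<X>'\<^esub> FA F (T_nat \<X> \<theta> Y) = T_nat \<X>' \<theta> (FO F Y) \<odot>\<^bsub>\<X>'\<^esub> \<alpha> (A, Y)"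
  using alpha_natural[OF assms(1), of "Id \<X> Y"] assms(2) by (simp add: T_nat_def source.id_arr F.map_id)

end

section \<open>Oplax functors and the tangent structure\<close>

context oplax_weil_linear_functor
begin

text \<open>Compatibility with the unit determines \<open>\<alpha>\<close> at \<open>\<N>\<close>, to which naturality at \<open>p : W \<rightarrow> \<N>\<close> reduces
  the claim.\<close>

lemma alpha_p:
  assumes Y: "Y \<in> Obj \<X>"
  shows "tangent_p \<X>' (FO F Y) \<odot>\<^bsub>\<X>'\<^esub> \<alpha> (W, Y) = FA F (tangent_p \<X> Y)"
proof -
  note FY = F.map_obj[OF Y]
  note u = source.unit[OF Y] and u' = target.unit[OF FY]
  note iu = source.inverse_arrowsD[OF u(4)] and iu' = target.inverse_arrowsD[OF u'(4)]
  note t = source.T_nat_arr[OF weil_p_hom Y] and t' = target.T_nat_arr[OF weil_p_hom FY]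
  note aW = alpha_arr[OF weil_obj_W Y] and aN = alpha_arr[OF weil_obj_unit Y]
  note Fu = F.map_inverse[OF u(4)]
  have "(\<alpha> (\<N>, Y) \<odot>\<^bsub>\<X>'\<^esub> FA F (unit_iso \<X> Y)) \<odot>\<^bsub>\<X>'\<^esub> FA F (inv_arr \<X> (unit_iso \<X> Y)) = \<alpha> (\<N>, Y)"
    by (rule target.inverse_cancel_right(2)[OF Fu]) (use aN u in \<open>simp_all add: F.map_arr\<close>)
  then have aN_eq: "\<alpha> (\<N>, Y) = unit_iso \<X>' (FO F Y) \<odot>\<^bsub>\<X>'\<^esub> FA F (inv_arr \<X> (unit_iso \<X> Y))"
    unfolding unit_compat[OF Y] by simp
  have "tangent_p \<X>' (FO F Y) \<odot>\<^bsub>\<X>'\<^esub> \<alpha> (W, Y) =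
      inv_arr \<X>' (unit_iso \<X>' (FO F Y)) \<odot>\<^bsub>\<X>'\<^esub> \<alpha> (\<N>, Y) \<odot>\<^bsub>\<X>'\<^esub> FA F (T_nat \<X> weil_p Y)"
    unfolding alpha_natural_weil[OF weil_p_hom Y] tangent_p_def
    using t' aW u' iu' by (simp add: target.assoc)
  also have "\<dots> = FA F (inv_arr \<X> (unit_iso \<X> Y)) \<odot>\<^bsub>\<X>'\<^esub> FA F (T_nat \<X> weil_p Y)"
    unfolding aN_eq using iu t u u' by (simp add: target.assoc target.comp_arr F.map_arr target.inverse_cancel(1)[OF u'(4)])
  finally show ?thesis
    using iu t u by (simp add: tangent_p_def F.map_comp)
qed

lemma alpha_0:
  assumes Y: "Y \<in> Obj \<X>"
  shows "\<alpha> (W, Y) \<odot>\<^bsub>\<X>'\<^esub> FA F (tangent_0 \<X> Y) = tangent_0 \<X>' (FO F Y)"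
proof -
  note FY = F.map_obj[OF Y]
  note u = source.unit[OF Y] and u' = target.unit[OF FY]
  note t = source.T_nat_arr[OF weil_0_hom Y] and t' = target.T_nat_arr[OF weil_0_hom FY]
  note aW = alpha_arr[OF weil_obj_W Y] and aN = alpha_arr[OF weil_obj_unit Y]
  have "\<alpha> (W, Y) \<odot>\<^bsub>\<X>'\<^esub> FA F (tangent_0 \<X> Y) =
      (\<alpha> (W, Y) \<odot>\<^bsub>\<X>'\<^esub> FA F (T_nat \<X> weil_0 Y)) \<odot>\<^bsub>\<X>'\<^esub> FA F (unit_iso \<X> Y)"
    using t u aW by (simp add: tangent_0_def F.map_comp F.map_arr target.assoc)
  also have "\<dots> = T_nat \<X>' weil_0 (FO F Y) \<odot>\<^bsub>\<X>'\<^esub> \<alpha> (\<N>, Y) \<odot>\<^bsub>\<X>'\<^esub> FA F (unit_iso \<X> Y)"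
    unfolding alpha_natural_weil[OF weil_0_hom Y] using t' u aN by (simp add: F.map_arr target.assoc)
  finally show ?thesis
    unfolding unit_compat[OF Y] tangent_0_def .
qed

text \<open>Compatibility with \<open>W \<otimes> W\<close> rewrites \<open>\<alpha>\<close> at the tensor product as two applications of \<open>\<alpha>\<close>
  at \<open>W\<close>; the structure isomorphisms cancel those inside \<open>tangent_l\<close>.\<close>

lemma alpha_l:
  assumes Y: "Y \<in> Obj \<X>"
  shows "tangent_l \<X>' (FO F Y) \<odot>\<^bsub>\<X>'\<^esub> \<alpha> (W, Y) =
    (FA (tangent \<X>') (\<alpha> (W, Y)) \<odot>\<^bsub>\<X>'\<^esub> \<alpha> (W, FO (tangent \<X>) Y)) \<odot>\<^bsub>\<X>'\<^esub> FA F (tangent_l \<X> Y)"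
proof -
  note FY = F.map_obj[OF Y] and Ws = weil_obj_W weil_obj_W
  interpret T: cat_functor \<X> \<X> "T_fun \<X> W"
    by (rule source.T_fun_functor[OF weil_obj_W])
  interpret T': cat_functor \<X>' \<X>' "T_fun \<X>' W"
    by (rule target.T_fun_functor[OF weil_obj_W])
  note m = source.mult[OF Ws Y] and m' = target.mult[OF Ws FY]
  note im = source.inverse_arrowsD[OF m(4)] and im' = target.inverse_arrowsD[OF m'(4)]
  note t = source.T_nat_arr[OF weil_l_hom Y] and t' = target.T_nat_arr[OF weil_l_hom FY]
  note aW = alpha_arr[OF weil_obj_W Y] and aWW = alpha_arr[OF weil_obj_tensor[OF Ws] Y]
    and aT = alpha_arr[OF weil_obj_W T.map_obj[OF Y]]
  note Fm = F.map_inverse[OF m(4)]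
  let ?b = "FA (T_fun \<X>' W) (\<alpha> (W, Y)) \<odot>\<^bsub>\<X>'\<^esub> \<alpha> (W, FO (T_fun \<X> W) Y)"
  have b: "?b \<in> Arr \<X>'" "Dom \<X>' ?b = FO F (FO (T_fun \<X> W) (FO (T_fun \<X> W) Y))" "Cod \<X>' ?b = FO (T_fun \<X>' W) (FO (T_fun \<X>' W) (FO F Y))"
    using aW aT by (simp_all add: target.comp_arr T'.map_arr)
  have "(\<alpha> (W \<otimes>\<^sub>W W, Y) \<odot>\<^bsub>\<X>'\<^esub> FA F (mult_iso \<X> (W, W, Y))) \<odot>\<^bsub>\<X>'\<^esub> FA F (inv_arr \<X> (mult_iso \<X> (W, W, Y))) = \<alpha> (W \<otimes>\<^sub>W W, Y)"
    by (rule target.inverse_cancel_right(2)[OF Fm]) (use aWW m in \<open>simp_all add: F.map_arr\<close>)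
  then have aWW_eq: "\<alpha> (W \<otimes>\<^sub>W W, Y) = (mult_iso \<X>' (W, W, FO F Y) \<odot>\<^bsub>\<X>'\<^esub> ?b) \<odot>\<^bsub>\<X>'\<^esub> FA F (inv_arr \<X> (mult_iso \<X> (W, W, Y)))"
    unfolding mult_compat[OF Ws Y] by simp
  have "tangent_l \<X>' (FO F Y) \<odot>\<^bsub>\<X>'\<^esub> \<alpha> (W, Y) =
      inv_arr \<X>' (mult_iso \<X>' (W, W, FO F Y)) \<odot>\<^bsub>\<X>'\<^esub> \<alpha> (W \<otimes>\<^sub>W W, Y) \<odot>\<^bsub>\<X>'\<^esub> FA F (T_nat \<X> weil_l Y)"
    unfolding alpha_natural_weil[OF weil_l_hom Y] tangent_l_def
    using t' aW m' im' by (simp add: target.assoc)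
  also have "\<dots> = ?b \<odot>\<^bsub>\<X>'\<^esub> FA F (inv_arr \<X> (mult_iso \<X> (W, W, Y))) \<odot>\<^bsub>\<X>'\<^esub> FA F (T_nat \<X> weil_l Y)"
    unfolding aWW_eq using im im' t m m' b aW aT
    by (simp add: target.assoc target.comp_arr F.map_arr T'.map_arr target.inverse_cancel(1)[OF m'(4)])
  finally show ?thesis
    using im t m by (simp add: tangent_l_def tangent_def F.map_comp)
qed

lemma alpha_natural_arr_comp:
  assumes A: "A \<in> Obj Weil" and f: "f \<in> Arr \<X>" and x: "x \<in> Arr \<X>" "Cod \<X> x = FO (T_fun \<X> A) (Dom \<X> f)"
  shows "FA (T_fun \<X>' A) (FA F f) \<odot>\<^bsub>\<X>'\<^esub> \<alpha> (A, Dom \<X> f) \<odot>\<^bsub>\<X>'\<^esub> FA F x =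
    \<alpha> (A, Cod \<X> f) \<odot>\<^bsub>\<X>'\<^esub> FA F (FA (T_fun \<X> A) f \<odot>\<^bsub>\<X>\<^esub> x)"
proof -
  interpret T: cat_functor \<X> \<X> "T_fun \<X> A"
    by (rule source.T_fun_functor[OF A])
  interpret T': cat_functor \<X>' \<X>' "T_fun \<X>' A"
    by (rule target.T_fun_functor[OF A])
  have o: "Dom \<X> f \<in> Obj \<X>" "Cod \<X> f \<in> Obj \<X>"
    using f by (simp_all add: source.dom_obj source.cod_obj)
  have "FA (T_fun \<X>' A) (FA F f) \<odot>\<^bsub>\<X>'\<^esub> \<alpha> (A, Dom \<X> f) \<odot>\<^bsub>\<X>'\<^esub> FA F x =
      (FA (T_fun \<X>' A) (FA F f) \<odot>\<^bsub>\<X>'\<^esub> \<alpha> (A, Dom \<X> f)) \<odot>\<^bsub>\<X>'\<^esub> FA F x"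
    using alpha_arr[OF A o(1)] f x by (simp add: target.assoc F.map_arr T'.map_arr)
  also have "\<dots> = \<alpha> (A, Cod \<X> f) \<odot>\<^bsub>\<X>'\<^esub> FA F (FA (T_fun \<X> A) f \<odot>\<^bsub>\<X>\<^esub> x)"
    unfolding alpha_natural_arr[OF A f, symmetric]
    using alpha_arr[OF A o(2)] f x by (simp add: target.assoc F.map_arr T.map_arr F.map_comp)
  finally show ?thesis .
qed

lemma alpha_natural_weil_comp:
  assumes \<theta>: "\<theta> \<in> Hom Weil A B" and Y: "Y \<in> Obj \<X>" and x: "x \<in> Arr \<X>" "Cod \<X> x = FO (T_fun \<X> A) Y"
  shows "T_nat \<X>' \<theta> (FO F Y) \<odot>\<^bsub>\<X>'\<^esub> \<alpha> (A, Y) \<odot>\<^bsub>\<X>'\<^esub> FA F x = \<alpha> (B, Y) \<odot>\<^bsub>\<X>'\<^esub> FA F (T_nat \<X> \<theta> Y \<odot>\<^bsub>\<X>\<^esub> x)"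
proof -
  have AB: "A \<in> Obj Weil" "B \<in> Obj Weil"
    using \<theta> by (auto simp: weil_hom_iff)
  note t = source.T_nat_arr[OF \<theta> Y] and t' = target.T_nat_arr[OF \<theta> F.map_obj[OF Y]]
  have "T_nat \<X>' \<theta> (FO F Y) \<odot>\<^bsub>\<X>'\<^esub> \<alpha> (A, Y) \<odot>\<^bsub>\<X>'\<^esub> FA F x =
      (T_nat \<X>' \<theta> (FO F Y) \<odot>\<^bsub>\<X>'\<^esub> \<alpha> (A, Y)) \<odot>\<^bsub>\<X>'\<^esub> FA F x"
    using alpha_arr[OF AB(1) Y] t' x by (simp add: target.assoc F.map_arr)
  also have "\<dots> = \<alpha> (B, Y) \<odot>\<^bsub>\<X>'\<^esub> FA F (T_nat \<X> \<theta> Y \<odot>\<^bsub>\<X>\<^esub> x)"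
    unfolding alpha_natural_weil[OF \<theta> Y, symmetric]
    using alpha_arr[OF AB(2) Y] t x by (simp add: target.assoc F.map_arr F.map_comp)
  finally show ?thesis .
qed

lemma preserves_pullbacks_over_tangent_power:
  assumes pres: "\<And>A. A \<in> Obj Weil \<Longrightarrow> preserves_pullbacks_over \<X> \<X>' (T_fun \<X>' A \<circ>\<^sub>F F) S"
  shows "preserves_pullbacks_over \<X> \<X>' (ftor_power k (tangent \<X>') \<circ>\<^sub>F F) S"
  by (rule preserves_pullbacks_over_iso[OF source.category_axioms target.category_axioms
        natural_isomorphism_precomp[OF is_functor target.tpow_iso] pres[OF weil_obj_tpow]])

end

section \<open>The image of a differential bundle\<close>

text \<open>A functor that preserves pullbacks over the base of a differential bundle, as a lax differential
  functor does over the terminal object.\<close>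

locale differential_bundle_image = oplax_weil_linear_functor \<X> \<X>' F \<alpha> + source: tangent_actegory \<X> + target: tangent_actegory \<X>'
  for \<X> :: "('o, 'm, 'y) wact_scheme" and \<X>' :: "('p, 'n, 'z) wact_scheme"
    and F :: "('o, 'm, 'p, 'n) ftor" and \<alpha> :: "weil_obj \<times> 'o \<Rightarrow> 'n" +
  fixes B :: "('o, 'm) bundle_data" and l :: 'm
  assumes B: "differential_bundle \<X> B l"
    and pres: "\<And>A. A \<in> Obj Weil \<Longrightarrow> preserves_pullbacks_over \<X> \<X>' (T_fun \<X>' A \<circ>\<^sub>F F) (Base B)"
begin

sublocale T: cat_functor \<X> \<X> "tangent \<X>"
  unfolding tangent_def by (rule source.T_fun_functor[OF weil_obj_W])

sublocale T': cat_functor \<X>' \<X>' "tangent \<X>'"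
  unfolding tangent_def by (rule target.T_fun_functor[OF weil_obj_W])

abbreviation "E \<equiv> Tot B"
abbreviation "M \<equiv> Base B"
abbreviation "q \<equiv> Proj B"
abbreviation "p1 \<equiv> Fst B"
abbreviation "p2 \<equiv> Snd B"
abbreviation "l' \<equiv> \<alpha> (W, E) \<odot>\<^bsub>\<X>'\<^esub> FA F l"

lemma additive: "additive_bundle \<X> B"
  using B by (simp add: differential_bundle_def)

lemma bundle_arrows:
  shows "q \<in> Arr \<X>" "Dom \<X> q = E" "Cod \<X> q = M"
    and "p1 \<in> Arr \<X>" "Dom \<X> p1 = Pow2 B" "Cod \<X> p1 = E"
    and "p2 \<in> Arr \<X>" "Dom \<X> p2 = Pow2 B" "Cod \<X> p2 = E"
    and "Plus B \<in> Arr \<X>" "Dom \<X> (Plus B) = Pow2 B" "Cod \<X> (Plus B) = E"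
    and "Zero B \<in> Arr \<X>" "Dom \<X> (Zero B) = M" "Cod \<X> (Zero B) = E"
    and "l \<in> Arr \<X>" "Dom \<X> l = E" "Cod \<X> l = FO (tangent \<X>) E"
  using B by (simp_all add: differential_bundle_def additive_bundle_def Hom_def)

lemma bundle_objects: "E \<in> Obj \<X>" "M \<in> Obj \<X>" "Pow2 B \<in> Obj \<X>"
  using source.dom_obj[OF bundle_arrows(1)] source.cod_obj[OF bundle_arrows(1)] source.dom_obj[OF bundle_arrows(4)] bundle_arrows by simp_all

lemma pullback_E2: "is_pullback \<X> p1 p2 q q"
  using additive unfolding additive_bundle_def by blast

lemma q_p12: "q \<odot>\<^bsub>\<X>\<^esub> p1 = q \<odot>\<^bsub>\<X>\<^esub> p2"
  by (rule source.is_pullbackD(9)[OF pullback_E2])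

lemma pullback_powers_exist: "\<exists>P b \<pi>. is_pullback_power \<X> q n P b \<pi>"
  using additive by (simp add: additive_bundle_def)

lemma ftor_power_0: "ftor_power 0 G = id_ftor" and ftor_power_1: "ftor_power 1 G = G"
  by (simp_all add: ftor_power_def id_ftor_def)

text \<open>The case \<open>k = 1\<close>, \<open>n = 2\<close> of the preservation of pullback powers, in the form of a square.\<close>

lemma pullback_TE2: "is_pullback \<X> (FA (tangent \<X>) p1) (FA (tangent \<X>) p2) (FA (tangent \<X>) q) (FA (tangent \<X>) q)"
proof -
  have "\<forall>n P b \<pi>. is_pullback_power \<X> q n P b \<pi> \<longrightarrow>
      (\<forall>k. let Tk = ftor_power k (tangent \<X>) in
        is_pullback_power \<X> (FA Tk q) n (FO Tk P) (FA Tk b) (\<lambda>i. FA Tk (\<pi> i)))"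
    using B unfolding differential_bundle_def by blast
  from this[rule_format, OF source.is_pullback_power_2[OF pullback_E2], of 1]
  have "is_pullback_power \<X> (FA (tangent \<X>) q) 2 (FO (tangent \<X>) (Dom \<X> p1)) (FA (tangent \<X>) (q \<odot>\<^bsub>\<X>\<^esub> p1))
      (\<lambda>i. FA (tangent \<X>) (if i = 0 then p1 else p2))"
    unfolding ftor_power_1 Let_def .
  from source.is_pullback_power_2_pullback[OF this] show ?thesis
    by simp
qed

lemma pres_power: "preserves_pullbacks_over \<X> \<X>' (ftor_power k (tangent \<X>') \<circ>\<^sub>F F) M"
  by (rule preserves_pullbacks_over_tangent_power[OF pres])

lemma pres_F: "preserves_pullbacks_over \<X> \<X>' F M"
proof -
  have "ftor_power 0 (tangent \<X>') \<circ>\<^sub>F F = F"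
    by (simp add: ftor_power_0 comp_ftor_def id_ftor_def)
  with pres_power[of 0] show ?thesis
    by simp
qed

lemma pullback_T'FE2: "is_pullback \<X>' (FA (tangent \<X>') (FA F p1)) (FA (tangent \<X>') (FA F p2))
    (FA (tangent \<X>') (FA F q)) (FA (tangent \<X>') (FA F q))"
  using pres[OF weil_obj_W] pullback_E2 bundle_arrows(3)
  unfolding preserves_pullbacks_over_def by (simp add: comp_ftor_def tangent_def)

lemma l'_arr: "l' \<in> Arr \<X>'" "Dom \<X>' l' = FO F E" "Cod \<X>' l' = FO (tangent \<X>') (FO F E)"
  using alpha_arr[OF weil_obj_W bundle_objects(1)] bundle_arrows by (simp_all add: target.comp_arr F.map_arr tangent_def)

lemma l'_comp: "\<lbrakk>x \<in> Arr \<X>; Cod \<X> x = E\<rbrakk> \<Longrightarrow> l' \<odot>\<^bsub>\<X>'\<^esub> FA F x = \<alpha> (W, E) \<odot>\<^bsub>\<X>'\<^esub> FA F (l \<odot>\<^bsub>\<X>\<^esub> x)"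
  using alpha_arr[OF weil_obj_W bundle_objects(1)] bundle_arrows by (simp add: target.assoc F.map_arr F.map_comp tangent_def)

text \<open>The additivity of the lift over \<open>T(q)\<close> and the upper side of the lift square both have the form
  \<open>T(\<sigma>) \<circ> \<langle>a, b\<rangle>\<close>; naturality of \<open>\<alpha>\<close> carries such an arrow from the source to the target.\<close>

lemma T_pairing:
  assumes ab: "a \<in> Arr \<X>" "b \<in> Arr \<X>" "Dom \<X> b = Dom \<X> a" "Cod \<X> a = FO (tangent \<X>) E" "Cod \<X> b = FO (tangent \<X>) E"
    "FA (tangent \<X>) q \<odot>\<^bsub>\<X>\<^esub> a = FA (tangent \<X>) q \<odot>\<^bsub>\<X>\<^esub> b"
  shows "FA (tangent \<X>') (FA F (Plus B)) \<odot>\<^bsub>\<X>'\<^esub> pairing \<X>' (FA (tangent \<X>') (FA F p1)) (FA (tangent \<X>') (FA F p2))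
      (\<alpha> (W, E) \<odot>\<^bsub>\<X>'\<^esub> FA F a) (\<alpha> (W, E) \<odot>\<^bsub>\<X>'\<^esub> FA F b) =
    \<alpha> (W, E) \<odot>\<^bsub>\<X>'\<^esub> FA F (FA (tangent \<X>) (Plus B) \<odot>\<^bsub>\<X>\<^esub> pairing \<X> (FA (tangent \<X>) p1) (FA (tangent \<X>) p2) a b)"
proof -
  have *: "Cod \<X> a = Dom \<X> (FA (tangent \<X>) q)" "Cod \<X> b = Dom \<X> (FA (tangent \<X>) q)"
    using ab bundle_arrows by (simp_all add: T.map_arr)
  note pr = source.pairing[OF pullback_TE2 ab(1-3) * ab(6)]
  let ?pr = "pairing \<X> (FA (tangent \<X>) p1) (FA (tangent \<X>) p2) a b"
  have cod: "Cod \<X> ?pr = FO (tangent \<X>) (Pow2 B)"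
    using pr bundle_arrows by (simp add: T.map_arr)
  note al = alpha_arr[OF weil_obj_W bundle_objects(3), folded tangent_def] alpha_arr[OF weil_obj_W bundle_objects(1), folded tangent_def]
  note nat = alpha_natural_arr_comp[OF weil_obj_W _ pr(1), folded tangent_def]
  have "pairing \<X>' (FA (tangent \<X>') (FA F p1)) (FA (tangent \<X>') (FA F p2))
      (\<alpha> (W, E) \<odot>\<^bsub>\<X>'\<^esub> FA F a) (\<alpha> (W, E) \<odot>\<^bsub>\<X>'\<^esub> FA F b) = \<alpha> (W, Pow2 B) \<odot>\<^bsub>\<X>'\<^esub> FA F ?pr"
  proof (rule target.pairing_eqI[OF pullback_T'FE2])
    show "FA (tangent \<X>') (FA F p1) \<odot>\<^bsub>\<X>'\<^esub> \<alpha> (W, Pow2 B) \<odot>\<^bsub>\<X>'\<^esub> FA F ?pr = \<alpha> (W, E) \<odot>\<^bsub>\<X>'\<^esub> FA F a"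
      using nat[of p1] pr cod bundle_arrows by simp
    show "FA (tangent \<X>') (FA F p2) \<odot>\<^bsub>\<X>'\<^esub> \<alpha> (W, Pow2 B) \<odot>\<^bsub>\<X>'\<^esub> FA F ?pr = \<alpha> (W, E) \<odot>\<^bsub>\<X>'\<^esub> FA F b"
      using nat[of p2] pr cod bundle_arrows by simp
  qed (use al pr cod ab bundle_arrows in \<open>simp_all add: target.comp_arr F.map_arr T'.map_arr\<close>)
  then show ?thesis
    using nat[of "Plus B"] pr cod bundle_arrows by simp
qed

lemma lift_over_base:
  shows "FA (tangent \<X>) q \<odot>\<^bsub>\<X>\<^esub> l = tangent_0 \<X> M \<odot>\<^bsub>\<X>\<^esub> q"
    and "tangent_p \<X> E \<odot>\<^bsub>\<X>\<^esub> l = Zero B \<odot>\<^bsub>\<X>\<^esub> q"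
  using B by (simp_all add: differential_bundle_def additive_bundle_morphism_def map_bundle_def tangent_bundle_def)

lemma lift_additive_map:
  "additive_bundle_morphism \<X>' (map_bundle F B) (map_bundle (tangent \<X>') (map_bundle F B)) l' (tangent_0 \<X>' (FO F M))"
proof -
  have mor: "l \<odot>\<^bsub>\<X>\<^esub> Plus B = FA (tangent \<X>) (Plus B) \<odot>\<^bsub>\<X>\<^esub> pairing \<X> (FA (tangent \<X>) p1) (FA (tangent \<X>) p2) (l \<odot>\<^bsub>\<X>\<^esub> p1) (l \<odot>\<^bsub>\<X>\<^esub> p2)"
     "l \<odot>\<^bsub>\<X>\<^esub> Zero B = FA (tangent \<X>) (Zero B) \<odot>\<^bsub>\<X>\<^esub> tangent_0 \<X> M"
    using B by (simp_all add: differential_bundle_def additive_bundle_morphism_def map_bundle_def)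
  note z = source.zero_arr[OF bundle_objects(2)] and z' = target.zero_arr[OF F.map_obj[OF bundle_objects(2)]]
  note nat = alpha_natural_arr_comp[OF weil_obj_W, folded tangent_def]
  note aM = alpha_arr[OF weil_obj_W bundle_objects(2), folded tangent_def]
  have "FA (tangent \<X>') (FA F q) \<odot>\<^bsub>\<X>'\<^esub> l' = \<alpha> (W, M) \<odot>\<^bsub>\<X>'\<^esub> FA F (tangent_0 \<X> M \<odot>\<^bsub>\<X>\<^esub> q)"
    using nat[of q l] bundle_arrows lift_over_base(1) by simp
  also have "\<dots> = (\<alpha> (W, M) \<odot>\<^bsub>\<X>'\<^esub> FA F (tangent_0 \<X> M)) \<odot>\<^bsub>\<X>'\<^esub> FA F q"
    using bundle_arrows z aM by (simp add: F.map_comp F.map_arr target.assoc)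
  finally have 1: "FA (tangent \<X>') (FA F q) \<odot>\<^bsub>\<X>'\<^esub> l' = tangent_0 \<X>' (FO F M) \<odot>\<^bsub>\<X>'\<^esub> FA F q"
    unfolding alpha_0[OF bundle_objects(2)] .
  have "FA (tangent \<X>) q \<odot>\<^bsub>\<X>\<^esub> l \<odot>\<^bsub>\<X>\<^esub> p1 = FA (tangent \<X>) q \<odot>\<^bsub>\<X>\<^esub> l \<odot>\<^bsub>\<X>\<^esub> p2"
  proof -
    have "FA (tangent \<X>) q \<odot>\<^bsub>\<X>\<^esub> l \<odot>\<^bsub>\<X>\<^esub> x = tangent_0 \<X> M \<odot>\<^bsub>\<X>\<^esub> q \<odot>\<^bsub>\<X>\<^esub> x" if "x \<in> Arr \<X>" "Cod \<X> x = E" for x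
      using source.assoc[of x l "FA (tangent \<X>) q"] source.assoc[of x q "tangent_0 \<X> M"] that bundle_arrows z lift_over_base(1)
      by (simp add: T.map_arr)
    then show ?thesis
      using bundle_arrows q_p12 by simp
  qed
  then have 2: "l' \<odot>\<^bsub>\<X>'\<^esub> FA F (Plus B) = FA (tangent \<X>') (FA F (Plus B)) \<odot>\<^bsub>\<X>'\<^esub>
      pairing \<X>' (FA (tangent \<X>') (FA F p1)) (FA (tangent \<X>') (FA F p2)) (l' \<odot>\<^bsub>\<X>'\<^esub> FA F p1) (l' \<odot>\<^bsub>\<X>'\<^esub> FA F p2)"
    using bundle_arrows by (simp add: l'_comp mor(1) T_pairing source.comp_arr)
  have "l' \<odot>\<^bsub>\<X>'\<^esub> FA F (Zero B) = FA (tangent \<X>') (FA F (Zero B)) \<odot>\<^bsub>\<X>'\<^esub> \<alpha> (W, M) \<odot>\<^bsub>\<X>'\<^esub> FA F (tangent_0 \<X> M)"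
    using nat[of "Zero B" "tangent_0 \<X> M"] bundle_arrows z by (simp add: l'_comp mor(2))
  then have 3: "l' \<odot>\<^bsub>\<X>'\<^esub> FA F (Zero B) = FA (tangent \<X>') (FA F (Zero B)) \<odot>\<^bsub>\<X>'\<^esub> tangent_0 \<X>' (FO F M)"
    unfolding alpha_0[OF bundle_objects(2)] .
  show ?thesis
    unfolding additive_bundle_morphism_def using 1 2 3 l'_arr z'
    by (simp add: map_bundle_def Hom_def)
qed

text \<open>Here the pairings go into \<open>T\<^sub>2\<close>, and the comparison is \<open>\<alpha>\<close> at \<open>W\<^sup>2\<close>, natural with respect to the
  projections and the addition of \<open>Weil\<close>.\<close>

lemma lift_additive_tangent:
  "additive_bundle_morphism \<X>' (map_bundle F B) (tangent_bundle \<X>' (FO F E)) l' (FA F (Zero B))"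
proof -
  have mor: "l \<odot>\<^bsub>\<X>\<^esub> Plus B = T_nat \<X> weil_plus E \<odot>\<^bsub>\<X>\<^esub>
      pairing \<X> (T_nat \<X> (weil_proj 1) E) (T_nat \<X> (weil_proj 2) E) (l \<odot>\<^bsub>\<X>\<^esub> p1) (l \<odot>\<^bsub>\<X>\<^esub> p2)"
     "l \<odot>\<^bsub>\<X>\<^esub> Zero B = tangent_0 \<X> E \<odot>\<^bsub>\<X>\<^esub> Zero B"
  proof -
    have "additive_bundle_morphism \<X> B (tangent_bundle \<X> E) l (Zero B)"
      using B unfolding differential_bundle_def by blast
    then show "l \<odot>\<^bsub>\<X>\<^esub> Plus B = T_nat \<X> weil_plus E \<odot>\<^bsub>\<X>\<^esub>
        pairing \<X> (T_nat \<X> (weil_proj 1) E) (T_nat \<X> (weil_proj 2) E) (l \<odot>\<^bsub>\<X>\<^esub> p1) (l \<odot>\<^bsub>\<X>\<^esub> p2)"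
      "l \<odot>\<^bsub>\<X>\<^esub> Zero B = tangent_0 \<X> E \<odot>\<^bsub>\<X>\<^esub> Zero B"
      by (simp_all add: additive_bundle_morphism_def tangent_bundle_def tangent_plus_def tangent_proj_def)
  qed
  note FE = F.map_obj[OF bundle_objects(1)]
  note p = source.p_arr[OF bundle_objects(1)] and p' = target.p_arr[OF FE]
  note z = source.zero_arr[OF bundle_objects(1)] and z' = target.zero_arr[OF FE]
  note a = alpha_arr[OF weil_obj_W bundle_objects(1), folded tangent_def] and a2 = alpha_arr[OF weil_obj_pow bundle_objects(1), of 2]
  note tp = source.T_nat_arr[OF weil_p_hom bundle_objects(1), folded tangent_def]
  note u = source.unit[OF bundle_objects(1)]
  note iu = source.inverse_arrowsD[OF u(4)]
  have "tangent_p \<X>' (FO F E) \<odot>\<^bsub>\<X>'\<^esub> l' = (tangent_p \<X>' (FO F E) \<odot>\<^bsub>\<X>'\<^esub> \<alpha> (W, E)) \<odot>\<^bsub>\<X>'\<^esub> FA F l"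
    using bundle_arrows p' a by (simp add: target.assoc F.map_arr)
  also have "\<dots> = FA F (Zero B) \<odot>\<^bsub>\<X>'\<^esub> FA F q"
    unfolding alpha_p[OF bundle_objects(1)] using bundle_arrows p lift_over_base(2) by (simp flip: F.map_comp)
  finally have 1: "tangent_p \<X>' (FO F E) \<odot>\<^bsub>\<X>'\<^esub> l' = FA F (Zero B) \<odot>\<^bsub>\<X>'\<^esub> FA F q" .
  have "T_nat \<X> weil_p E \<odot>\<^bsub>\<X>\<^esub> l \<odot>\<^bsub>\<X>\<^esub> p1 = T_nat \<X> weil_p E \<odot>\<^bsub>\<X>\<^esub> l \<odot>\<^bsub>\<X>\<^esub> p2"
  proof -
    have *: "T_nat \<X> weil_p E = unit_iso \<X> E \<odot>\<^bsub>\<X>\<^esub> tangent_p \<X> E"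
      using tp u iu by (simp add: tangent_p_def source.inverse_cancel[OF u(4)])
    have "T_nat \<X> weil_p E \<odot>\<^bsub>\<X>\<^esub> l \<odot>\<^bsub>\<X>\<^esub> x = unit_iso \<X> E \<odot>\<^bsub>\<X>\<^esub> Zero B \<odot>\<^bsub>\<X>\<^esub> q \<odot>\<^bsub>\<X>\<^esub> x" if "x \<in> Arr \<X>" "Cod \<X> x = E" for x
      unfolding * using source.assoc[of x l "tangent_p \<X> E"] source.assoc[of x q "Zero B"] that bundle_arrows p u lift_over_base(2)
      by (simp add: source.assoc source.comp_arr)
    then show ?thesis
      using bundle_arrows q_p12 by simp
  qed
  then have ab: "l \<odot>\<^bsub>\<X>\<^esub> p1 \<in> Arr \<X>" "l \<odot>\<^bsub>\<X>\<^esub> p2 \<in> Arr \<X>" "Dom \<X> (l \<odot>\<^bsub>\<X>\<^esub> p2) = Dom \<X> (l \<odot>\<^bsub>\<X>\<^esub> p1)"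
    "Cod \<X> (l \<odot>\<^bsub>\<X>\<^esub> p1) = Dom \<X> (T_nat \<X> weil_p E)" "Cod \<X> (l \<odot>\<^bsub>\<X>\<^esub> p2) = Dom \<X> (T_nat \<X> weil_p E)"
    "T_nat \<X> weil_p E \<odot>\<^bsub>\<X>\<^esub> l \<odot>\<^bsub>\<X>\<^esub> p1 = T_nat \<X> weil_p E \<odot>\<^bsub>\<X>\<^esub> l \<odot>\<^bsub>\<X>\<^esub> p2"
    using bundle_arrows tp by (simp_all add: source.comp_arr)
  note pr = source.pairing[OF source.tangent_proj_pullback[OF bundle_objects(1), unfolded tangent_proj_def] ab]
  let ?pr = "pairing \<X> (T_nat \<X> (weil_proj 1) E) (T_nat \<X> (weil_proj 2) E) (l \<odot>\<^bsub>\<X>\<^esub> p1) (l \<odot>\<^bsub>\<X>\<^esub> p2)"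
  have cod: "Cod \<X> ?pr = FO (T_fun \<X> (weil_pow 2)) E"
    using pr source.T_nat_arr[OF weil_proj(1) bundle_objects(1)] by simp
  note nat = alpha_natural_weil_comp[OF _ bundle_objects(1) pr(1) cod]
  have "pairing \<X>' (T_nat \<X>' (weil_proj 1) (FO F E)) (T_nat \<X>' (weil_proj 2) (FO F E)) (l' \<odot>\<^bsub>\<X>'\<^esub> FA F p1) (l' \<odot>\<^bsub>\<X>'\<^esub> FA F p2) =
      \<alpha> (weil_pow 2, E) \<odot>\<^bsub>\<X>'\<^esub> FA F ?pr"
  proof (rule target.pairing_eqI[OF target.tangent_proj_pullback[OF FE, unfolded tangent_proj_def]])
    show "T_nat \<X>' (weil_proj 1) (FO F E) \<odot>\<^bsub>\<X>'\<^esub> \<alpha> (weil_pow 2, E) \<odot>\<^bsub>\<X>'\<^esub> FA F ?pr = l' \<odot>\<^bsub>\<X>'\<^esub> FA F p1"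
      unfolding nat[OF weil_proj(1)] pr(4) using bundle_arrows by (simp add: l'_comp)
    show "T_nat \<X>' (weil_proj 2) (FO F E) \<odot>\<^bsub>\<X>'\<^esub> \<alpha> (weil_pow 2, E) \<odot>\<^bsub>\<X>'\<^esub> FA F ?pr = l' \<odot>\<^bsub>\<X>'\<^esub> FA F p2"
      unfolding nat[OF weil_proj(1)] pr(5) using bundle_arrows by (simp add: l'_comp)
  qed (use a2 pr cod bundle_arrows l'_arr target.T_nat_arr[OF weil_proj(1) FE] in \<open>simp_all add: target.comp_arr source.comp_arr F.map_arr\<close>)
  then have 2: "l' \<odot>\<^bsub>\<X>'\<^esub> FA F (Plus B) = T_nat \<X>' weil_plus (FO F E) \<odot>\<^bsub>\<X>'\<^esub>
      pairing \<X>' (T_nat \<X>' (weil_proj 1) (FO F E)) (T_nat \<X>' (weil_proj 2) (FO F E)) (l' \<odot>\<^bsub>\<X>'\<^esub> FA F p1) (l' \<odot>\<^bsub>\<X>'\<^esub> FA F p2)"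
    using bundle_arrows nat[OF weil_plus_hom] l'_comp[of "Plus B"] by (simp add: mor(1))
  have "l' \<odot>\<^bsub>\<X>'\<^esub> FA F (Zero B) = (\<alpha> (W, E) \<odot>\<^bsub>\<X>'\<^esub> FA F (tangent_0 \<X> E)) \<odot>\<^bsub>\<X>'\<^esub> FA F (Zero B)"
  proof -
    have "l' \<odot>\<^bsub>\<X>'\<^esub> FA F (Zero B) = \<alpha> (W, E) \<odot>\<^bsub>\<X>'\<^esub> FA F (tangent_0 \<X> E \<odot>\<^bsub>\<X>\<^esub> Zero B)"
      using bundle_arrows by (simp add: l'_comp flip: mor(2))
    then show ?thesis
      using bundle_arrows z a by (simp add: F.map_comp F.map_arr target.assoc)
  qed
  then have 3: "l' \<odot>\<^bsub>\<X>'\<^esub> FA F (Zero B) = tangent_0 \<X>' (FO F E) \<odot>\<^bsub>\<X>'\<^esub> FA F (Zero B)"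
    unfolding alpha_0[OF bundle_objects(1)] .
  show ?thesis
    unfolding additive_bundle_morphism_def using 1 2 3 l'_arr bundle_arrows
    by (simp add: map_bundle_def tangent_bundle_def tangent_plus_def tangent_proj_def Hom_def F.map_arr)
qed

lemma lift_coassoc: "tangent_l \<X>' (FO F E) \<odot>\<^bsub>\<X>'\<^esub> l' = FA (tangent \<X>') l' \<odot>\<^bsub>\<X>'\<^esub> l'"
proof -
  have coassoc: "tangent_l \<X> E \<odot>\<^bsub>\<X>\<^esub> l = FA (tangent \<X>) l \<odot>\<^bsub>\<X>\<^esub> l"
    using B by (simp add: differential_bundle_def)
  note FE = F.map_obj[OF bundle_objects(1)] and TE = T.map_obj[OF bundle_objects(1)]
  note a = alpha_arr[OF weil_obj_W bundle_objects(1), folded tangent_def] and aT = alpha_arr[OF weil_obj_W TE, folded tangent_def]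
  note tl = source.l_arr[OF bundle_objects(1)] and tl' = target.l_arr[OF FE]
  have "tangent_l \<X>' (FO F E) \<odot>\<^bsub>\<X>'\<^esub> l' = (tangent_l \<X>' (FO F E) \<odot>\<^bsub>\<X>'\<^esub> \<alpha> (W, E)) \<odot>\<^bsub>\<X>'\<^esub> FA F l"
    using bundle_arrows a tl' by (simp add: target.assoc F.map_arr)
  also have "\<dots> = FA (tangent \<X>') (\<alpha> (W, E)) \<odot>\<^bsub>\<X>'\<^esub> \<alpha> (W, FO (tangent \<X>) E) \<odot>\<^bsub>\<X>'\<^esub> FA F (FA (tangent \<X>) l \<odot>\<^bsub>\<X>\<^esub> l)"
    unfolding alpha_l[OF bundle_objects(1)] coassoc[symmetric]
    using bundle_arrows a aT tl by (simp add: target.assoc target.comp_arr F.map_arr T'.map_arr F.map_comp)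
  also have "\<dots> = FA (tangent \<X>') (\<alpha> (W, E)) \<odot>\<^bsub>\<X>'\<^esub> FA (tangent \<X>') (FA F l) \<odot>\<^bsub>\<X>'\<^esub> l'"
    using alpha_natural_arr_comp[OF weil_obj_W, folded tangent_def, of l l] bundle_arrows by simp
  also have "\<dots> = FA (tangent \<X>') l' \<odot>\<^bsub>\<X>'\<^esub> l'"
    using bundle_arrows a l'_arr by (simp add: T'.map_comp T'.map_arr F.map_arr target.assoc)
  finally show ?thesis .
qed

text \<open>Both \<open>0 : M \<rightarrow> TM\<close> and the upper side of the lift square are invertible, so the image of
  that square can be pasted to the naturality square of \<open>\<alpha>\<close>.  By naturality the outer sides of the result
  are the ones required.\<close>

lemma lift_universal:
  assumes terms: "terminal \<X> M" "terminal \<X> (FO (tangent \<X>) M)"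
    and nat_pb: "is_pullback \<X>' (\<alpha> (W, E)) (FA F (FA (tangent \<X>) q)) (FA (tangent \<X>') (FA F q)) (\<alpha> (W, M))"
  shows "is_pullback \<X>'
      (FA (tangent \<X>') (FA F (Plus B)) \<odot>\<^bsub>\<X>'\<^esub>
        pairing \<X>' (FA (tangent \<X>') (FA F p1)) (FA (tangent \<X>') (FA F p2))
          (l' \<odot>\<^bsub>\<X>'\<^esub> FA F p1) (tangent_0 \<X>' (FO F E) \<odot>\<^bsub>\<X>'\<^esub> FA F p2))
      (FA F q \<odot>\<^bsub>\<X>'\<^esub> FA F p1) (FA (tangent \<X>') (FA F q)) (tangent_0 \<X>' (FO F M))"
proof -
  let ?\<mu> = "FA (tangent \<X>) (Plus B) \<odot>\<^bsub>\<X>\<^esub> pairing \<X> (FA (tangent \<X>) p1) (FA (tangent \<X>) p2)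
    (l \<odot>\<^bsub>\<X>\<^esub> p1) (tangent_0 \<X> E \<odot>\<^bsub>\<X>\<^esub> p2)"
  have pb: "is_pullback \<X> ?\<mu> (q \<odot>\<^bsub>\<X>\<^esub> p1) (FA (tangent \<X>) q) (tangent_0 \<X> M)"
    using B by (simp add: differential_bundle_def)
  note z = source.zero_arr[OF bundle_objects(2)] and zE = source.zero_arr[OF bundle_objects(1)]
  note a = alpha_arr[OF weil_obj_W bundle_objects(1), folded tangent_def]
  obtain g where g: "g \<in> Arr \<X>" "Dom \<X> g = FO (tangent \<X>) M" "Cod \<X> g = M"
    using terms T.map_obj[OF bundle_objects(2)] unfolding terminal_def Hom_def by blast
  have uniq: "f = h" if "terminal \<X> Z" "f \<in> Arr \<X>" "h \<in> Arr \<X>" "Dom \<X> f = Dom \<X> h" "Cod \<X> f = Z" "Cod \<X> h = Z" for Z f h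
    using that source.dom_obj[of f] unfolding terminal_def Hom_def by auto
  have "inverse_arrows \<X> (tangent_0 \<X> M) g"
    unfolding inverse_arrows_def Hom_def using z g T.map_obj[OF bundle_objects(2)] bundle_objects
    by (auto simp: source.id_arr source.comp_arr intro: uniq[OF terms(1)] uniq[OF terms(2)])
  then obtain g where g: "inverse_arrows \<X> (tangent_0 \<X> M) g" ..
  obtain h where h: "inverse_arrows \<X> ?\<mu> h"
    using source.pullback_of_iso[OF pb g] by blast
  note d = source.is_pullbackD[OF pb]
  have cod: "Cod \<X> ?\<mu> = FO (tangent \<X>) E"
    using d bundle_arrows by (simp add: T.map_arr)
  have "is_pullback \<X>' (\<alpha> (W, E) \<odot>\<^bsub>\<X>'\<^esub> FA F ?\<mu>) (FA F (q \<odot>\<^bsub>\<X>\<^esub> p1)) (FA (tangent \<X>') (FA F q)) (\<alpha> (W, M) \<odot>\<^bsub>\<X>'\<^esub> FA F (tangent_0 \<X> M))"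
  proof (rule target.pullback_precomp_iso[OF nat_pb F.map_inverse[OF h] F.map_inverse[OF g]])
    show "FA F (FA (tangent \<X>) q) \<odot>\<^bsub>\<X>'\<^esub> FA F ?\<mu> = FA F (tangent_0 \<X> M) \<odot>\<^bsub>\<X>'\<^esub> FA F (q \<odot>\<^bsub>\<X>\<^esub> p1)"
      using d by (simp flip: F.map_comp)
  qed (use d z cod a alpha_arr[OF weil_obj_W bundle_objects(2), folded tangent_def] in \<open>simp_all add: F.map_arr\<close>)
  moreover have "\<alpha> (W, E) \<odot>\<^bsub>\<X>'\<^esub> FA F ?\<mu> = FA (tangent \<X>') (FA F (Plus B)) \<odot>\<^bsub>\<X>'\<^esub>
        pairing \<X>' (FA (tangent \<X>') (FA F p1)) (FA (tangent \<X>') (FA F p2))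
          (l' \<odot>\<^bsub>\<X>'\<^esub> FA F p1) (tangent_0 \<X>' (FO F E) \<odot>\<^bsub>\<X>'\<^esub> FA F p2)"
  proof -
    have "FA (tangent \<X>) q \<odot>\<^bsub>\<X>\<^esub> l \<odot>\<^bsub>\<X>\<^esub> p1 = (tangent_0 \<X> M \<odot>\<^bsub>\<X>\<^esub> q) \<odot>\<^bsub>\<X>\<^esub> p1"
      using bundle_arrows by (simp add: T.map_arr flip: source.assoc lift_over_base(1))
    also have "\<dots> = (tangent_0 \<X> M \<odot>\<^bsub>\<X>\<^esub> q) \<odot>\<^bsub>\<X>\<^esub> p2"
      using bundle_arrows z q_p12 by (simp add: source.assoc)
    also have "\<dots> = FA (tangent \<X>) q \<odot>\<^bsub>\<X>\<^esub> tangent_0 \<X> E \<odot>\<^bsub>\<X>\<^esub> p2"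
      using source.zero_natural[OF bundle_arrows(1)] bundle_arrows zE by (simp add: source.assoc T.map_arr)
    finally have eq: "FA (tangent \<X>) q \<odot>\<^bsub>\<X>\<^esub> l \<odot>\<^bsub>\<X>\<^esub> p1 = FA (tangent \<X>) q \<odot>\<^bsub>\<X>\<^esub> tangent_0 \<X> E \<odot>\<^bsub>\<X>\<^esub> p2" .
    have "tangent_0 \<X>' (FO F E) \<odot>\<^bsub>\<X>'\<^esub> FA F p2 = \<alpha> (W, E) \<odot>\<^bsub>\<X>'\<^esub> FA F (tangent_0 \<X> E \<odot>\<^bsub>\<X>\<^esub> p2)"
      unfolding alpha_0[OF bundle_objects(1), symmetric] using bundle_arrows zE a by (simp add: F.map_comp F.map_arr target.assoc)
    with eq show ?thesis
      using bundle_arrows zE by (simp add: l'_comp T_pairing source.comp_arr)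
  qed
  ultimately show ?thesis
    using bundle_arrows by (simp add: alpha_0[OF bundle_objects(2)] F.map_comp)
qed

text \<open>The given power is isomorphic to the image of a power of \<open>q\<close>, and the statement is invariant under
  this isomorphism.\<close>

lemma powers_preserved:
  assumes pow: "is_pullback_power \<X>' (FA F q) n P b \<pi>"
  shows "is_pullback_power \<X>' (FA (ftor_power k (tangent \<X>')) (FA F q)) n (FO (ftor_power k (tangent \<X>')) P)
    (FA (ftor_power k (tangent \<X>')) b) (\<lambda>i. FA (ftor_power k (tangent \<X>')) (\<pi> i))"
proof -
  let ?Tk = "ftor_power k (tangent \<X>')"
  interpret Tk: cat_functor \<X>' \<X>' ?Tk
    using target.tpow_iso[of k] by unfold_locales (simp add: natural_isomorphism_def natural_transformation_def)
  interpret TkF: cat_functor \<X> \<X>' "?Tk \<circ>\<^sub>F F"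
    by unfold_locales (rule comp_is_functor[OF is_functor Tk.is_ftor])
  obtain Q c \<rho> where \<rho>: "is_pullback_power \<X> q n Q c \<rho>"
    using pullback_powers_exist by blast
  have F\<rho>: "is_pullback_power \<X>' (FA F q) n (FO F Q) (FA F c) (\<lambda>i. FA F (\<rho> i))"
    by (rule F.map_pullback_power[OF _ pullback_powers_exist \<rho>]) (simp add: bundle_arrows pres_F)
  have "is_pullback_power \<X>' (FA (?Tk \<circ>\<^sub>F F) q) n (FO (?Tk \<circ>\<^sub>F F) Q) (FA (?Tk \<circ>\<^sub>F F) c) (\<lambda>i. FA (?Tk \<circ>\<^sub>F F) (\<rho> i))"
    by (rule TkF.map_pullback_power[OF _ pullback_powers_exist \<rho>]) (simp add: bundle_arrows pres_power)
  then have Tk\<rho>: "is_pullback_power \<X>' (FA ?Tk (FA F q)) n (FO ?Tk (FO F Q)) (FA ?Tk (FA F c)) (\<lambda>i. FA ?Tk (FA F (\<rho> i)))"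
    by (simp add: comp_ftor_def)
  obtain e e' where e: "inverse_arrows \<X>' e e'" "Dom \<X>' e = P" "Cod \<X>' e = FO F Q" "FA F c \<odot>\<^bsub>\<X>'\<^esub> e = b" "\<forall>i<n. FA F (\<rho> i) \<odot>\<^bsub>\<X>'\<^esub> e = \<pi> i"
    using target.is_pullback_power_unique[OF F\<rho> pow] by blast
  note ie = target.inverse_arrowsD[OF e(1)] and d = target.is_pullback_powerD[OF F\<rho>]
  have "is_pullback_power \<X>' (FA ?Tk (FA F q)) n (Dom \<X>' (FA ?Tk e)) (FA ?Tk (FA F c) \<odot>\<^bsub>\<X>'\<^esub> FA ?Tk e)
      (\<lambda>i. FA ?Tk (FA F (\<rho> i)) \<odot>\<^bsub>\<X>'\<^esub> FA ?Tk e)"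
    by (rule target.is_pullback_power_iso[OF Tk\<rho> Tk.map_inverse[OF e(1)]]) (use e ie in \<open>simp add: Tk.map_arr\<close>)
  moreover have "Dom \<X>' (FA ?Tk e) = FO ?Tk P" "FA ?Tk (FA F c) \<odot>\<^bsub>\<X>'\<^esub> FA ?Tk e = FA ?Tk b"
    using e ie d by (simp_all add: Tk.map_arr flip: Tk.map_comp)
  moreover have "FA ?Tk (FA F (\<rho> i)) \<odot>\<^bsub>\<X>'\<^esub> FA ?Tk e = FA ?Tk (\<pi> i)" if "i < n" for i
    using e ie d that by (simp flip: Tk.map_comp)
  ultimately show ?thesis
    using target.is_pullback_power_cong by simp
qed

lemma image_differential_bundle:
  assumes "terminal \<X> M" "terminal \<X> (FO (tangent \<X>) M)"
    and "is_pullback \<X>' (\<alpha> (W, E)) (FA F (FA (tangent \<X>) q)) (FA (tangent \<X>') (FA F q)) (\<alpha> (W, M))"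
  shows "differential_bundle \<X>' (map_bundle F B) l'"
proof -
  have mb: "Tot (map_bundle F B) = FO F E" "Base (map_bundle F B) = FO F M" "Proj (map_bundle F B) = FA F q"
    "Fst (map_bundle F B) = FA F p1" "Snd (map_bundle F B) = FA F p2" "Plus (map_bundle F B) = FA F (Plus B)"
    "Zero (map_bundle F B) = FA F (Zero B)"
    by (simp_all add: map_bundle_def)
  show ?thesis
    unfolding differential_bundle_def mb Let_def
  proof (intro conjI allI impI)
    show "additive_bundle \<X>' (map_bundle F B)"
      by (rule F.map_additive_bundle[OF pres_F additive])
    show "l' \<in> Hom \<X>' (FO F E) (FO (tangent \<X>') (FO F E))"
      using l'_arr by (simp add: Hom_def)
  qed (rule powers_preserved lift_additive_map lift_additive_tangent lift_coassoc lift_universal[OF assms] | assumption)+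
qed

end

theorem proposition4p5:
  fixes \<X> :: "('o, 'm, 'y) wact_scheme"
    and \<X>' :: "('p, 'n, 'z) wact_scheme"
    and F :: "('o, 'm, 'p, 'n) ftor"
    and \<alpha> :: "weil_obj \<times> 'o \<Rightarrow> 'n"
    and star X X2 :: 'o
    and bang p1 p2 \<sigma> \<zeta> l :: 'm
  assumes "tangent_actegory \<X>"
    and "tangent_actegory \<X>'"
    and "terminal \<X> star"
    and "terminal \<X> (FO (tangent \<X>) star)"
    and "oplax_weil_linear_functor \<X> \<X>' F \<alpha>"
    and "differential_object \<X>
      \<lparr> Tot = X, Base = star, Proj = bang, Pow2 = X2, Fst = p1, Snd = p2, Plus = \<sigma>, Zero = \<zeta> \<rparr> l"
  shows "(lax_differential_functor \<X> \<X>' star F \<alpha> \<longrightarrow>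
      differential_bundle \<X>'
        \<lparr> Tot = FO F X, Base = FO F star, Proj = FA F bang, Pow2 = FO F X2, Fst = FA F p1,
          Snd = FA F p2, Plus = FA F \<sigma>, Zero = FA F \<zeta> \<rparr>
        (\<alpha> (W, X) \<odot>\<^bsub>\<X>'\<^esub> FA F l)) \<and>
    (strong_differential_functor \<X> \<X>' star F \<alpha> \<longrightarrow>
      differential_object \<X>'
        \<lparr> Tot = FO F X, Base = FO F star, Proj = FA F bang, Pow2 = FO F X2, Fst = FA F p1,
          Snd = FA F p2, Plus = FA F \<sigma>, Zero = FA F \<zeta> \<rparr>
        (\<alpha> (W, X) \<odot>\<^bsub>\<X>'\<^esub> FA F l))"
proof -
  let ?lax = "lax_differential_functor \<X> \<X>' star F \<alpha>"
    and ?FB = "\<lparr> Tot = FO F X, Base = FO F star, Proj = FA F bang, Pow2 = FO F X2, Fst = FA F p1,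
      Snd = FA F p2, Plus = FA F \<sigma>, Zero = FA F \<zeta> \<rparr>"
    and ?l = "\<alpha> (W, X) \<odot>\<^bsub>\<X>'\<^esub> FA F l"
    and ?B = "\<lparr> Tot = X, Base = star, Proj = bang, Pow2 = X2, Fst = p1, Snd = p2, Plus = \<sigma>, Zero = \<zeta> \<rparr>"
  have image: "differential_bundle \<X>' ?FB ?l" if lax: "?lax"
  proof -
    interpret differential_bundle_image \<X> \<X>' F \<alpha> ?B l
      using assms lax
      by (simp add: differential_bundle_image_def differential_bundle_image_axioms_def differential_object_def lax_differential_functor_def)
    have "bang \<in> Arr \<X>" "Dom \<X> bang = X" "Cod \<X> bang = star"
      using bundle_arrows by simp_all
    then have "is_pullback \<X>' (\<alpha> (W, X)) (FA F (FA (tangent \<X>) bang)) (FA (tangent \<X>') (FA F bang)) (\<alpha> (W, star))"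
      using lax weil_obj_W unfolding lax_differential_functor_def tangent_def by blast
    then show ?thesis
      using image_differential_bundle assms(3,4) by (simp add: map_bundle_def)
  qed
  then show ?thesis
    by (simp add: strong_differential_functor_def differential_object_def)
qed

end
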